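(* Let $\mathbb{K}$ be a field of characteristic $0$, $\lambda\in\mathbb{K}$ nonzero, and let $(A,B,P)$ be a relative averaging algebra of weight $\lambda$. Then $(\delta_{\mathrm{rAvg}_\lambda})^2=0$; that is, $\{C^\bullet_{\mathrm{rAvg}_\lambda}(A,B,P),\delta_{\mathrm{rAvg}_\lambda}\}$ is a cochain complex.
   Context: Bimodules and operators. An associative $A$-bimodule is an associative algebra $B$ (product $xy$) with bilinear actions $a\cdot x$, $x\cdot a\in B$ such that $(ab)\cdot x=a\cdot(b\cdot x)$, $(a\cdot x)\cdot b=a\cdot(x\cdot b)$, $(x\cdot a)\cdot b=x\cdot(ab)$, $(xy)\cdot a=x(y\cdot a)$, $(x\cdot a)y=x(a\cdot y)$, $(a\cdot x)y=a\cdot(xy)$ for $a,b\in A$, $x,y\in B$. A relative averaging algebra of weight $\lambda$ is $(A,B,P)$ with $A$ an associative algebra, $B$ an associative $A$-bimodule, $P:B\to A$ linear with $P(x)P(y)=P(P(x)\cdot y)=P(x\cdot P(y))=\lambda P(xy)$. Trees. For $n\ge1$, $T_n$ is the set of planar rooted trees with $n+1$ leaves in which every internal vertex has at least two incoming edges; $T_0=\{|\}$. Leaves are labelled $0,\dots,n$ from left to right; deleting a leaf suppresses a vertex left with a single incoming edge. For $m,n\ge1$, $1\le i\le m$, $T\in T_{m+n-1}$: $R_0^{m;i,n}(T)\in T_m$ is obtained by deleting the leaves $i,\dots,i+n-2$, and $R_i^{m;i,n}(T)\in T_n$ by deleting all leaves except $i-1,\dots,i+n-1$. $T_1$ has one element.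 $T_2=\{T^{\dashv},T^{\vdash},T^{\perp}\}$: in $T^{\dashv}$ leaves 1,2 are joined at a vertex above the root vertex, in $T^{\vdash}$ leaves 0,1 are, and $T^{\perp}$ has one vertex with three leaves. Every $T\in T_n$ ($n\ge1$) is uniquely a grafting $T=T^{i_1-1}\vee\cdots\vee T^{i_k-1}$, $k\ge2$, with $T^{i_j-1}\in T_{i_j-1}$ (roots joined, left to right, to a new root vertex), where $i_1+\dots+i_k=n+1$. Graded Lie algebra. With $D=A\oplus B$, $C^n(D,D)=\mathrm{Hom}(\mathbb{K}[T_n]\otimes D^{\otimes n},D)$ and $\mathfrak{g}=\bigoplus_{n\ge0}C^{n+1}(D,D)$ ($C^{n+1}$ in degree $n$), with bracket, for $f\in C^m$, $g\in C^n$, $$[f,g]=\sum_{i=1}^m(-1)^{(i-1)(n-1)}f\circ_ig-(-1)^{(m-1)(n-1)}\sum_{i=1}^n(-1)^{(i-1)(m-1)}g\circ_if,$$ $$(f\circ_ig)(T;x_1,\dots,x_{m+n-1})=f\big(R_0^{m;i,n}(T);x_1,\dots,x_{i-1},g(R_i^{m;i,n}(T);x_i,\dots,x_{i+n-1}),x_{i+n},\dots,x_{m+n-1}\big).$$ $\mathcal{A}^{k,l}$ is the direct sum of all $(k+l)$-fold tensor products of $A$'s and $B$'s with $A$ appearing $k$ times and $B$ appearing $l$ times. $\mathfrak{a}=\bigoplus_{n\ge0}\mathrm{Hom}(\mathbb{K}[T_{n+1}]\otimes B^{\otimes n+1},A)\subset\mathfrak{g}$, $p:\mathfrak{g}\to\mathfrak{g}$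 is the projection onto $\mathfrak{a}$, and $\mathfrak{h}=\bigoplus_{n\ge0}\big(\mathrm{Hom}(\mathbb{K}[T_{n+1}]\otimes A^{\otimes n+1},A)\oplus\bigoplus_{k+l=n+1,\,k\ge0,\,l>0}\mathrm{Hom}(\mathbb{K}[T_{n+1}]\otimes\mathcal{A}^{k,l},B)\big)$. The element $\pi_\lambda\in\mathfrak{h}_1$: $\pi_\lambda(T^{\dashv};(a,x),(b,y))=(ab,x\cdot b)$, $\pi_\lambda(T^{\vdash};(a,x),(b,y))=(ab,a\cdot y)$, $\pi_\lambda(T^{\perp};(a,x),(b,y))=(ab,\lambda xy)$. $L_\infty$-structure on $s^{-1}\mathfrak{h}\oplus\mathfrak{a}$ (with $(s^{-1}\mathfrak{h})_n=\mathfrak{h}_{n+1}$; degree $1$ graded symmetric operations): $l_2((s^{-1}f,0),(s^{-1}g,0))=((-1)^{|f|}s^{-1}[f,g],0)$, $l_k((s^{-1}f,0),(0,h_1),\dots,(0,h_{k-1}))=(0,p[\cdots[[f,h_1],h_2],\dots,h_{k-1}])$ for $k\ge2$; up to permutation of inputs all other maps vanish. $\alpha=(s^{-1}\pi_\lambda,P)$ is a Maurer-Cartan element, and $l_1^{\alpha}(z)=\sum_{n\ge0}\frac1{n!}l_{n+1}(\alpha,\dots,\alpha,z)$ ($n$ copies of $\alpha$; a finite sum). Cochains. $C^0_{\mathrm{rAvg}_\lambda}(A,B,P)=0$, $C^1_{\mathrm{rAvg}_\lambda}(A,B,P)=\mathrm{Hom}(A,A)\oplus\mathrm{Hom}(B,B)$,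 and for $n\ge2$ $$C^n_{\mathrm{rAvg}_\lambda}(A,B,P)=\mathrm{Hom}(A^{\otimes n},A)\oplus\mathrm{Hom}(B^{\otimes n},B)\oplus\bigoplus_{k+l=n,\ k,l\ge1}\mathrm{Hom}(\mathcal{A}^{k,l},B)\oplus\mathrm{Hom}(\mathbb{K}[T_{n-1}]\otimes B^{\otimes n-1},A).$$ $(f,g)\in C^1$ is identified with $(s^{-1}(f+g),0)\in(s^{-1}\mathfrak{h}\oplus\mathfrak{a})_{-1}$, and $(f,g,h,\gamma)\in C^n$, $n\ge2$, with $(s^{-1}\pi_{f,g,h},\gamma)\in(s^{-1}\mathfrak{h}\oplus\mathfrak{a})_{n-2}$, where for $T=T^{i_1-1}\vee\cdots\vee T^{i_k-1}$ $$\pi_{f,g,h}(T;(a_1,x_1),\dots,(a_n,x_n))=\big(f(a_1,\dots,a_n),\ \lambda^{k-2}(g+h)(c_1,\dots,c_n)\big),$$ with $c_j=x_j$ if $j\in\{i_1,\,i_1+i_2,\,\dots,\,i_1+\cdots+i_{k-1}\}$ and $c_j=a_j$ otherwise ($g+h$ denotes $g$ on $B^{\otimes n}$ and the corresponding component of $h$ on mixed tensors). These identifications are embeddings, and through them $\delta_{\mathrm{rAvg}_\lambda}:C^n_{\mathrm{rAvg}_\lambda}\to C^{n+1}_{\mathrm{rAvg}_\lambda}$ is defined by $$\delta_{\mathrm{rAvg}_\lambda}(f,g)=-l_1^{(s^{-1}\pi_\lambda,P)}(s^{-1}(f+g),0),\qquad \delta_{\mathrm{rAvg}_\lambda}(f,g,h,\gamma)=(-1)^{n-2}\,l_1^{(s^{-1}\pi_\lambda,P)}(s^{-1}\pi_{f,g,h},\gamma)\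 \ (n\ge2).$$ *)

theory Defs
  imports Complex_Main "HOL-Library.Function_Algebras" "HOL-Library.Product_Plus"
    "HOL-Library.Groups_Big_Fun"
begin

section \<open>Relative averaging algebras\<close>

text \<open>Associative algebras are not assumed unital; the class \<^class>\<open>ring\<close> has no unit.\<close>

locale assoc_algebra = vector_space scale
  for scale :: "'k::field \<Rightarrow> 'a::ring \<Rightarrow> 'a" +
  assumes scale_mult_left: "scale c (x * y) = scale c x * y"
    and scale_mult_right: "scale c (x * y) = x * scale c y"

locale assoc_bimodule =
  A: assoc_algebra scaleA + B: assoc_algebra scaleB
  for scaleA :: "'k::field \<Rightarrow> 'a::ring \<Rightarrow> 'a"
    and scaleB :: "'k \<Rightarrow> 'b::ring \<Rightarrow> 'b" +
  fixes lact :: "'a \<Rightarrow> 'b \<Rightarrow> 'b" and ract :: "'b \<Rightarrow> 'a \<Rightarrow> 'b"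
  assumes lact_linear_left: "Vector_Spaces.linear scaleA scaleB (\<lambda>a. lact a x)"
    and lact_linear_right: "Vector_Spaces.linear scaleB scaleB (\<lambda>x. lact a x)"
    and ract_linear_left: "Vector_Spaces.linear scaleB scaleB (\<lambda>x. ract x a)"
    and ract_linear_right: "Vector_Spaces.linear scaleA scaleB (\<lambda>a. ract x a)"
    and lact_mult: "lact (a * b) x = lact a (lact b x)"
    and lact_ract: "ract (lact a x) b = lact a (ract x b)"
    and ract_mult: "ract (ract x a) b = ract x (a * b)"
    and mult_ract: "ract (x * y) a = x * ract y a"
    and ract_mult_lact: "ract x a * y = x * lact a y"
    and lact_mult_assoc: "lact a x * y = lact a (x * y)"

locale rel_averaging_algebra = assoc_bimodule scaleA scaleB lact ract
  for scaleA :: "'k::field \<Rightarrow> 'a::ring \<Rightarrow> 'a"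
    and scaleB :: "'k \<Rightarrow> 'b::ring \<Rightarrow> 'b"
    and lact :: "'a \<Rightarrow> 'b \<Rightarrow> 'b" and ract :: "'b \<Rightarrow> 'a \<Rightarrow> 'b" +
  fixes P :: "'b \<Rightarrow> 'a" and lam :: 'k
  assumes P_linear: "Vector_Spaces.linear scaleB scaleA P"
    and P_lact: "P x * P y = P (lact (P x) y)"
    and P_ract: "P x * P y = P (ract x (P y))"
    and P_weight: "P x * P y = scaleA lam (P (x * y))"


section \<open>Planar rooted trees\<close>

datatype ptree = Leaf | Node "ptree list"

fun leaves :: "ptree \<Rightarrow> nat" where
  "leaves Leaf = 1"
| "leaves (Node ts) = sum_list (map leaves ts)"

fun reduced :: "ptree \<Rightarrow> bool" where
  "reduced Leaf = True"
| "reduced (Node ts) = (2 \<le> length ts \<and> (\<forall>t\<in>set ts. reduced t))"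

definition trees :: "nat \<Rightarrow> ptree set" where
  "trees n = {T. reduced T \<and> leaves T = n + 1}"

text \<open>
  \<open>keep S k T\<close> deletes from \<open>T\<close>, whose leaves are labelled \<open>k, k+1, \<dots>\<close> from left to
  right, all leaves with a label outside \<open>S\<close>. A vertex left with one incoming edge is
  suppressed, and one left with no incoming edge disappears together with the leaves
  above it (\<open>None\<close>: nothing of the tree is left).
\<close>

fun graft :: "ptree list \<Rightarrow> ptree option" where
  "graft [] = None"
| "graft [t] = Some t"
| "graft (t # u # ts) = Some (Node (t # u # ts))"

fun keep :: "nat set \<Rightarrow> nat \<Rightarrow> ptree \<Rightarrow> ptree option"
  and keep_list :: "nat set \<Rightarrow> nat \<Rightarrow> ptree list \<Rightarrow> ptree list" where
  "keep S k Leaf = (if k \<in> S then Some Leaf else None)"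
| "keep S k (Node ts) = graft (keep_list S k ts)"
| "keep_list S k [] = []"
| "keep_list S k (t # ts) =
    (case keep S k t of None \<Rightarrow> [] | Some u \<Rightarrow> [u]) @ keep_list S (k + leaves t) ts"

text \<open>
  The trees $R_0^{m;i,n}(T)$ and $R_i^{m;i,n}(T)$ for $T \in T_{m+n-1}$; the index \<open>m\<close> is
  determined by \<open>T\<close> and \<open>n\<close>. The half-open interval is $\{i,\dots,i+n-2\}$.
\<close>

definition R_outer :: "nat \<Rightarrow> nat \<Rightarrow> ptree \<Rightarrow> ptree" where
  "R_outer i n T = the (keep (- {i..<i + n - 1}) 0 T)"

definition R_inner :: "nat \<Rightarrow> nat \<Rightarrow> ptree \<Rightarrow> ptree" where
  "R_inner i n T = the (keep {i - 1..i + n - 1} 0 T)"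

text \<open>
  For $T = T^{i_1-1} \vee \dots \vee T^{i_k-1}$ the subtree $T^{i_j-1}$ has $i_j$ leaves.
  \<open>arity_root T\<close> is $k$ and \<open>root_gaps T\<close> is $\{i_1, i_1+i_2, \dots, i_1+\dots+i_{k-1}\}$.
\<close>

fun arity_root :: "ptree \<Rightarrow> nat" where
  "arity_root Leaf = 0"
| "arity_root (Node ts) = length ts"

fun root_gaps :: "ptree \<Rightarrow> nat set" where
  "root_gaps Leaf = {}"
| "root_gaps (Node ts) = {sum_list (map leaves (take r ts)) | r. 1 \<le> r \<and> r < length ts}"


section \<open>Multilinear maps\<close>

text \<open>
  Linear maps out of a tensor product are encoded by the corresponding multilinear maps,
  taking the list of arguments; values on lists of the wrong length are 0, so that equality
  of maps is equality of functions.
\<close>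

definition multilinear ::
    "('k::field \<Rightarrow> 'v::ab_group_add \<Rightarrow> 'v) \<Rightarrow> ('k \<Rightarrow> 'w::ab_group_add \<Rightarrow> 'w) \<Rightarrow> nat
      \<Rightarrow> ('v list \<Rightarrow> 'w) set" where
  "multilinear sV sW n =
    {F. (\<forall>xs. length xs \<noteq> n \<longrightarrow> F xs = 0) \<and>
        (\<forall>xs i. length xs = n \<and> i < n \<longrightarrow> Vector_Spaces.linear sV sW (\<lambda>v. F (xs[i := v])))}"

text \<open>$\mathrm{Hom}(\mathbb{K}[T_n] \otimes V^{\otimes n}, W)$\<close>

definition tree_hom ::
    "('k::field \<Rightarrow> 'v::ab_group_add \<Rightarrow> 'v) \<Rightarrow> ('k \<Rightarrow> 'w::ab_group_add \<Rightarrow> 'w) \<Rightarrow> nat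
      \<Rightarrow> (ptree \<Rightarrow> 'v list \<Rightarrow> 'w) set" where
  "tree_hom sV sW n =
    {F. (\<forall>T. T \<notin> trees n \<longrightarrow> F T = 0) \<and> (\<forall>T\<in>trees n. F T \<in> multilinear sV sW n)}"

text \<open>
  A pure tensor in a summand of $\mathcal{A}^{k,l}$ is a word in \<open>'a + 'b\<close> with \<open>k\<close> letters
  \<open>Inl a\<close> and \<open>l\<close> letters \<open>Inr x\<close>; the pattern of \<open>Inl\<close>s and \<open>Inr\<close>s selects the summand.
\<close>

definition words_AB :: "nat \<Rightarrow> nat \<Rightarrow> ('a + 'b) list set" where
  "words_AB k l = {c. length (filter isl c) = k \<and> length (filter (\<lambda>u. \<not> isl u) c) = l}"

text \<open>$\bigoplus_{k+l=n,\ k,l \ge 1} \mathrm{Hom}(\mathcal{A}^{k,l}, B)$\<close>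

definition mixed_hom ::
    "('k::field \<Rightarrow> 'a::ab_group_add \<Rightarrow> 'a) \<Rightarrow> ('k \<Rightarrow> 'b::ab_group_add \<Rightarrow> 'b) \<Rightarrow> nat
      \<Rightarrow> (('a + 'b) list \<Rightarrow> 'b) set" where
  "mixed_hom sA sB n =
    {h. (\<forall>c. (\<nexists>k l. k + l = n \<and> 1 \<le> k \<and> 1 \<le> l \<and> c \<in> words_AB k l) \<longrightarrow> h c = 0) \<and>
        (\<forall>c i. length c = n \<and> i < n \<longrightarrow>
           Vector_Spaces.linear sA sB (\<lambda>a. h (c[i := Inl a])) \<and>
           Vector_Spaces.linear sB sB (\<lambda>x. h (c[i := Inr x])))}"


section \<open>The graded Lie algebra\<close>

type_synonym ('a, 'b) op = "ptree \<Rightarrow> ('a \<times> 'b) list \<Rightarrow> 'a \<times> 'b"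

definition scaleD :: "('k \<Rightarrow> 'a \<Rightarrow> 'a) \<Rightarrow> ('k \<Rightarrow> 'b \<Rightarrow> 'b) \<Rightarrow> 'k \<Rightarrow> 'a \<times> 'b \<Rightarrow> 'a \<times> 'b" where
  "scaleD sA sB c d = (sA c (fst d), sB c (snd d))"

text \<open>$C^n(D,D)$, the part of $\mathfrak{g}$ of degree $n-1$\<close>

definition Cspace ::
    "('k::field \<Rightarrow> 'a::ab_group_add \<Rightarrow> 'a) \<Rightarrow> ('k \<Rightarrow> 'b::ab_group_add \<Rightarrow> 'b) \<Rightarrow> nat
      \<Rightarrow> ('a, 'b) op set" where
  "Cspace sA sB n = tree_hom (scaleD sA sB) (scaleD sA sB) n"

text \<open>\<open>pm e x\<close> is $(-1)^e x$.\<close>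

definition pm :: "int \<Rightarrow> 'x::ab_group_add \<Rightarrow> 'x" where
  "pm e x = (if even e then x else - x)"

definition circ ::
    "nat \<Rightarrow> nat \<Rightarrow> nat \<Rightarrow> ('a, 'b) op \<Rightarrow> ('a, 'b) op \<Rightarrow> ('a::ab_group_add, 'b::ab_group_add) op" where
  "circ m n i f g = (\<lambda>T xs.
    if T \<in> trees (m + n - 1) \<and> length xs = m + n - 1
    then f (R_outer i n T)
           (take (i - 1) xs @ [g (R_inner i n T) (take n (drop (i - 1) xs))] @ drop (i - 1 + n) xs)
    else 0)"

text \<open>\<open>bracket m n f g\<close> is $[f,g]$ for $f \in C^m(D,D)$, $g \in C^n(D,D)$.\<close>

definition bracket ::
    "nat \<Rightarrow> nat \<Rightarrow> ('a, 'b) op \<Rightarrow> ('a, 'b) op \<Rightarrow> ('a::ab_group_add, 'b::ab_group_add) op" where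
  "bracket m n f g =
    (\<Sum>i=1..m. pm ((int i - 1) * (int n - 1)) (circ m n i f g))
    - pm ((int m - 1) * (int n - 1))
        (\<Sum>i=1..n. pm ((int i - 1) * (int m - 1)) (circ n m i g f))"

text \<open>$[\cdots[[f,h_1],h_2],\dots,h_r]$, every $h_j$ being paired with its arity\<close>

primrec iter_bracket ::
    "nat \<Rightarrow> ('a, 'b) op \<Rightarrow> (nat \<times> ('a, 'b) op) list \<Rightarrow> ('a::ab_group_add, 'b::ab_group_add) op" where
  "iter_bracket m f [] = f"
| "iter_bracket m f (h # hs) =
    iter_bracket (m + fst h - 1) (bracket m (fst h) f (snd h)) hs"

text \<open>The projection $p$ onto $\mathfrak{a}$: all arguments are taken from $B$, the value from $A$.\<close>

definition proj :: "('a, 'b) op \<Rightarrow> ('a::ab_group_add, 'b::ab_group_add) op" where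
  "proj F = (\<lambda>T ds. (fst (F T (map (\<lambda>d. (0, snd d)) ds)), 0))"

text \<open>
  The homogeneous components $\mathfrak{a}_d$ and $\mathfrak{h}_d$ as subspaces of
  $\mathfrak{g}_d = C^{d+1}(D,D)$, both 0 for $d < 0$. A map on a summand of $D^{\otimes n}$
  is extended by 0 to the other summands. In \<open>h_part\<close> the first condition says that the
  \<open>A\<close>-valued part factors through the projection onto $A^{\otimes n}$, the second one that the
  \<open>B\<close>-valued part vanishes on $A^{\otimes n}$.
\<close>

definition a_part ::
    "('k::field \<Rightarrow> 'a::ab_group_add \<Rightarrow> 'a) \<Rightarrow> ('k \<Rightarrow> 'b::ab_group_add \<Rightarrow> 'b) \<Rightarrow> int
      \<Rightarrow> ('a, 'b) op set" where
  "a_part sA sB d =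
    (if d < 0 then {0} else {F \<in> Cspace sA sB (nat (d + 1)). proj F = F})"

definition h_part ::
    "('k::field \<Rightarrow> 'a::ab_group_add \<Rightarrow> 'a) \<Rightarrow> ('k \<Rightarrow> 'b::ab_group_add \<Rightarrow> 'b) \<Rightarrow> int
      \<Rightarrow> ('a, 'b) op set" where
  "h_part sA sB d =
    (if d < 0 then {0} else {F \<in> Cspace sA sB (nat (d + 1)).
      \<forall>T ds. fst (F T ds) = fst (F T (map (\<lambda>e. (fst e, 0)) ds)) \<and>
             snd (F T (map (\<lambda>e. (fst e, 0)) ds)) = 0})"

text \<open>Embedding of $\mathrm{Hom}(\mathbb{K}[T_n] \otimes B^{\otimes n}, A)$ into $\mathfrak{g}$\<close>

definition emb_a :: "(ptree \<Rightarrow> 'b list \<Rightarrow> 'a) \<Rightarrow> ('a, 'b::zero) op" where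
  "emb_a \<gamma> = (\<lambda>T ds. (\<gamma> T (map snd ds), 0))"

text \<open>The operator \<open>P\<close> as an element of $\mathfrak{a}_0$, via $\mathbb{K}[T_1] \otimes B = B$\<close>

definition P_op :: "('b \<Rightarrow> 'a) \<Rightarrow> ('a::ab_group_add, 'b::ab_group_add) op" where
  "P_op P = emb_a (\<lambda>T xs. if T \<in> trees 1 \<and> length xs = 1 then P (hd xs) else 0)"

definition pi_lam ::
    "('k \<Rightarrow> 'b \<Rightarrow> 'b) \<Rightarrow> ('a \<Rightarrow> 'b \<Rightarrow> 'b) \<Rightarrow> ('b \<Rightarrow> 'a \<Rightarrow> 'b) \<Rightarrow> 'k \<Rightarrow> ('a::ring, 'b::ring) op" where
  "pi_lam sB lact ract lam = (\<lambda>T ds.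
    case ds of
      [(a, x), (b, y)] \<Rightarrow>
        if T = Node [Leaf, Node [Leaf, Leaf]] then (a * b, ract x b)
        else if T = Node [Node [Leaf, Leaf], Leaf] then (a * b, lact a y)
        else if T = Node [Leaf, Leaf, Leaf] then (a * b, sB lam (x * y))
        else 0
    | _ \<Rightarrow> 0)"


section \<open>The $L_\infty$-structure\<close>

text \<open>
  \<open>(d, \<theta>, \<gamma>)\<close> is the homogeneous element $(s^{-1}\theta, \gamma)$ of degree \<open>d\<close> of
  $s^{-1}\mathfrak{h} \oplus \mathfrak{a}$; so $\theta \in \mathfrak{h}_{d+1}$ has arity \<open>d + 2\<close> and
  $\gamma \in \mathfrak{a}_d$ has arity \<open>d + 1\<close>.
\<close>

type_synonym ('a, 'b) homog = "int \<times> ('a, 'b) op \<times> ('a, 'b) op"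

definition deg :: "('a, 'b) homog \<Rightarrow> int" where "deg z = fst z"
definition hcomp :: "('a, 'b) homog \<Rightarrow> ('a, 'b) op" where "hcomp z = fst (snd z)"
definition acomp :: "('a, 'b) homog \<Rightarrow> ('a, 'b) op" where "acomp z = snd (snd z)"

definition sh_a ::
    "('k::field \<Rightarrow> 'a::ab_group_add \<Rightarrow> 'a) \<Rightarrow> ('k \<Rightarrow> 'b::ab_group_add \<Rightarrow> 'b) \<Rightarrow> int
      \<Rightarrow> (('a, 'b) op \<times> ('a, 'b) op) set" where
  "sh_a sA sB d = h_part sA sB (d + 1) \<times> a_part sA sB d"

text \<open>
  \<open>Linf [z\<^sub>1, \<dots>, z\<^sub>k]\<close> is $l_k(z_1,\dots,z_k)$, obtained from the two given families of
  operations by multilinearity and graded symmetry. In $l_k(z_1,\dots,z_k)$ the \<open>i\<close>-th term of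
  the sum has $s^{-1}\theta_i$ moved to the front past $z_1,\dots,z_{i-1}$, with its Koszul
  sign, and is $l_k((s^{-1}\theta_i,0),(0,\gamma_1),\dots)$, $\gamma_i$ being left out. The list index
  \<open>i\<close> starts at 0.
\<close>

definition Linf :: "('a, 'b) homog list
    \<Rightarrow> ('a::ab_group_add, 'b::ab_group_add) op \<times> ('a, 'b) op" where
  "Linf zs =
    ((if length zs = 2
      then pm (deg (zs ! 0) + 1)
             (bracket (nat (deg (zs ! 0) + 2)) (nat (deg (zs ! 1) + 2)) (hcomp (zs ! 0)) (hcomp (zs ! 1)))
      else 0),
     (if 2 \<le> length zs
      then (\<Sum>i<length zs.
              pm (deg (zs ! i) * (\<Sum>z\<leftarrow>take i zs. deg z))
                (proj (iter_bracket (nat (deg (zs ! i) + 2)) (hcomp (zs ! i))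
                   (map (\<lambda>z. (nat (deg z + 1), acomp z)) (take i zs @ drop (Suc i) zs)))))
      else 0))"

definition scale_pair ::
    "('k \<Rightarrow> 'a \<Rightarrow> 'a) \<Rightarrow> ('k \<Rightarrow> 'b \<Rightarrow> 'b) \<Rightarrow> 'k
      \<Rightarrow> ('a, 'b) op \<times> ('a, 'b) op \<Rightarrow> ('a, 'b) op \<times> ('a, 'b) op" where
  "scale_pair sA sB c w =
    ((\<lambda>T ds. scaleD sA sB c (fst w T ds)), (\<lambda>T ds. scaleD sA sB c (snd w T ds)))"

text \<open>
  $l_1^\alpha(z)$; \<^const>\<open>Sum_any\<close> is the sum over the (finitely many) indices with a nonzero
  summand.
\<close>

definition l1_twisted ::
    "('k::field_char_0 \<Rightarrow> 'a \<Rightarrow> 'a) \<Rightarrow> ('k \<Rightarrow> 'b \<Rightarrow> 'b) \<Rightarrow> ('a, 'b) homog \<Rightarrow> ('a, 'b) homog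
      \<Rightarrow> ('a::ab_group_add, 'b::ab_group_add) op \<times> ('a, 'b) op" where
  "l1_twisted sA sB \<alpha> z =
    Sum_any (\<lambda>n. scale_pair sA sB (1 / fact n) (Linf (replicate n \<alpha> @ [z])))"


section \<open>The cochain complex\<close>

type_synonym ('a, 'b) cochain =
  "('a list \<Rightarrow> 'a) \<times> ('b list \<Rightarrow> 'b) \<times> (('a + 'b) list \<Rightarrow> 'b) \<times> (ptree \<Rightarrow> 'b list \<Rightarrow> 'a)"

definition scale_cochain ::
    "('k \<Rightarrow> 'a \<Rightarrow> 'a) \<Rightarrow> ('k \<Rightarrow> 'b \<Rightarrow> 'b) \<Rightarrow> 'k \<Rightarrow> ('a, 'b) cochain \<Rightarrow> ('a, 'b) cochain" where
  "scale_cochain sA sB c = (\<lambda>(f, g, h, \<gamma>).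
    (\<lambda>as. sA c (f as), \<lambda>xs. sB c (g xs), \<lambda>w. sB c (h w), \<lambda>T xs. sA c (\<gamma> T xs)))"

definition cochains ::
    "('k::field \<Rightarrow> 'a::ab_group_add \<Rightarrow> 'a) \<Rightarrow> ('k \<Rightarrow> 'b::ab_group_add \<Rightarrow> 'b) \<Rightarrow> nat
      \<Rightarrow> ('a, 'b) cochain set" where
  "cochains sA sB n =
    (if n = 0 then {0}
     else if n = 1 then multilinear sA sA 1 \<times> multilinear sB sB 1 \<times> {0} \<times> {0}
     else multilinear sA sA n \<times> multilinear sB sB n \<times> mixed_hom sA sB n \<times> tree_hom sB sA (n - 1))"

text \<open>\<open>f + g\<close> as an element of $\mathfrak{h}_0$\<close>

definition fg_op :: "('a list \<Rightarrow> 'a) \<Rightarrow> ('b list \<Rightarrow> 'b) \<Rightarrow> ('a::ab_group_add, 'b::ab_group_add) op" where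
  "fg_op f g = (\<lambda>T ds.
    if T \<in> trees 1 \<and> length ds = 1 then (f (map fst ds), g (map snd ds)) else 0)"

text \<open>\<open>g + h\<close>: the map \<open>g\<close> on words over \<open>B\<close> only, and \<open>h\<close> on mixed words\<close>

definition gh_sum :: "('b list \<Rightarrow> 'b) \<Rightarrow> (('a + 'b) list \<Rightarrow> 'b) \<Rightarrow> ('a + 'b) list \<Rightarrow> 'b" where
  "gh_sum g h c = (if \<exists>u\<in>set c. isl u then h c else g (map projr c))"

definition pi_fgh ::
    "('k::field \<Rightarrow> 'b \<Rightarrow> 'b) \<Rightarrow> 'k \<Rightarrow> nat \<Rightarrow> ('a list \<Rightarrow> 'a) \<Rightarrow> ('b list \<Rightarrow> 'b) \<Rightarrow> (('a + 'b) list \<Rightarrow> 'b)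
      \<Rightarrow> ('a::ab_group_add, 'b::ab_group_add) op" where
  "pi_fgh sB lam n f g h = (\<lambda>T ds.
    if T \<in> trees n \<and> length ds = n
    then (f (map fst ds),
          sB (lam ^ (arity_root T - 2))
            (gh_sum g h
              (map (\<lambda>j. if j \<in> root_gaps T then Inr (snd (ds ! (j - 1))) else Inl (fst (ds ! (j - 1))))
                [1..<n + 1])))
    else 0)"

text \<open>The identification of a cochain of degree $n \ge 1$ with an element of degree $n - 2$\<close>

definition emb ::
    "('k::field \<Rightarrow> 'b \<Rightarrow> 'b) \<Rightarrow> 'k \<Rightarrow> nat \<Rightarrow> ('a, 'b) cochain
      \<Rightarrow> ('a::ab_group_add, 'b::ab_group_add) op \<times> ('a, 'b) op" where
  "emb sB lam n = (\<lambda>(f, g, h, \<gamma>).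
    if n = 1 then (fg_op f g, 0) else (pi_fgh sB lam n f g h, emb_a \<gamma>))"

text \<open>
  $-l_1^\alpha$ (for $n = 1$) and $(-1)^{n-2} l_1^\alpha$ (for $n \ge 2$), applied to an element of
  degree $n - 2$, with $\alpha = (s^{-1}\pi_\lambda, P)$
\<close>

definition signed_l1 ::
    "('k::field_char_0 \<Rightarrow> 'a::ring \<Rightarrow> 'a) \<Rightarrow> ('k \<Rightarrow> 'b::ring \<Rightarrow> 'b) \<Rightarrow> ('a \<Rightarrow> 'b \<Rightarrow> 'b) \<Rightarrow> ('b \<Rightarrow> 'a \<Rightarrow> 'b)
      \<Rightarrow> ('b \<Rightarrow> 'a) \<Rightarrow> 'k \<Rightarrow> nat \<Rightarrow> ('a, 'b) op \<times> ('a, 'b) op \<Rightarrow> ('a, 'b) op \<times> ('a, 'b) op" where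
  "signed_l1 sA sB lact ract P lam n w =
    pm (int n - 2) (l1_twisted sA sB (0, pi_lam sB lact ract lam, P_op P) (int n - 2, w))"

text \<open>The coboundary: the cochain of degree $n + 1$ which is embedded as \<open>signed_l1\<close>\<close>

definition delta ::
    "('k::field_char_0 \<Rightarrow> 'a::ring \<Rightarrow> 'a) \<Rightarrow> ('k \<Rightarrow> 'b::ring \<Rightarrow> 'b) \<Rightarrow> ('a \<Rightarrow> 'b \<Rightarrow> 'b) \<Rightarrow> ('b \<Rightarrow> 'a \<Rightarrow> 'b)
      \<Rightarrow> ('b \<Rightarrow> 'a) \<Rightarrow> 'k \<Rightarrow> nat \<Rightarrow> ('a, 'b) cochain \<Rightarrow> ('a, 'b) cochain" where
  "delta sA sB lact ract P lam n c =
    (if n = 0 then 0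
     else inv_into (cochains sA sB (n + 1)) (emb sB lam (n + 1))
            (signed_l1 sA sB lact ract P lam n (emb sB lam n c)))"

definition cochain_complex ::
    "('k::field \<Rightarrow> 'c::ab_group_add \<Rightarrow> 'c) \<Rightarrow> (nat \<Rightarrow> 'c set) \<Rightarrow> (nat \<Rightarrow> 'c \<Rightarrow> 'c) \<Rightarrow> bool" where
  "cochain_complex scale C d \<longleftrightarrow>
    (\<forall>n. module.subspace scale (C n)) \<and>
    (\<forall>n. \<forall>c\<in>C n. d n c \<in> C (n + 1)) \<and>
    (\<forall>n. \<forall>c\<in>C n. \<forall>c'\<in>C n. d n (c + c') = d n c + d n c') \<and>
    (\<forall>n. \<forall>r. \<forall>c\<in>C n. d n (scale r c) = scale r (d n c)) \<and>
    (\<forall>n. \<forall>c\<in>C n. d (n + 1) (d n c) = 0)"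

end

theory Submission
  imports Defs
begin

text \<open>
  Deleting leaves is functorial, so the compositions \<open>circ\<close> satisfy the operad axioms and, for an
  associative $\mu$ of arity 2, $[\mu, -]$ is an alternating sum of cofaces and squares to 0. Since
  $P \circ P = 0$ in $\mathfrak{g}$, the series $\sum_r \frac{1}{r!} [\cdots[\theta,P],\dots,P]$
  is the conjugate $\theta^P$ of $\theta$ by the automorphism $(a,x) \mapsto (a + P x, x)$ of $D$,
  which is compatible with all compositions. Hence, with $\pi = \pi_\lambda$ and $\mu = \pi^P$,
  $$l_1^\alpha(s^{-1}\theta, \gamma) = (-s^{-1}[\pi,\theta],\ p(\theta^P) + p[\mu,\gamma]).$$
  The averaging identities say exactly $p\mu = 0$, which gives $p[\mu, X] = p[\mu, p X]$; the square
  of $l_1^\alpha$ therefore vanishes by $[\pi,[\pi,-]] = 0 = [\mu,[\mu,-]]$. As $\lambda \neq 0$, an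
  element is of the form $\pi_{f,g,h}$ iff its $A$-part depends only on the $A$-entries and its
  $B$-part depends on the tree only through the gaps at the root, reading the $B$-entry at each gap
  and the $A$-entry elsewhere. This property is stable under $\circ_i$, hence under $[\pi,-]$.
\<close>

section \<open>Gaps at the root\<close>

text \<open>The conjugation arises because inserting P into a slot, or applying it to the output,
  squares to zero and all these insertions commute: the exponential of their signed sum factors into
  1 + \<nu> for each slot and 1 - \<nu> for the output, where \<nu>(a,x) = (P x, 0). The \<pi>-terms
  of l_1^\<alpha> form a complete exponential series as well: among r + 1 copies of \<alpha> there
  are r + 1 choices of the one that contributes \<pi>, and (r + 1)/(r + 1)! = 1/r!. The
  \<theta>-series lacks its term p \<theta>, which is zero for \<theta> = \<pi>_{f,g,h}. Stability
  of the image under composition rests on a dichotomy. If the leaves of the inner tree enclose a gap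
  at the root of T, the inner tree has the same root and inherits the gaps. If not, its root lies
  higher and the root gaps of T do not determine its own, but then the outer operation reads only
  the A-value of the inner one, which ignores the tree. The condition \<lambda> \<noteq> 0 enters
  where g + h is recovered from \<pi>_{f,g,h}, by division by \<lambda>^{k-2}.\<close>

lemma leaves_pos: "reduced T \<Longrightarrow> 1 \<le> leaves T"
proof (induction T rule: leaves.induct)
  case (2 ts)
  then obtain t us where "ts = t # us" by (cases ts) auto
  with 2(1)[of t] 2(2) show ?case by simp
qed simp

text \<open>Both ends, 0 and the total number of leaves, count as gaps here, while
  \<open>root_gaps\<close> omits them. With the ends included the set behaves well under
  concatenation of forests and deletion of leaves.\<close>

definition forest_gaps :: "ptree list \<Rightarrow> nat set" where
  "forest_gaps ts = {sum_list (map leaves (take r ts)) | r. r \<le> length ts}"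

lemma forest_gaps_Nil [simp]: "forest_gaps [] = {0}"
  by (auto simp: forest_gaps_def)

lemma forest_gaps_Cons: "forest_gaps (t # ts) = insert 0 ((\<lambda>s. leaves t + s) ` forest_gaps ts)"
proof (rule set_eqI, rule iffI)
  fix x assume "x \<in> forest_gaps (t # ts)"
  then obtain r where r: "r \<le> Suc (length ts)" "x = sum_list (map leaves (take r (t # ts)))"
    by (auto simp: forest_gaps_def)
  then show "x \<in> insert 0 ((\<lambda>s. leaves t + s) ` forest_gaps ts)"
    by (cases r) (auto simp: forest_gaps_def)
next
  fix x assume "x \<in> insert 0 ((\<lambda>s. leaves t + s) ` forest_gaps ts)"
  then consider "x = 0" | r where "r \<le> length ts" "x = leaves t + sum_list (map leaves (take r ts))"
    by (auto simp: forest_gaps_def)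
  then show "x \<in> forest_gaps (t # ts)"
  proof cases
    case 1
    then show ?thesis by (auto simp: forest_gaps_def intro!: exI[of _ 0])
  next
    case (2 r)
    then show ?thesis by (auto simp: forest_gaps_def intro!: exI[of _ "Suc r"])
  qed
qed

lemma zero_in_forest_gaps: "0 \<in> forest_gaps ts"
  by (cases ts) (auto simp: forest_gaps_Cons)

lemma forest_gaps_append:
  "forest_gaps (ts @ us) = forest_gaps ts \<union> (\<lambda>s. sum_list (map leaves ts) + s) ` forest_gaps us"
proof (induction ts)
  case Nil
  then show ?case using zero_in_forest_gaps by auto
next
  case (Cons t ts)
  show ?case by (auto simp: forest_gaps_Cons Cons image_Un image_image add.assoc)
qed

lemma sum_in_forest_gaps: "sum_list (map leaves ts) \<in> forest_gaps ts"
  by (auto simp: forest_gaps_def intro!: exI[of _ "length ts"])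

lemma forest_gaps_le: "s \<in> forest_gaps ts \<Longrightarrow> s \<le> sum_list (map leaves ts)"
  by (induction ts arbitrary: s) (auto simp: forest_gaps_Cons)

lemma sum_list_leaves_ge: "\<forall>t\<in>set ts. reduced t \<Longrightarrow> length ts \<le> sum_list (map leaves ts)"
  using leaves_pos by (induction ts) fastforce+

text \<open>Every tree has at least one leaf, so the partial sums increase strictly.\<close>

lemma card_forest_gaps:
  assumes "\<forall>t\<in>set ts. reduced t"
  shows "card (forest_gaps ts) = Suc (length ts)"
  using assms
proof (induction ts)
  case (Cons t ts)
  have "finite (forest_gaps ts)" using Cons by (intro card_ge_0_finite) auto
  moreover have "0 \<notin> (\<lambda>s. leaves t + s) ` forest_gaps ts"
    using leaves_pos[of t] Cons.prems by auto
  ultimately show ?case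
    using Cons by (simp add: forest_gaps_Cons card_image)
qed simp

lemma root_gaps_Node:
  assumes "\<forall>t\<in>set ts. reduced t"
  shows "root_gaps (Node ts) = forest_gaps ts - {0, leaves (Node ts)}"
proof (rule set_eqI, rule iffI)
  fix x assume "x \<in> root_gaps (Node ts)"
  then obtain r where r: "1 \<le> r" "r < length ts" "x = sum_list (map leaves (take r ts))" by auto
  have "length (take r ts) \<le> x" "length (drop r ts) \<le> sum_list (map leaves (drop r ts))"
    using assms set_take_subset[of r ts] set_drop_subset[of r ts]
    by (auto simp: r(3) intro!: sum_list_leaves_ge simp del: length_take length_drop)
  moreover have "leaves (Node ts) = x + sum_list (map leaves (drop r ts))"
    by (simp add: r(3) flip: sum_list_append map_append)
  moreover have "0 < length (take r ts)" "0 < length (drop r ts)" using r by simp_all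
  ultimately have "0 < x" "x < leaves (Node ts)" by linarith+
  then show "x \<in> forest_gaps ts - {0, leaves (Node ts)}"
    using r by (auto simp: forest_gaps_def simp del: sum_list_eq_0_iff neq0_conv sum_list_eq_0_iff intro!: exI[of _ r])
next
  fix x assume x: "x \<in> forest_gaps ts - {0, leaves (Node ts)}"
  then obtain r where r: "r \<le> length ts" "x = sum_list (map leaves (take r ts))"
    by (auto simp: forest_gaps_def)
  have "r \<noteq> 0" "r \<noteq> length ts" using x r by (intro notI; simp)+
  then show "x \<in> root_gaps (Node ts)" using r by (auto intro!: exI[of _ r])
qed

lemma trees_pos_Node:
  assumes "T \<in> trees n" "1 \<le> n"
  obtains ts where "T = Node ts" "2 \<le> length ts" "\<forall>t\<in>set ts. reduced t"
    "sum_list (map leaves ts) = n + 1"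
  using assms by (cases T) (auto simp: trees_def)

lemma finite_forest_gaps [simp]: "finite (forest_gaps ts)"
  by (simp add: forest_gaps_def)

text \<open>The k branches at the root are separated by k - 1 gaps. Hence the exponent of \<lambda>
  in \<pi>_{f,g,h} is a function of the gaps.\<close>

lemma card_root_gaps:
  assumes "T \<in> trees n" "1 \<le> n"
  shows "Suc (card (root_gaps T)) = arity_root T"
proof -
  obtain ts where ts: "T = Node ts" "2 \<le> length ts" "\<forall>t\<in>set ts. reduced t"
    "sum_list (map leaves ts) = n + 1"
    using trees_pos_Node[OF assms] .
  have "card (forest_gaps ts - {0, n + 1}) = card (forest_gaps ts) - card {0, n + 1}"
    using sum_in_forest_gaps[of ts] zero_in_forest_gaps[of ts] ts
    by (intro card_Diff_subset) auto
  then show ?thesis using ts card_forest_gaps[of ts] root_gaps_Node[of ts] by simp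
qed

lemma root_gaps_bounds:
  assumes "T \<in> trees n" "1 \<le> n"
  shows "root_gaps T \<noteq> {}" "root_gaps T \<subseteq> {1..n}"
proof -
  obtain ts where ts: "T = Node ts" "2 \<le> length ts" "\<forall>t\<in>set ts. reduced t"
    "sum_list (map leaves ts) = n + 1"
    using trees_pos_Node[OF assms] .
  show "root_gaps T \<noteq> {}" using card_root_gaps[OF assms] ts by auto
  show "root_gaps T \<subseteq> {1..n}"
    using ts root_gaps_Node[of ts] forest_gaps_le[of _ ts] by (force simp del: root_gaps.simps)
qed

text \<open>The forest is built leaf by leaf from the left: a new leaf opens a new tree when a gap
  is required in front of it, and is grafted onto the last tree otherwise.\<close>

lemma ex_forest_gaps:
  assumes "S \<subseteq> {1..n}"
  shows "\<exists>ts. (\<forall>t\<in>set ts. reduced t) \<and> sum_list (map leaves ts) = n + 1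
    \<and> forest_gaps ts = insert 0 (insert (n + 1) S)"
  using assms
proof (induction n arbitrary: S)
  case 0
  then show ?case by (intro exI[of _ "[Leaf]"]) (auto simp: forest_gaps_Cons)
next
  case (Suc n)
  have "S - {Suc n} \<subseteq> {1..n}" using Suc.prems by (auto simp: le_Suc_eq)
  then obtain ts where ts: "\<forall>t\<in>set ts. reduced t" "sum_list (map leaves ts) = n + 1"
    "forest_gaps ts = insert 0 (insert (n + 1) (S - {Suc n}))"
    using Suc.IH by blast
  show ?case
  proof (cases "Suc n \<in> S")
    case True
    then show ?thesis using ts
      by (intro exI[of _ "ts @ [Leaf]"]) (auto simp: forest_gaps_append forest_gaps_Cons)
  next
    case False
    have "ts \<noteq> []" using ts(2) by auto
    then obtain us u where us: "ts = us @ [u]" by (metis append_butlast_last_id)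
    have *: "forest_gaps us \<subseteq> {..n}" "sum_list (map leaves us) + leaves u = n + 1" "1 \<le> leaves u"
      using ts us leaves_pos[of u] forest_gaps_le[of _ us] by fastforce+
    have "forest_gaps ts = insert (n + 1) (forest_gaps us)"
      using * sum_in_forest_gaps[of us] by (auto simp: us forest_gaps_append forest_gaps_Cons)
    then have "forest_gaps us = insert 0 S"
      using ts(3) * False Suc.prems by auto
    then show ?thesis using ts * us sum_in_forest_gaps[of us]
      by (intro exI[of _ "us @ [Node [u, Leaf]]"]) (auto simp: forest_gaps_append forest_gaps_Cons)
  qed
qed

text \<open>A nonempty \<open>S\<close> yields at least two branches, which can be joined at a root.
  Such trees serve to read off g + h from \<pi>_{f,g,h}.\<close>

lemma ex_tree_root_gaps:
  assumes "S \<subseteq> {1..n}" "S \<noteq> {}"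
  shows "\<exists>T\<in>trees n. root_gaps T = S"
proof -
  obtain ts where ts: "\<forall>t\<in>set ts. reduced t" "sum_list (map leaves ts) = n + 1"
    "forest_gaps ts = insert 0 (insert (n + 1) S)"
    using ex_forest_gaps[OF assms(1)] by blast
  have S: "0 \<notin> S" "n + 1 \<notin> S" "finite S" using assms finite_subset by auto
  have "card (insert 0 (insert (n + 1) S)) = Suc (Suc (card S))"
    using S by simp
  moreover have "card S \<noteq> 0" using S assms by simp
  ultimately have "2 \<le> length ts" using card_forest_gaps[OF ts(1)] ts(3) by simp
  then have "Node ts \<in> trees n" using ts by (simp add: trees_def)
  moreover have "root_gaps (Node ts) = S"
    using root_gaps_Node[OF ts(1)] ts(2,3) S by (simp del: root_gaps.simps)
  ultimately show ?thesis by blast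
qed

section \<open>Restriction of trees to sets of leaves\<close>

abbreviation forest_leaves :: "ptree list \<Rightarrow> nat" where
  "forest_leaves ts \<equiv> sum_list (map leaves ts)"

text \<open>A tree from which everything was deleted becomes the empty forest, so that trees and
  forests can share one induction.\<close>

abbreviation opt_list :: "'x option \<Rightarrow> 'x list" where
  "opt_list t \<equiv> (case t of None \<Rightarrow> [] | Some u \<Rightarrow> [u])"

lemma card_Int_interval_add:
  "card (S \<inter> {k..<k + p + q}) = card (S \<inter> {k..<k + p}) + card (S \<inter> {k + p..<k + p + q})"
      for k :: nat
proof -
  have "S \<inter> {k..<k + p + q} = (S \<inter> {k..<k + p}) \<union> (S \<inter> {k + p..<k + p + q})" by auto
  then show ?thesis by (simp add: card_Un_disjoint disjoint_iff)
qed

lemma keep_cong: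
  "S \<inter> {k..<k + leaves T} = S' \<inter> {k..<k + leaves T} \<Longrightarrow> keep S k T = keep S' k T"
  "S \<inter> {k..<k + forest_leaves ts} = S' \<inter> {k..<k + forest_leaves ts} \<Longrightarrow>
    keep_list S k ts = keep_list S' k ts"
proof (induction S k T and S k ts arbitrary: S' and S' rule: keep_keep_list.induct)
  case (4 S k t ts)
  have "S \<inter> {k..<k + leaves t} = S' \<inter> {k..<k + leaves t}"
    "S \<inter> {k + leaves t..<k + leaves t + forest_leaves ts}
      = S' \<inter> {k + leaves t..<k + leaves t + forest_leaves ts}"
    using 4(3) by (fastforce simp: set_eq_iff)+
  with 4(1,2) show ?case by (metis keep_list.simps(2))
qed auto

lemma forest_leaves_opt_list:
  "forest_leaves (opt_list (graft us)) = forest_leaves us"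
  by (cases us rule: graft.cases) auto

lemma leaves_keep:
  "forest_leaves (opt_list (keep S k T)) = card (S \<inter> {k..<k + leaves T})"
  "forest_leaves (keep_list S k ts) = card (S \<inter> {k..<k + forest_leaves ts})"
proof (induction S k T and S k ts rule: keep_keep_list.induct)
  case (1 S k)
  have "S \<inter> {k..<Suc k} = (if k \<in> S then {k} else {})" by auto
  then show ?case by auto
next
  case (2 S k ts)
  then show ?case using forest_leaves_opt_list[of "keep_list S k ts"] by simp
next
  case (4 S k t ts)
  then show ?case by (simp add: card_Int_interval_add flip: add.assoc)
qed auto

lemma reduced_opt_list_graft:
  "\<forall>t\<in>set us. reduced t \<Longrightarrow> \<forall>t\<in>set (opt_list (graft us)). reduced t"
  by (cases us rule: graft.cases) auto

lemma reduced_keep: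
  "reduced T \<Longrightarrow> \<forall>t\<in>set (opt_list (keep S k T)). reduced t"
  "\<forall>t\<in>set ts. reduced t \<Longrightarrow> \<forall>t\<in>set (keep_list S k ts). reduced t"
proof (induction S k T and S k ts rule: keep_keep_list.induct)
  case (2 S k ts)
  then show ?case using reduced_opt_list_graft[of "keep_list S k ts"] by simp
qed auto

text \<open>A gap moves to the number of kept leaves on its left. The gaps on both sides of a tree
  that disappears get the same image.\<close>

lemma forest_gaps_keep_list:
  "forest_gaps (keep_list S k ts) = (\<lambda>s. card (S \<inter> {k..<k + s})) ` forest_gaps ts"
proof (induction ts arbitrary: k)
  case (Cons t ts)
  let ?u = "opt_list (keep S k t)"
  have u: "forest_gaps ?u = {0, card (S \<inter> {k..<k + leaves t})}"
    using leaves_keep(1)[of S k t] by (cases "keep S k t") (auto simp: forest_gaps_Cons)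
  have "(\<lambda>s. card (S \<inter> {k..<k + s})) ` forest_gaps (t # ts)
    = insert 0 ((\<lambda>s. card (S \<inter> {k..<k + leaves t}) + card (S \<inter> {k + leaves t..<k + leaves
        t + s})) ` forest_gaps ts)"
    by (simp add: forest_gaps_Cons image_image card_Int_interval_add flip: add.assoc)
  \<comment> \<open>The gap behind the first tree is already the image of the gap 0 of the remaining
    forest.\<close>
  moreover have "card (S \<inter> {k..<k + leaves t})
    \<in> (\<lambda>s. card (S \<inter> {k..<k + leaves t}) + card (S \<inter> {k + leaves t..<k + leaves t +
        s})) ` forest_gaps ts"
    by (rule image_eqI[OF _ zero_in_forest_gaps]) simp
  ultimately show ?case
    by (simp add: insert_absorb forest_gaps_append u leaves_keep Cons image_image)
qed simp

lemma keep_list_append: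
  "keep_list S k (ts @ us) = keep_list S k ts @ keep_list S (k + forest_leaves ts) us"
  by (induction ts arbitrary: k) (auto simp: add.assoc)

text \<open>Suppressing a vertex with a single remaining branch does not influence later
  deletions.\<close>

lemma graft_keep_list:
  assumes "graft us = Some u"
  shows "keep V l u = graft (keep_list V l us)"
  using assms by (cases us rule: graft.cases) (auto split: option.splits)

text \<open>
  The leaves of \<open>keep S k T\<close> are renumbered from \<open>l\<close>; \<open>pull_back S k V
      l\<close> collects the old labels
  of those with a new label in \<open>V\<close>.
\<close>

definition pull_back :: "nat set \<Rightarrow> nat \<Rightarrow> nat set \<Rightarrow> nat \<Rightarrow> nat set" where
  "pull_back S k V l = {j \<in> S. k \<le> j \<and> l + card (S \<inter> {k..<j}) \<in> V}"

lemma pull_back_shift: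
  "pull_back S k V l \<inter> {k + p..<r} = pull_back S (k + p) V (l + card (S \<inter> {k..<k + p})) \<inter>
      {k + p..<r}"
proof -
  have "card (S \<inter> {k..<j}) = card (S \<inter> {k..<k + p}) + card (S \<inter> {k + p..<j})" if "k + p
      \<le> j" for j
    using card_Int_interval_add[of S k p "j - (k + p)"] that by simp
  then have "j \<in> pull_back S k V l \<longleftrightarrow> j \<in> pull_back S (k + p) V (l + card (S
      \<inter> {k..<k + p}))"
    if "k + p \<le> j" for j
    using that unfolding pull_back_def mem_Collect_eq by (metis add.assoc add_leD1)
  then show ?thesis by auto
qed

text \<open>Functoriality of deletion. In the first step a root may survive, be suppressed or
  disappear; read as forests the three cases agree, which is why both halves compare
  forests.\<close>

lemma keep_keep:
  "keep_list V l (opt_list (keep S k T)) = opt_list (keep (pull_back S k V l) k T)"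
  "keep_list V l (keep_list S k ts) = keep_list (pull_back S k V l) k ts"
proof (induction S k T and S k ts arbitrary: l and l rule: keep_keep_list.induct)
  case (1 S k)
  then show ?case by (auto simp: pull_back_def)
next
  case (2 S k ts)
  show ?case
  proof (cases "graft (keep_list S k ts)")
    case None
    then have "keep_list S k ts = []" by (cases "keep_list S k ts" rule: graft.cases) auto
    then have "keep_list (pull_back S k V l) k ts = []" using 2[of l] by simp
    then show ?thesis using None by simp
  next
    case (Some u)
    then show ?thesis using graft_keep_list[OF Some, of V l] 2[of l] by simp
  qed
next
  case (4 S k t ts)
  have "keep_list (pull_back S k V l) (k + leaves t) ts
    = keep_list (pull_back S (k + leaves t) V (l + card (S \<inter> {k..<k + leaves t}))) (k + leaves t) ts"
    by (rule keep_cong(2)) (rule pull_back_shift)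
  then show ?case using 4 by (simp add: keep_list_append leaves_keep)
qed simp

definition res :: "nat set \<Rightarrow> ptree \<Rightarrow> ptree" where
  "res S T = the (keep S 0 T)"

lemma R_outer_res: "R_outer i n T = res (- {i..<i + n - 1}) T"
  and R_inner_res: "R_inner i n T = res {i - 1..i + n - 1} T"
  by (simp_all add: R_outer_def R_inner_def res_def)

lemma keep_Some_res:
  assumes "reduced T" "S \<inter> {..<leaves T} \<noteq> {}"
  shows "keep S 0 T = Some (res S T)"
proof -
  have "card (S \<inter> {0..<0 + leaves T}) \<noteq> 0" using assms by (auto simp: lessThan_atLeast0)
  then have "keep S 0 T \<noteq> None" using leaves_keep(1)[of S 0 T] by (metis list.simps(8) option.simps(4)
      sum_list.Nil)
  then show ?thesis by (auto simp: res_def)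
qed

lemma res_tree:
  assumes "T \<in> trees n" "card (S \<inter> {..n}) = Suc p"
  shows "res S T \<in> trees p"
proof -
  have T: "reduced T" "leaves T = Suc n" using assms by (auto simp: trees_def)
  have "S \<inter> {..<leaves T} \<noteq> {}" using assms(2) T by (auto simp: lessThan_Suc_atMost)
  then have "keep S 0 T = Some (res S T)" using keep_Some_res T by blast
  then show ?thesis using leaves_keep(1)[of S 0 T] reduced_keep(1)[OF T(1), of S 0] assms(2) T(2)
    by (simp add: trees_def atLeast0LessThan lessThan_Suc_atMost)
qed

text \<open>A kept leaf \<open>j\<close> gets as its new label the number of kept leaves to its
  left. Through this all compatibilities of outer and inner trees reduce to comparing sets of old
  labels.\<close>

lemma res_eqI:
  assumes "T \<in> trees n" "S \<inter> {..n} \<noteq> {}"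
    and "\<And>j. j \<le> n \<Longrightarrow> (j \<in> S \<and> card (S \<inter> {..<j}) \<in> V)
        \<longleftrightarrow> j \<in> S'"
  shows "res V (res S T) = res S' T"
proof -
  have T: "reduced T" "leaves T = Suc n" using assms(1) by (auto simp: trees_def)
  have k: "keep S 0 T = Some (res S T)"
    using keep_Some_res[of T S] T assms(2) by (simp add: lessThan_Suc_atMost)
  have "opt_list (keep V 0 (res S T)) = opt_list (keep (pull_back S 0 V 0) 0 T)"
    using keep_keep(1)[of V 0 S 0 T] by (simp add: k)
  then have "keep V 0 (res S T) = keep (pull_back S 0 V 0) 0 T" by (auto split: option.splits)
  also have "pull_back S 0 V 0 \<inter> {0..<0 + leaves T} = S' \<inter> {0..<0 + leaves T}"
    using assms(3) by (simp add: pull_back_def T set_eq_iff atLeast0LessThan) (metis less_Suc_eq_le)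
  then have "keep (pull_back S 0 V 0) 0 T = keep S' 0 T" by (rule keep_cong(1))
  finally show ?thesis by (simp add: res_def)
qed

lemma keep_all:
  "reduced T \<Longrightarrow> {k..<k + leaves T} \<subseteq> S \<Longrightarrow> keep S k T = Some T"
  "\<forall>t\<in>set ts. reduced t \<Longrightarrow> {k..<k + forest_leaves ts} \<subseteq> S
      \<Longrightarrow> keep_list S k ts = ts"
proof (induction S k T and S k ts rule: keep_keep_list.induct)
  case (2 S k ts)
  then show ?case by (cases ts rule: graft.cases) auto
next
  case (4 S k t ts)
  have "{k..<k + leaves t} \<subseteq> S" "{k + leaves t..<k + leaves t + forest_leaves ts} \<subseteq> S"
    using 4(4) by (force simp: subset_iff)+
  then show ?case using 4 by simp
qed auto

lemma res_all: "T \<in> trees n \<Longrightarrow> {..n} \<subseteq> S \<Longrightarrow> res S T = T"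
  using keep_all(1)[of T 0 S] by (auto simp: res_def trees_def lessThan_Suc_atMost atLeast0LessThan)

text \<open>Gaps pushed to 0 or to the right end no longer separate anything. If another one
  remains, at least two branches at the root survive and the root stays. Otherwise at most one
  branch is left, and the gaps of \<open>T\<close> say nothing about the new root.\<close>

lemma root_gaps_res:
  assumes "T \<in> trees n" "1 \<le> n"
    and G: "G = (\<lambda>s. card (S \<inter> {..<s})) ` root_gaps T - {0, card (S \<inter> {..n})}" "G \<noteq> {}"
  shows "root_gaps (res S T) = G"
proof -
  obtain ts where ts: "T = Node ts" "2 \<le> length ts" "\<forall>t\<in>set ts. reduced t"
    "forest_leaves ts = n + 1"
    using trees_pos_Node[OF assms(1,2)] .
  let ?us = "keep_list S 0 ts"
  have total: "forest_leaves ?us = card (S \<inter> {..n})"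
    using ts leaves_keep(2)[of S 0 ts] by (simp add: atLeast0LessThan lessThan_Suc_atMost)
  have red: "\<forall>u\<in>set ?us. reduced u" using reduced_keep(2) ts by blast
  have gap: "forest_gaps ?us - {0, forest_leaves ?us} = G"
  proof -
    have "forest_gaps ?us - {0, forest_leaves ?us} =
      (\<lambda>s. card (S \<inter> {..<s})) ` forest_gaps ts - {0, card (S \<inter> {..n})}"
      by (simp add: total forest_gaps_keep_list atLeast0LessThan)
    also have "\<dots> = G" using ts root_gaps_Node[OF ts(3)]
      by (auto simp: G(1) lessThan_Suc_atMost simp del: root_gaps.simps)
    finally show ?thesis .
  qed
  have "2 \<le> length ?us"
  proof (rule ccontr)
    assume "\<not> 2 \<le> length ?us"
    then have "?us = [] \<or> (\<exists>u. ?us = [u])" by (cases ?us rule: graft.cases) auto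
    then have "forest_gaps ?us - {0, forest_leaves ?us} = {}"
      by (auto simp: forest_gaps_Cons)
    then show False using gap G(2) by simp
  qed
  then have "res S T = Node ?us" using ts by (cases ?us rule: graft.cases) (auto simp: res_def)
  then show ?thesis using gap root_gaps_Node[OF red] by (simp del: root_gaps.simps)
qed

section \<open>Renumbering of leaves and gaps in outer and inner trees\<close>

lemma card_Compl_interval:
  "card (- {i..<i + d} \<inter> {..<j}) = (if j \<le> i then j else if j \<le> i + d then i else j - d)" for i :: nat
proof -
  have "card (- {i..<i + d} \<inter> {..<j}) = card ({..<j} - {i..<i + d} \<inter> {..<j})"
    by (rule arg_cong[where f = card]) auto
  also have "\<dots> = j - card ({i..<i + d} \<inter> {..<j})"
    by (subst card_Diff_subset) auto
  also have "{i..<i + d} \<inter> {..<j} = {i..<min (i + d) j}" by auto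
  finally show ?thesis by auto
qed

lemma card_interval: "card ({p..q} \<inter> {..<j}) = (if j \<le> q then j - p else Suc q - p)" for p :: nat
proof -
  have "{p..q} \<inter> {..<j} = {p..<min (Suc q) j}" by auto
  then show ?thesis by auto
qed

lemma R_outer_tree:
  assumes "T \<in> trees (m + n - 1)" "1 \<le> i" "i \<le> m" "1 \<le> n"
  shows "R_outer i n T \<in> trees m"
  unfolding R_outer_res
proof (rule res_tree[OF assms(1)])
  show "card (- {i..<i + n - 1} \<inter> {..m + n - 1}) = Suc m"
    using card_Compl_interval[of i "n - 1" "m + n"] assms
    by (simp flip: lessThan_Suc_atMost)
qed

lemma R_inner_tree:
  assumes "T \<in> trees (m + n - 1)" "1 \<le> i" "i \<le> m" "1 \<le> n"
  shows "R_inner i n T \<in> trees n"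
  unfolding R_inner_res
proof (rule res_tree[OF assms(1)])
  show "card ({i - 1..i + n - 1} \<inter> {..m + n - 1}) = Suc n"
    using assms by (auto simp: card_interval simp flip: lessThan_Suc_atMost)
qed

lemma R_outer_one: "T \<in> trees n \<Longrightarrow> R_outer i 1 T = T"
  by (simp add: R_outer_res res_all)

lemma R_inner_all: "T \<in> trees n \<Longrightarrow> R_inner 1 n T = T"
  by (simp add: R_inner_res res_all atMost_atLeast0)

lemma res_R_outer:
  assumes "T \<in> trees N" "1 \<le> i"
    and "\<And>j. j \<le> N \<Longrightarrow> (\<not> (i \<le> j \<and> j < i + d) \<and>
       (if j \<le> i then j else if j \<le> i + d then i else j - d) \<in> V) \<longleftrightarrow> j \<in> S'"
  shows "res V (R_outer i (Suc d) T) = res S' T"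
proof -
  have "0 \<in> - {i..<i + d} \<inter> {..N}" using assms(2) by simp
  then have ne: "- {i..<i + d} \<inter> {..N} \<noteq> {}" by blast
  show ?thesis unfolding R_outer_res using assms
    by (intro res_eqI[OF assms(1)]) (simp_all add: card_Compl_interval ne)
qed

lemma res_R_inner:
  assumes "T \<in> trees N" "i \<le> N"
    and "\<And>j. j \<le> N \<Longrightarrow> (i \<le> j \<and> j \<le> i + n \<and> j - i \<in> V)
        \<longleftrightarrow> j \<in> S'"
  shows "res V (R_inner (Suc i) n T) = res S' T"
  unfolding R_inner_res using assms
  by (intro res_eqI[OF assms(1)]) (auto simp: card_interval intro!: exI[of _ i])

text \<open>The tree part of the sequential operad axiom: on both sides the same leaves are
  deleted.\<close>

lemma R_outer_outer_seq:
  assumes T: "T \<in> trees (m + n + p - 2)" and ij: "1 \<le> i" "i \<le> m" "1 \<le> j" "j \<le> n" and p: "1 \<le> p"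
  shows "R_outer i n (R_outer (i + j - 1) p T) = R_outer i (n + p - 1) T"
    and "R_inner i n (R_outer (i + j - 1) p T) = R_outer j p (R_inner i (n + p - 1) T)"
    and "R_inner j p (R_inner i (n + p - 1) T) = R_inner (i + j - 1) p T"
proof -
  \<comment> \<open>Writing the inequalities as sums removes the truncated subtractions, and each
    identity becomes a comparison of label sets given by linear inequalities.\<close>
  obtain i' j' m' n' p' where e: "i = Suc i'" "j = Suc j'" "n = Suc (j' + n')" "m = Suc (i' + m')" "p = Suc p'"
    using ij p by (metis (no_types) Suc_le_D One_nat_def le_Suc_ex add_Suc plus_1_eq_Suc)
  have T': "T \<in> trees (Suc (i' + m' + j' + n' + p'))" using T by (simp add: e algebra_simps)
  show "R_outer i n (R_outer (i + j - 1) p T) = R_outer i (n + p - 1) T"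
    unfolding R_outer_res[of i]
    unfolding e add_Suc_right diff_Suc_1 add_Suc diff_Suc_Suc
    by (rule res_R_outer[OF T']) auto
  have "R_inner i n (R_outer (i + j - 1) p T) = res {k. i' \<le> k \<and> k \<le> i' + n + p' \<and> \<not> (i'
      + j \<le> k \<and> k < i' + j + p')} T"
    unfolding R_inner_res[of i]
    unfolding e add_Suc_right diff_Suc_1 add_Suc diff_Suc_Suc
    by (rule res_R_outer[OF T']) auto
  moreover have "R_outer j p (R_inner i (n + p - 1) T) = res {k. i' \<le> k \<and> k \<le> i' + n + p' \<and>
      \<not> (i' + j \<le> k \<and> k < i' + j + p')} T"
    unfolding R_outer_res[of j]
    unfolding e add_Suc_right diff_Suc_1 add_Suc diff_Suc_Suc
    by (rule res_R_inner[OF T']) auto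
  ultimately show "R_inner i n (R_outer (i + j - 1) p T) = R_outer j p (R_inner i (n + p - 1) T)"
    by simp
  show "R_inner j p (R_inner i (n + p - 1) T) = R_inner (i + j - 1) p T"
    unfolding R_inner_res[of j] R_inner_res[of "i + j - 1"]
    unfolding e add_Suc_right diff_Suc_1 add_Suc diff_Suc_Suc
    by (rule res_R_inner[OF T']) auto
qed

text \<open>The tree part of the parallel operad axiom: the two deleted intervals are disjoint, and
  filling slot \<open>i\<close> shifts slot \<open>k\<close> by \<open>n - 1\<close>.\<close>

lemma R_outer_outer_par:
  assumes T: "T \<in> trees (m + n + p - 2)" and ik: "1 \<le> i" "i < k" "k \<le> m" and np: "1 \<le> n" "1 \<le> p"
  shows "R_outer i n (R_outer (k + n - 1) p T) = R_outer k p (R_outer i n T)"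
    and "R_inner i n (R_outer (k + n - 1) p T) = R_inner i n T"
    and "R_inner k p (R_outer i n T) = R_inner (k + n - 1) p T"
proof -
  obtain i' k' m' n' p' where e: "i = Suc i'" "k = Suc (i + k')" "n = Suc n'" "m = k + m'" "p = Suc p'"
    using ik np by (metis (no_types) Suc_le_D One_nat_def le_Suc_ex less_iff_Suc_add)
  have T': "T \<in> trees (k + m' + n' + p')" using T by (simp add: e algebra_simps)
  have "R_outer i n (R_outer (k + n - 1) p T) = res {j. \<not> (i \<le> j \<and> j < i + n') \<and> \<not> (k +
      n' \<le> j \<and> j < k + n' + p')} T"
    unfolding R_outer_res[of i]
    unfolding e add_Suc_right diff_Suc_1 add_Suc diff_Suc_Suc
    by (rule res_R_outer[OF T'[unfolded e add_Suc_right add_Suc]]) auto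
  moreover have "R_outer k p (R_outer i n T) = res {j. \<not> (i \<le> j \<and> j < i + n') \<and> \<not> (k +
      n' \<le> j \<and> j < k + n' + p')} T"
    unfolding R_outer_res[of k]
    unfolding e add_Suc_right diff_Suc_1 add_Suc diff_Suc_Suc
    by (rule res_R_outer[OF T'[unfolded e add_Suc_right add_Suc]]) auto
  ultimately show "R_outer i n (R_outer (k + n - 1) p T) = R_outer k p (R_outer i n T)" by simp
  show "R_inner i n (R_outer (k + n - 1) p T) = R_inner i n T"
    unfolding R_inner_res[of i]
    unfolding e add_Suc_right diff_Suc_1 add_Suc diff_Suc_Suc
    by (rule res_R_outer[OF T'[unfolded e add_Suc_right add_Suc]]) auto
  show "R_inner k p (R_outer i n T) = R_inner (k + n - 1) p T"
    unfolding R_inner_res[of k] R_inner_res[of "k + n - 1"]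
    unfolding e add_Suc_right diff_Suc_1 add_Suc diff_Suc_Suc
    by (rule res_R_outer[OF T'[unfolded e add_Suc_right add_Suc]]) auto
qed

text \<open>The first and the last leaf are kept, so no gap is pushed to an end; the gaps from
  \<open>i\<close> to \<open>i + n - 1\<close> merge into \<open>i\<close>.\<close>

lemma root_gaps_R_outer:
  assumes T: "T \<in> trees (m + n - 1)" and "1 \<le> i" "i \<le> m" "1 \<le> n"
  shows "root_gaps (R_outer i n T)
    = (\<lambda>s. if s \<le> i then s else if s \<le> i + n - 1 then i else s - (n - 1)) ` root_gaps T"
proof -
  have mn: "1 \<le> m + n - 1" using assms by simp
  let ?c = "\<lambda>s. if s \<le> i then s else if s \<le> i + n - 1 then i else s - (n - 1)"
  have c: "card (- {i..<i + n - 1} \<inter> {..<s}) = ?c s" for s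
    using card_Compl_interval[of i "n - 1" s] assms by simp
  have t: "card (- {i..<i + n - 1} \<inter> {..m + n - 1}) = Suc m"
    using card_Compl_interval[of i "n - 1" "m + n"] assms by (simp flip: lessThan_Suc_atMost)
  have "?c s \<notin> {0, Suc m}" if "s \<in> root_gaps T" for s
    using subsetD[OF root_gaps_bounds(2)[OF T mn] that] assms by auto
  then have "?c ` root_gaps T \<inter> {0, Suc m} = {}" by blast
  then have "?c ` root_gaps T - {0, Suc m} = ?c ` root_gaps T" by (rule Diff_triv)
  then show ?thesis unfolding R_outer_res
    by (intro root_gaps_res[OF T mn]) (use root_gaps_bounds[OF T mn] in \<open>simp_all only: c t
        image_is_empty\<close>, simp_all)
qed

text \<open>Without a gap of \<open>T\<close> in this range, the leaves of the inner tree belong to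
  a single branch at the root of \<open>T\<close>, and the right-hand side would be empty while the
  inner tree has gaps; hence the last assumption.\<close>

lemma root_gaps_R_inner:
  assumes T: "T \<in> trees (m + n - 1)" and "1 \<le> i" "i \<le> m" "1 \<le> n"
    and ne: "root_gaps T \<inter> {i..i + n - 1} \<noteq> {}"
  shows "root_gaps (R_inner i n T) = (\<lambda>s. s - (i - 1)) ` (root_gaps T \<inter> {i..i + n - 1})"
proof -
  have mn: "1 \<le> m + n - 1" using assms by simp
  let ?c = "\<lambda>s. if s \<le> i + n - 1 then s - (i - 1) else Suc n"
  have c: "card ({i - 1..i + n - 1} \<inter> {..<s}) = ?c s" for s
    using card_interval[of "i - 1" "i + n - 1" s] assms by simp
  have t: "card ({i - 1..i + n - 1} \<inter> {..m + n - 1}) = Suc n"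
    using assms by (auto simp: card_interval simp flip: lessThan_Suc_atMost)
  have "?c ` root_gaps T - {0, Suc n} = (\<lambda>s. s - (i - 1)) ` (root_gaps T \<inter> {i..i + n - 1})"
    using assms by (force simp: image_iff split: if_splits)
  then show ?thesis unfolding R_inner_res using ne
    by (intro root_gaps_res[OF T mn]) (simp_all only: c t image_is_empty, simp_all)
qed

section \<open>Operad structure\<close>

lemma linear_iff_vs:
  "vector_space s1 \<Longrightarrow> vector_space s2 \<Longrightarrow>
    Vector_Spaces.linear s1 s2 f \<longleftrightarrow> (\<forall>x y. f (x + y) = f x + f y) \<and> (\<forall>c
        x. f (s1 c x) = s2 c (f x))"
  by (auto simp: Vector_Spaces.linear_iff)

text \<open>
  For functions vanishing on lists of the wrong length, multilinearity needs no side conditions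
  on lengths when it is stated for lists of the form \<open>xs @ v # ys\<close>.
\<close>

definition multi_add :: "('v::ab_group_add list \<Rightarrow> 'w::ab_group_add) \<Rightarrow> bool" where
  "multi_add K \<longleftrightarrow> (\<forall>xs ys u v. K (xs @ (u + v) # ys) = K (xs @ u # ys) + K (xs @ v # ys))"

definition multi_scale :: "('k \<Rightarrow> 'v \<Rightarrow> 'v) \<Rightarrow> ('k \<Rightarrow> 'w
    \<Rightarrow> 'w) \<Rightarrow> ('v list \<Rightarrow> 'w) \<Rightarrow> bool" where
  "multi_scale sV sW K \<longleftrightarrow> (\<forall>xs ys c v. K (xs @ sV c v # ys) = sW c (K (xs @ v # ys)))"

lemma multilinear_iff:
  fixes sV :: "'k::field \<Rightarrow> 'v::ab_group_add \<Rightarrow> 'v" and sW :: "'k \<Rightarrow>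
      'w::ab_group_add \<Rightarrow> 'w"
  assumes "vector_space sV" "vector_space sW"
  shows "F \<in> multilinear sV sW n \<longleftrightarrow>
    (\<forall>xs. length xs \<noteq> n \<longrightarrow> F xs = 0) \<and> multi_add F \<and> multi_scale sV sW F"
proof
  interpret W: vector_space sW by fact
  assume F: "F \<in> multilinear sV sW n"
  then have z: "length xs \<noteq> n \<Longrightarrow> F xs = 0"
    and l: "length xs = n \<Longrightarrow> i < n \<Longrightarrow> Vector_Spaces.linear sV sW (\<lambda>v. F
        (xs[i := v]))" for xs i
    unfolding multilinear_def by blast+
  have lin: "Vector_Spaces.linear sV sW (\<lambda>v. F (xs @ v # ys))" for xs ys
  proof (cases "length (xs @ 0 # ys) = n")
    case True
    then have "length xs < n" by auto
    from l[OF True this] show ?thesis by simp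
  next
    case False
    then have "F (xs @ v # ys) = 0" for v by (intro z) simp
    then show ?thesis using assms by (simp add: linear_iff_vs)
  qed
  then show "(\<forall>xs. length xs \<noteq> n \<longrightarrow> F xs = 0) \<and> multi_add F \<and>
      multi_scale sV sW F"
    using z assms by (simp add: multi_add_def multi_scale_def linear_iff_vs)
next
  assume F: "(\<forall>xs. length xs \<noteq> n \<longrightarrow> F xs = 0) \<and> multi_add F \<and>
      multi_scale sV sW F"
  show "F \<in> multilinear sV sW n"
    unfolding multilinear_def
  proof (intro CollectI conjI allI impI)
    fix xs :: "'v list" and i assume i: "length xs = n \<and> i < n"
    show "Vector_Spaces.linear sV sW (\<lambda>v. F (xs[i := v]))"
      using F i assms by (simp add: linear_iff_vs upd_conv_take_nth_drop multi_add_def multi_scale_def)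
  qed (use F in simp)
qed

lemma tree_hom_iff:
  fixes sV :: "'k::field \<Rightarrow> 'v::ab_group_add \<Rightarrow> 'v" and sW :: "'k \<Rightarrow>
      'w::ab_group_add \<Rightarrow> 'w"
  assumes "vector_space sV" "vector_space sW"
  shows "F \<in> tree_hom sV sW n \<longleftrightarrow>
    (\<forall>T xs. T \<notin> trees n \<or> length xs \<noteq> n \<longrightarrow> F T xs = 0) \<and>
        (\<forall>T. multi_add (F T) \<and> multi_scale sV sW (F T))"
    (is "?L \<longleftrightarrow> ?R")
proof
  assume L: ?L
  interpret W: vector_space sW by fact
  have z: "multi_add (0 :: 'v list \<Rightarrow> 'w) \<and> multi_scale sV sW (0 :: 'v list \<Rightarrow> 'w)"
    by (simp add: multi_add_def multi_scale_def)
  have "multi_add (F T) \<and> multi_scale sV sW (F T)" for T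
    using L z by (cases "T \<in> trees n") (simp_all add: tree_hom_def multilinear_iff[OF assms])
  moreover have "T \<notin> trees n \<or> length xs \<noteq> n \<Longrightarrow> F T xs = 0" for T xs
    using L by (cases "T \<in> trees n") (simp_all add: tree_hom_def multilinear_iff[OF assms])
  ultimately show ?R by blast
next
  assume ?R
  then show ?L by (auto simp: tree_hom_def multilinear_iff[OF assms] fun_eq_iff)
qed

section \<open>Signs and alternating sums\<close>

lemma pm_simps [simp]:
  "pm e 0 = 0" "pm e (x + y) = pm e x + pm e y" "pm e (- x) = - pm e x" "pm e (x - y) = pm e x - pm e y"
  "pm a (pm b x) = pm (a + b) x" "pm 0 x = x"
  by (auto simp: pm_def)

lemma pm_sum: "pm e (sum f I) = (\<Sum>i\<in>I. pm e (f i))"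
  by (auto simp: pm_def sum_negf)

lemma pm_even: "even a \<Longrightarrow> pm a x = x"
  by (simp add: pm_def)

lemma pm_odd: "odd a \<Longrightarrow> pm a x = - x"
  by (simp add: pm_def)

lemma additive_pm: "additive f \<Longrightarrow> f (pm e x) = pm e (f x)"
  by (simp add: pm_def additive.minus)

lemma additive_fun_apply: "additive (\<lambda>F. F x)"
  by (simp add: additive_def)

text \<open>The argument for d^2 = 0 in a cosimplicial group: a pair (i, j) with i < j cancels
  against (j - 1, i), whose sign is opposite.\<close>

lemma alternating_double_sum_eq_0:
  fixes a :: "nat \<Rightarrow> nat \<Rightarrow> 'x::ab_group_add"
  assumes "\<And>i j. i < j \<Longrightarrow> j \<le> Suc N \<Longrightarrow> a i j = a (j - 1) i"
  shows "(\<Sum>i\<le>N. \<Sum>j\<le>Suc N. pm (int i + int j) (a i j)) = 0"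
proof -
  let ?e = "\<lambda>(i, j). pm (int i + int j) (a i j)"
  let ?I = "{(i, j). i \<le> N \<and> j \<le> Suc N}" and ?L = "{(i, j). i \<le> N \<and> j \<le> i}"
    and ?U = "{(i, j). i < j \<and> j \<le> Suc N}"
  have fin: "finite ?L" "finite ?U"
    by (rule finite_subset[of _ "{..N} \<times> {..Suc N}"]; force)+
  have "(\<Sum>i\<le>N. \<Sum>j\<le>Suc N. pm (int i + int j) (a i j)) = sum ?e ({..N} \<times> {..Suc N})"
    by (simp add: sum.cartesian_product del: sum.atMost_Suc)
  also have "{..N} \<times> {..Suc N} = ?L \<union> ?U" by auto
  also have "sum ?e (?L \<union> ?U) = sum ?e ?L + sum ?e ?U"
    using fin by (intro sum.union_disjoint) auto
  also have "sum ?e ?U = (\<Sum>p\<in>?L. - ?e p)"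
  proof (rule sum.reindex_bij_witness[of _ "\<lambda>(i, j). (j, Suc i)" "\<lambda>(i, j). (j - 1, i)"])
    fix p assume "p \<in> ?U"
    then obtain i j where p: "p = (i, j)" "i < j" "j \<le> Suc N" by auto
    then have "- pm (int (j - 1) + int i) (a (j - 1) i) = pm (int i + int j) (a i j)"
      using assms[of i j] by (simp add: pm_def of_nat_diff)
    then show "- ?e (case p of (i, j) \<Rightarrow> (j - 1, i)) = ?e p" using p by simp
  qed auto
  finally show ?thesis by (simp add: sum_negf)
qed

section \<open>The operad axioms\<close>

lemma op_eqI:
  assumes "\<And>T xs. T \<in> trees N \<Longrightarrow> length xs = N \<Longrightarrow> F T xs = G T xs"
    and "\<And>T xs. T \<notin> trees N \<or> length xs \<noteq> N \<Longrightarrow> F T xs = 0"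
    and "\<And>T xs. T \<notin> trees N \<or> length xs \<noteq> N \<Longrightarrow> G T xs = 0"
  shows "F = G"
  using assms by (intro ext) metis

lemma split_list3:
  assumes "length xs = p + q + r"
  obtains as bs cs where "xs = as @ bs @ cs" "length as = p" "length bs = q" "length cs = r"
proof
  show "xs = take p xs @ take q (drop p xs) @ drop (p + q) xs"
    by (metis append_take_drop_id drop_drop add.commute)
qed (use assms in auto)

lemma circ_outside: "T \<notin> trees (m + n - 1) \<or> length xs \<noteq> m + n - 1 \<Longrightarrow> circ m n
    i f g T xs = 0"
  by (auto simp: circ_def)

lemma circ_append:
  assumes "T \<in> trees (m + n - 1)" "length xs = i - 1" "length ys = n" "length zs = m - i" "1 \<le> i" "i \<le> m"
  shows "circ m n i f g T (xs @ ys @ zs) = f (R_outer i n T) (xs @ g (R_inner i n T) ys # zs)"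
  using assms by (auto simp: circ_def)

text \<open>The list of arguments is cut into five blocks, with the arguments of \<open>h\<close> in
  the middle and those of \<open>g\<close> on both sides of them; \<open>R_outer_outer_seq\<close>
  identifies the three trees involved.\<close>

lemma circ_assoc_seq:
  assumes "1 \<le> i" "i \<le> m" "1 \<le> j" "j \<le> n" "1 \<le> p"
  shows "circ (m + n - 1) p (i + j - 1) (circ m n i f g) h = circ m (n + p - 1) i f (circ n p j g h)"
proof -
  have e: "m + n - 1 + p - 1 = m + n + p - 2" "m + (n + p - 1) - 1 = m + n + p - 2"
    using assms by auto
  show ?thesis
proof (rule op_eqI[of "m + n + p - 2"])
  fix T and xs :: "('a \<times> 'b) list"
  assume T: "T \<in> trees (m + n + p - 2)" and "length xs = m + n + p - 2"
  then have "length xs = (i - 1) + (n + p - 1) + (m - i)" using assms by simp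
  then obtain as ys es where 1: "xs = as @ ys @ es" "length as = i - 1" "length ys = n + p - 1" "length es = m - i"
    by (rule split_list3)
  have "length ys = (j - 1) + p + (n - j)" using 1 assms by simp
  then obtain bs cs ds where 2: "ys = bs @ cs @ ds" "length bs = j - 1" "length cs = p" "length ds = n - j"
    by (rule split_list3)
  note R = R_outer_outer_seq[OF T assms]
  have T1: "T \<in> trees (m + n - 1 + p - 1)" and T2: "T \<in> trees (m + (n + p - 1) - 1)"
    unfolding e by (fact T)+
  have o: "R_outer (i + j - 1) p T \<in> trees (m + n - 1)"
    by (rule R_outer_tree[OF T1]) (use assms in auto)
  have i: "R_inner i (n + p - 1) T \<in> trees (n + p - 1)"
    by (rule R_inner_tree[OF T2]) (use assms in auto)
  have "circ (m + n - 1) p (i + j - 1) (circ m n i f g) h T ((as @ bs) @ cs @ (ds @ es))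
    = circ m n i f g (R_outer (i + j - 1) p T) ((as @ bs) @ h (R_inner (i + j - 1) p T) cs # (ds @ es))"
    by (rule circ_append[OF T1]) (use assms 1 2 in auto)
  also have "\<dots> = circ m n i f g (R_outer (i + j - 1) p T) (as @ (bs @ h (R_inner (i + j - 1) p T) cs # ds) @ es)"
    by simp
  also have "\<dots> = f (R_outer i n (R_outer (i + j - 1) p T))
      (as @ g (R_inner i n (R_outer (i + j - 1) p T)) (bs @ h (R_inner (i + j - 1) p T) cs # ds) # es)"
    by (rule circ_append) (use o assms 1 2 in auto)
  also have "\<dots> = f (R_outer i (n + p - 1) T) (as @ circ n p j g h (R_inner i (n + p - 1) T) (bs @ cs @ ds) # es)"
    unfolding R(1,2) R(3)[symmetric] by (subst circ_append[OF i]) (use assms 1 2 in auto)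
  also have "\<dots> = circ m (n + p - 1) i f (circ n p j g h) T (as @ (bs @ cs @ ds) @ es)"
    by (rule circ_append[OF T2, symmetric]) (use assms 1 2 in auto)
  finally show "circ (m + n - 1) p (i + j - 1) (circ m n i f g) h T xs = circ m (n + p - 1) i f (circ n p j g h) T xs"
    by (simp add: 1 2)
qed (rule circ_outside, unfold e, assumption)+
qed

lemma circ_assoc_par:
  assumes "1 \<le> i" "i < k" "k \<le> m" "1 \<le> n" "1 \<le> p"
  shows "circ (m + n - 1) p (k + n - 1) (circ m n i f g) h = circ (m + p - 1) n i (circ m p k f h) g"
proof -
  have e: "m + n - 1 + p - 1 = m + n + p - 2" "m + p - 1 + n - 1 = m + n + p - 2"
    using assms by auto
  show ?thesis
proof (rule op_eqI[of "m + n + p - 2"])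
  fix T and xs :: "('a \<times> 'b) list"
  assume T: "T \<in> trees (m + n + p - 2)" and "length xs = m + n + p - 2"
  then have "length xs = (i - 1) + n + (k - 1 - i + p + (m - k))" using assms by simp
  then obtain as bs ys where 1: "xs = as @ bs @ ys" "length as = i - 1" "length bs = n"
    "length ys = (k - 1 - i) + p + (m - k)"
    by (rule split_list3)
  from 1(4) obtain cs ds es where 2: "ys = cs @ ds @ es" "length cs = k - 1 - i" "length ds = p" "length es = m - k"
    by (rule split_list3)
  note R = R_outer_outer_par[OF T assms]
  have T1: "T \<in> trees (m + n - 1 + p - 1)" and T2: "T \<in> trees (m + p - 1 + n - 1)"
    unfolding e by (fact T)+
  have o: "R_outer (k + n - 1) p T \<in> trees (m + n - 1)"
    by (rule R_outer_tree[OF T1]) (use assms in auto)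
  have o': "R_outer i n T \<in> trees (m + p - 1)"
    by (rule R_outer_tree[OF T2]) (use assms in auto)
  have "circ (m + n - 1) p (k + n - 1) (circ m n i f g) h T ((as @ bs @ cs) @ ds @ es)
    = circ m n i f g (R_outer (k + n - 1) p T) ((as @ bs @ cs) @ h (R_inner (k + n - 1) p T) ds # es)"
    by (rule circ_append[OF T1]) (use assms 1 2 in auto)
  also have "\<dots> = circ m n i f g (R_outer (k + n - 1) p T) (as @ bs @ (cs @ h (R_inner (k + n - 1) p T) ds # es))"
    by simp
  also have "\<dots> = f (R_outer i n (R_outer (k + n - 1) p T))
      (as @ g (R_inner i n (R_outer (k + n - 1) p T)) bs # (cs @ h (R_inner (k + n - 1) p T) ds # es))"
    by (rule circ_append) (use o assms 1 2 in auto)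
  also have "\<dots> = f (R_outer k p (R_outer i n T))
      ((as @ g (R_inner i n T) bs # cs) @ h (R_inner k p (R_outer i n T)) ds # es)"
    unfolding R by simp
  also have "\<dots> = circ m p k f h (R_outer i n T) ((as @ g (R_inner i n T) bs # cs) @ ds @ es)"
    by (rule circ_append[symmetric]) (use o' assms 1 2 in auto)
  also have "\<dots> = circ m p k f h (R_outer i n T) (as @ g (R_inner i n T) bs # (cs @ ds @ es))"
    by simp
  also have "\<dots> = circ (m + p - 1) n i (circ m p k f h) g T (as @ bs @ (cs @ ds @ es))"
    by (rule circ_append[OF T2, symmetric]) (use assms 1 2 in auto)
  finally show "circ (m + n - 1) p (k + n - 1) (circ m n i f g) h T xs = circ (m + p - 1) n i (circ m p k f h) g T xs"
    by (simp add: 1 2)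
qed (rule circ_outside, unfold e, assumption)+
qed

text \<open>
  The cofaces of the cosimplicial object behind $[\mu,-]$; they satisfy the cosimplicial identities
  as soon as \<open>\<mu>\<close> is associative, without any linearity.
\<close>

definition coface :: "('a::ab_group_add, 'b::ab_group_add) op \<Rightarrow> nat \<Rightarrow> nat \<Rightarrow>
    ('a, 'b) op \<Rightarrow> ('a, 'b) op" where
  "coface \<mu> n i f = (if i = 0 then circ 2 n 2 \<mu> f else if i \<le> n then circ n 2 i f \<mu> else circ 2
      n 1 \<mu> f)"

text \<open>Associativity of \<mu> is used where two copies of \<mu> meet: for j = i + 1, and for i
  = 0 and j = n + 2. The remaining cases are instances of the operad axioms.\<close>

lemma coface_coface:
  assumes \<mu>: "circ 2 2 1 \<mu> \<mu> = circ 2 2 2 \<mu> \<mu>" and "1 \<le> n" "i < j" "j \<le> n + 2"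
  shows "coface \<mu> (n + 1) j (coface \<mu> n i f) = coface \<mu> (n + 1) i (coface \<mu> n (j - 1) f)"
proof -
  have e: "2 + 2 - 1 = (3::nat)" "2 + n - 1 = n + 1" "n + 2 - 1 = n + 1" "2 + 1 - 1 = (2::nat)"
    "1 + 2 - 1 = (2::nat)" "1 + 1 - 1 = (1::nat)" by simp_all
  have "i = 0 \<and> j = 1 \<or> i = 0 \<and> 2 \<le> j \<and> j \<le> n + 1 \<or> i = 0 \<and> j = n + 2
    \<or> 1 \<le> i \<and> j = i + 1 \<and> j \<le> n + 1 \<or> 1 \<le> i \<and> i + 1 < j \<and> j \<le> n + 1
    \<or> 1 \<le> i \<and> i \<le> n \<and> j = n + 2 \<or> i = n + 1 \<and> j = n + 2"
    using assms(2-) by presburger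
  then consider "i = 0" "j = 1" | "i = 0" "2 \<le> j" "j \<le> n + 1" | "i = 0" "j = n + 2"
    | "1 \<le> i" "j = i + 1" "j \<le> n + 1" | "1 \<le> i" "i + 1 < j" "j \<le> n + 1"
    | "1 \<le> i" "i \<le> n" "j = n + 2" | "i = n + 1" "j = n + 2"
    by blast
  then show ?thesis
  proof cases
    case 1
    have "circ (n + 1) 2 1 (circ 2 n 2 \<mu> f) \<mu> = circ 3 n 3 (circ 2 2 1 \<mu> \<mu>) f"
      using circ_assoc_par[of 1 2 2 2 n \<mu> \<mu> f] assms unfolding e by simp
    also have "\<dots> = circ 2 (n + 1) 2 \<mu> (circ 2 n 2 \<mu> f)"
      using circ_assoc_seq[of 2 2 2 2 n \<mu> \<mu> f] assms unfolding e \<mu> by simp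
    finally show ?thesis using 1 assms by (simp add: coface_def)
  next
    case 2
    have "circ (n + 1) 2 j (circ 2 n 2 \<mu> f) \<mu> = circ 2 (n + 1) 2 \<mu> (circ n 2 (j - 1) f \<mu>)"
      using circ_assoc_seq[of 2 2 "j - 1" n 2 \<mu> f \<mu>] 2 unfolding e by simp
    moreover have "j - 1 \<noteq> 0" "j - 1 \<le> n" using 2 by auto
    ultimately show ?thesis using 2 by (simp add: coface_def)
  next
    case 3
    have "circ 2 (n + 1) 1 \<mu> (circ 2 n 2 \<mu> f) = circ 3 n 2 (circ 2 2 1 \<mu> \<mu>) f"
      using circ_assoc_seq[of 1 2 2 2 n \<mu> \<mu> f] assms unfolding e by simp
    also have "\<dots> = circ 2 (n + 1) 2 \<mu> (circ 2 n 1 \<mu> f)"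
      using circ_assoc_seq[of 2 2 1 2 n \<mu> \<mu> f] assms unfolding e \<mu> by simp
    finally show ?thesis using 3 by (simp add: coface_def)
  next
    case 4
    have "circ (n + 1) 2 (i + 1) (circ n 2 i f \<mu>) \<mu> = circ n 3 i f (circ 2 2 2 \<mu> \<mu>)"
      using circ_assoc_seq[of i n 2 2 2 f \<mu> \<mu>] 4 unfolding e by simp
    also have "\<dots> = circ (n + 1) 2 i (circ n 2 i f \<mu>) \<mu>"
      using circ_assoc_seq[of i n 1 2 2 f \<mu> \<mu>] 4 unfolding e \<mu> by simp
    finally show ?thesis using 4 by (simp add: coface_def)
  next
    case 5
    have "circ (n + 1) 2 j (circ n 2 i f \<mu>) \<mu> = circ (n + 1) 2 i (circ n 2 (j - 1) f \<mu>) \<mu>"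
      using circ_assoc_par[of i "j - 1" n 2 2 f \<mu> \<mu>] 5 unfolding e by simp
    moreover have "j - 1 \<noteq> 0" "j - 1 \<le> n" using 5 by auto
    ultimately show ?thesis using 5 by (simp add: coface_def)
  next
    case 6
    have "circ 2 (n + 1) 1 \<mu> (circ n 2 i f \<mu>) = circ (n + 1) 2 i (circ 2 n 1 \<mu> f) \<mu>"
      using circ_assoc_seq[of 1 2 i n 2 \<mu> f \<mu>] 6 unfolding e by simp
    then show ?thesis using 6 by (simp add: coface_def)
  next
    case 7
    have "circ 2 (n + 1) 1 \<mu> (circ 2 n 1 \<mu> f) = circ 3 n 1 (circ 2 2 1 \<mu> \<mu>) f"
      using circ_assoc_seq[of 1 2 1 2 n \<mu> \<mu> f] assms unfolding e by simp
    also have "\<dots> = circ (n + 1) 2 (n + 1) (circ 2 n 1 \<mu> f) \<mu>"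
      using circ_assoc_par[of 1 2 2 n 2 \<mu> f \<mu>] assms unfolding e \<mu> by simp
    finally show ?thesis using 7 by (simp add: coface_def)
  qed
qed

lemma sum_atMost_Suc_endpoints:
  "(\<Sum>i\<le>Suc n. g i) = g 0 + (\<Sum>i=1..n. g i) + (g (Suc n) :: 'x::ab_group_add)"
  by (induction n) (auto simp: algebra_simps)

section \<open>The differential of an associative operation\<close>

text \<open>Once (-1)^(n-1) is taken out, the sign of the i-th coface is (-1)^i. The first sum of
  the bracket gives the two outer cofaces, the second sum the inner ones.\<close>

lemma bracket_eq_coface:
  assumes "1 \<le> n"
  shows "bracket 2 n \<mu> f = pm (int n - 1) (\<Sum>i\<le>Suc n. pm (int i) (coface \<mu> n i f))"
proof -
  have 1: "(\<Sum>i=1..2. pm ((int i - 1) * (int n - 1)) (circ 2 n i \<mu> f))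
      = circ 2 n 1 \<mu> f + pm (int n - 1) (circ 2 n 2 \<mu> f)"
    by (simp add: numeral_2_eq_2)
  have "pm (int n - 1) (pm (int i) (coface \<mu> n i f)) = - pm (int n - 1) (pm (int i - 1) (circ n 2 i f \<mu>))"
    if "i \<in> {1..n}" for i
    using that by (simp add: coface_def) (simp add: pm_def)
  then have 2: "(\<Sum>i=1..n. pm (int n - 1) (pm (int i) (coface \<mu> n i f)))
      = - pm (int n - 1) (\<Sum>i=1..n. pm (int i - 1) (circ n 2 i f \<mu>))"
    by (simp add: pm_sum sum_negf)
  have 3: "pm (int n - 1) (pm (int (Suc n)) (coface \<mu> n (Suc n) f)) = circ 2 n 1 \<mu> f"
    by (simp add: coface_def pm_even)
  have 4: "coface \<mu> n 0 f = circ 2 n 2 \<mu> f" by (simp add: coface_def)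
  have "pm (int n - 1) (\<Sum>i\<le>Suc n. pm (int i) (coface \<mu> n i f))
    = pm (int n - 1) (coface \<mu> n 0 f) + (\<Sum>i=1..n. pm (int n - 1) (pm (int i) (coface \<mu> n i f)))
      + pm (int n - 1) (pm (int (Suc n)) (coface \<mu> n (Suc n) f))"
    unfolding sum_atMost_Suc_endpoints by (simp add: pm_sum del: of_nat_Suc)
  also have "\<dots> = bracket 2 n \<mu> f"
    unfolding 2 3 4 bracket_def 1 by simp
  finally show ?thesis ..
qed

lemma circ_add_left: "circ m n i (f + f') g = circ m n i f g + circ m n i f' g"
  by (auto simp: circ_def fun_eq_iff)

section \<open>Spaces of operations on the sum of A and B\<close>

locale two_spaces = A: vector_space sA + B: vector_space sB
  for sA :: "'k::field \<Rightarrow> 'a::ab_group_add \<Rightarrow> 'a" and sB :: "'k \<Rightarrow>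
      'b::ab_group_add \<Rightarrow> 'b"
begin

abbreviation sD :: "'k \<Rightarrow> 'a \<times> 'b \<Rightarrow> 'a \<times> 'b" where "sD \<equiv> scaleD sA sB"
abbreviation C :: "nat \<Rightarrow> ('a, 'b) op set" where "C \<equiv> Cspace sA sB"

lemma vector_space_D: "vector_space sD"
  by standard (auto simp: scaleD_def A.scale_right_distrib A.scale_left_distrib
      B.scale_right_distrib B.scale_left_distrib)

sublocale D: vector_space sD by (rule vector_space_D)

lemma C_iff:
  "F \<in> C n \<longleftrightarrow> (\<forall>T xs. T \<notin> trees n \<or> length xs \<noteq> n
      \<longrightarrow> F T xs = 0)
    \<and> (\<forall>T. multi_add (F T) \<and> multi_scale sD sD (F T))"
  unfolding Cspace_def by (rule tree_hom_iff[OF vector_space_D vector_space_D])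

lemma C_outside: "F \<in> C n \<Longrightarrow> T \<notin> trees n \<or> length xs \<noteq> n \<Longrightarrow>
    F T xs = 0"
  unfolding C_iff by blast

lemma C_add: "F \<in> C n \<Longrightarrow> F T (xs @ (u + v) # ys) = F T (xs @ u # ys) + F T (xs @ v # ys)"
  unfolding C_iff multi_add_def by blast

lemma C_scale: "F \<in> C n \<Longrightarrow> F T (xs @ sD c v # ys) = sD c (F T (xs @ v # ys))"
  unfolding C_iff multi_scale_def by blast

lemma C_I:
  assumes "\<And>T xs. T \<notin> trees n \<or> length xs \<noteq> n \<Longrightarrow> F T xs = 0"
    and "\<And>T xs ys u v. F T (xs @ (u + v) # ys) = F T (xs @ u # ys) + F T (xs @ v # ys)"
    and "\<And>T xs ys c v. F T (xs @ sD c v # ys) = sD c (F T (xs @ v # ys))"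
  shows "F \<in> C n"
  unfolding C_iff multi_add_def multi_scale_def using assms by blast

lemma C_zero_arg: "F \<in> C n \<Longrightarrow> F T (xs @ 0 # ys) = 0"
  using C_add[of F n T xs 0 0 ys] by simp

definition scale_op :: "'k \<Rightarrow> ('a, 'b) op \<Rightarrow> ('a, 'b) op" where
  "scale_op c F = (\<lambda>T xs. sD c (F T xs))"

lemma scale_op_apply: "scale_op c F T xs = sD c (F T xs)"
  by (simp add: scale_op_def)

lemma additive_scale_op: "additive (scale_op c)"
  by (simp add: additive_def scale_op_def fun_eq_iff D.scale_right_distrib)

lemmas scale_op_simps [simp] = additive.add[OF additive_scale_op] additive.diff[OF additive_scale_op]
  additive.minus[OF additive_scale_op] additive.zero[OF additive_scale_op]

lemma scale_op_1 [simp]: "scale_op 1 F = F"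
  by (simp add: scale_op_def)

lemma scale_op_scale_op [simp]: "scale_op c (scale_op d F) = scale_op (c * d) F"
  by (simp add: scale_op_def)

lemma zero_in_C: "0 \<in> C n"
  by (rule C_I) simp_all

lemma add_in_C: "F \<in> C n \<Longrightarrow> G \<in> C n \<Longrightarrow> F + G \<in> C n"
  by (rule C_I) (simp_all add: C_outside C_add C_scale D.scale_right_distrib algebra_simps)

lemma uminus_in_C: "F \<in> C n \<Longrightarrow> - F \<in> C n"
  by (rule C_I) (simp_all add: C_outside C_add C_scale)

lemma diff_in_C: "F \<in> C n \<Longrightarrow> G \<in> C n \<Longrightarrow> F - G \<in> C n"
  using add_in_C[of F n "- G"] uminus_in_C by simp

lemma scale_op_in_C: "F \<in> C n \<Longrightarrow> scale_op c F \<in> C n"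
  by (rule C_I) (simp_all add: scale_op_def C_outside C_add C_scale D.scale_right_distrib mult.commute)

lemma pm_in_C: "F \<in> C n \<Longrightarrow> pm e F \<in> C n"
  by (simp add: pm_def uminus_in_C)

lemma sum_in_C: "(\<And>i. i \<in> I \<Longrightarrow> F i \<in> C n) \<Longrightarrow> sum F I \<in> C n"
  by (induction I rule: infinite_finite_induct) (auto intro: add_in_C zero_in_C)

text \<open>A single entry of the argument list reaches either \<open>f\<close> directly or
  \<open>f\<close> through \<open>g\<close>; multilinearity of a composition has to be checked for
  these two shapes only.\<close>

lemma circ_slot:
  assumes T: "T \<in> trees (m + n - 1)" and i: "1 \<le> i" "i \<le> m" and l: "length xs + 1 + length ys = m + n - 1"
  obtains
    (outer) U as bs where "\<And>v. circ m n i f g T (xs @ v # ys) = f U (as @ v # bs)"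
  | (inner) U V as bs cs ds where "\<And>v. circ m n i f g T (xs @ v # ys) = f U (as @ g V (cs @ v # ds) # bs)"
proof -
  have "length xs < i - 1 \<or> i - 1 \<le> length xs \<and> length xs < i - 1 + n \<or> i - 1 + n \<le> length xs"
    by linarith
  then consider "length xs < i - 1" | "i - 1 \<le> length xs" "length xs < i - 1 + n" | "i - 1 + n \<le> length xs"
    by blast
  then show ?thesis
  proof cases
    case 1
    then have "length ys = (i - 1 - length xs - 1) + n + (m - i)" using l i by simp
    then obtain y1 y2 y3 where y: "ys = y1 @ y2 @ y3" "length y1 = i - 1 - length xs - 1" "length y2 = n"
        "length y3 = m - i"
      by (rule split_list3)
    have "circ m n i f g T ((xs @ v # y1) @ y2 @ y3) = f (R_outer i n T) ((xs @ v # y1) @ g (R_inner i n T) y2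
        # y3)" for v
      by (rule circ_append[OF T]) (use 1 y i in auto)
    then show ?thesis using outer[of "R_outer i n T" xs "y1 @ g (R_inner i n T) y2 # y3"] by (simp add: y)
  next
    case 2
    obtain x1 x2 where x: "xs = x1 @ x2" "length x1 = i - 1"
      using 2 by (intro that[of "take (i - 1) xs" "drop (i - 1) xs"]) auto
    have "length ys = (n - 1 - length x2) + (m - i)" using 2 x l i by simp
    then obtain y1 y2 where y: "ys = y1 @ y2" "length y1 = n - 1 - length x2" "length y2 = m - i"
      by (intro that[of "take (n - 1 - length x2) ys" "drop (n - 1 - length x2) ys"]) auto
    have "circ m n i f g T (x1 @ (x2 @ v # y1) @ y2) = f (R_outer i n T) (x1 @ g (R_inner i n T) (x2 @ v # y1)
        # y2)" for v
      by (rule circ_append[OF T]) (use 2 x y i in auto)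
    then show ?thesis using inner[of "R_outer i n T" x1 "R_inner i n T" x2 y1 y2] by (simp add: x y)
  next
    case 3
    then obtain k where k: "length xs = (i - 1) + n + k" using le_Suc_ex by blast
    then obtain x1 x2 x3 where x: "xs = x1 @ x2 @ x3" "length x1 = i - 1" "length x2 = n" "length x3 = k"
      by (rule split_list3)
    have "circ m n i f g T (x1 @ x2 @ (x3 @ v # ys)) = f (R_outer i n T) (x1 @ g (R_inner i n T) x2 # (x3 @ v #
        ys))" for v
      by (rule circ_append[OF T]) (use k x l i in auto)
    then show ?thesis using outer[of "R_outer i n T" "x1 @ g (R_inner i n T) x2 # x3" ys] by (simp add: x)
  qed
qed

lemma circ_in_C:
  assumes f: "f \<in> C m" and g: "g \<in> C n" and i: "1 \<le> i" "i \<le> m"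
  shows "circ m n i f g \<in> C (m + n - 1)"
proof (rule C_I)
  show "circ m n i f g T xs = 0" if "T \<notin> trees (m + n - 1) \<or> length xs \<noteq> m + n - 1" for T xs
    using that by (rule circ_outside)
  have *: "circ m n i f g T (xs @ (u + v) # ys) = circ m n i f g T (xs @ u # ys) + circ m n i f g T (xs @ v # ys)
    \<and> circ m n i f g T (xs @ sD c v # ys) = sD c (circ m n i f g T (xs @ v # ys))" for T xs ys u v c
  proof (cases "T \<in> trees (m + n - 1) \<and> length xs + 1 + length ys = m + n - 1")
    case True
    then have T: "T \<in> trees (m + n - 1)" and l: "length xs + 1 + length ys = m + n - 1" by auto
    show ?thesis
      by (rule circ_slot[OF T i l, of f g]) (simp_all add: C_add[OF f] C_scale[OF f] C_add[OF g] C_scale[OF g])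
  next
    case False
    then have "circ m n i f g T (xs @ w # ys) = 0" for w by (intro circ_outside) auto
    then show ?thesis by simp
  qed
  show "circ m n i f g T (xs @ (u + v) # ys) = circ m n i f g T (xs @ u # ys) + circ m n i f g T (xs @ v # ys)"
    and "circ m n i f g T (xs @ sD c v # ys) = sD c (circ m n i f g T (xs @ v # ys))" for T xs ys u v c
    using * by blast+
qed

lemma circ_add_right: "f \<in> C m \<Longrightarrow> circ m n i f (g + g') = circ m n i f g + circ m n i f g'"
  by (auto simp: circ_def fun_eq_iff C_add)

lemma circ_scale_left: "circ m n i (scale_op c f) g = scale_op c (circ m n i f g)"
  by (auto simp: circ_def fun_eq_iff scale_op_def)

lemma circ_scale_right: "f \<in> C m \<Longrightarrow> circ m n i f (scale_op c g) = scale_op c (circ m n i f g)"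
  by (auto simp: circ_def fun_eq_iff scale_op_def C_scale)

lemma bracket_in_C:
  assumes "f \<in> C m" "g \<in> C n"
  shows "bracket m n f g \<in> C (m + n - 1)"
proof -
  have "circ n m i g f \<in> C (m + n - 1)" if "1 \<le> i" "i \<le> n" for i
    using circ_in_C[OF assms(2,1) that] by (simp add: add.commute)
  moreover have "circ m n i f g \<in> C (m + n - 1)" if "1 \<le> i" "i \<le> m" for i
    using circ_in_C[OF assms that] .
  ultimately show ?thesis unfolding bracket_def
    by (intro diff_in_C pm_in_C sum_in_C) auto
qed

lemma additive_bracket_right: "f \<in> C m \<Longrightarrow> additive (bracket m n f)"
  by (simp add: additive_def bracket_def circ_add_left circ_add_right sum.distrib)

lemma additive_bracket_left: "g \<in> C n \<Longrightarrow> additive (\<lambda>f. bracket m n f g)"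
  by (simp add: additive_def bracket_def circ_add_left circ_add_right sum.distrib)

lemma scale_op_pm: "scale_op c (pm e F) = pm e (scale_op c F)"
  by (rule additive_pm[OF additive_scale_op])

lemma scale_op_sum: "scale_op c (sum F I) = (\<Sum>i\<in>I. scale_op c (F i))"
  by (rule additive.sum[OF additive_scale_op])

lemma bracket_scale_right: "f \<in> C m \<Longrightarrow> bracket m n f (scale_op c g) = scale_op c (bracket m n f g)"
  by (simp add: bracket_def circ_scale_left circ_scale_right scale_op_sum scale_op_pm)

lemma bracket_scale_left: "g \<in> C n \<Longrightarrow> bracket m n (scale_op c f) g = scale_op c (bracket m n f g)"
  by (simp add: bracket_def circ_scale_left circ_scale_right scale_op_sum scale_op_pm)

lemma additive_coface: "\<mu> \<in> C 2 \<Longrightarrow> additive (coface \<mu> n i)"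
  by (simp add: additive_def coface_def circ_add_left circ_add_right)

text \<open>The global signs of the two brackets come out as one sign. What remains is the
  alternating double sum of cofaces, which cancels by the cosimplicial identities.\<close>

lemma bracket_bracket_eq_0:
  assumes \<mu>: "\<mu> \<in> C 2" "circ 2 2 1 \<mu> \<mu> = circ 2 2 2 \<mu> \<mu>" and n: "1 \<le> n"
  shows "bracket 2 (n + 1) \<mu> (bracket 2 n \<mu> f) = 0"
proof -
  let ?d = "\<lambda>n i. coface \<mu> n i"
  note add = additive_coface[OF \<mu>(1)]
  have "bracket 2 (n + 1) \<mu> (bracket 2 n \<mu> f)
    = pm (int n) (\<Sum>j\<le>n + 2. pm (int j) (?d (n + 1) j (pm (int n - 1) (\<Sum>i\<le>n + 1. pm (int i)
        (?d n i f)))))"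
    using n by (simp add: bracket_eq_coface del: sum.atMost_Suc)
  also have "\<dots> = pm (int n + (int n - 1)) (\<Sum>j\<le>n + 2. \<Sum>i\<le>n + 1. pm (int i + int j) (?d
      (n + 1) j (?d n i f)))"
    by (simp add: additive_pm[OF add] additive.sum[OF add] pm_sum add.commute add.left_commute add.assoc
        del: sum.atMost_Suc pm_simps(2))
  also have "(\<Sum>j\<le>n + 2. \<Sum>i\<le>n + 1. pm (int i + int j) (?d (n + 1) j (?d n i f)))
    = (\<Sum>i\<le>n + 1. \<Sum>j\<le>Suc (n + 1). pm (int i + int j) (?d (n + 1) j (?d n i f)))"
    by (subst sum.swap) simp
  also have "\<dots> = 0"
    by (rule alternating_double_sum_eq_0) (use coface_coface[OF \<mu>(2) n] in auto)
  finally show ?thesis unfolding pm_simps(1) .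
qed

end

section \<open>The projection onto the operations from B to A\<close>

abbreviation zero_fst :: "'a::zero \<times> 'b \<Rightarrow> 'a \<times> 'b" where "zero_fst \<equiv>
    \<lambda>d. (0, snd d)"

lemma additive_proj: "additive proj"
  by (auto simp: additive_def proj_def fun_eq_iff)

lemmas proj_simps [simp] = additive.add[OF additive_proj] additive.diff[OF additive_proj]
  additive.minus[OF additive_proj] additive.zero[OF additive_proj]

lemma fst_proj_zero: "map zero_fst xs = xs \<Longrightarrow> fst (proj F T xs) = fst (F T xs)"
  by (simp add: proj_def)

context two_spaces
begin

lemma proj_scale_op: "proj (scale_op c F) = scale_op c (proj F)"
  by (auto simp: proj_def scale_op_def fun_eq_iff scaleD_def)

lemma proj_in_C:
  assumes "F \<in> C n"
  shows "proj F \<in> C n"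
proof (rule C_I)
  have e: "zero_fst (u + v) = zero_fst u + zero_fst v" "zero_fst (sD c v) = sD c (zero_fst v)"
    for u v :: "'a \<times> 'b" and c
    by (auto simp: scaleD_def)
  then show "proj F T (xs @ (u + v) # ys) = proj F T (xs @ u # ys) + proj F T (xs @ v # ys)"
    and "proj F T (xs @ sD c v # ys) = sD c (proj F T (xs @ v # ys))" for T xs ys u v c
    unfolding proj_def map_append list.map e C_add[OF assms] C_scale[OF assms] by (simp_all add: scaleD_def)
qed (simp add: proj_def C_outside[OF assms] zero_prod_def)

text \<open>
  The kernel of $p$ is closed under $\circ_i$ and contains \<open>\<mu>\<close>, so only $p X$ contributes.
\<close>

lemma proj_bracket_proj:
  assumes \<mu>: "\<mu> \<in> C 2" "proj \<mu> = 0" and X: "X \<in> C n"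
  shows "proj (bracket 2 n \<mu> (proj X)) = proj (bracket 2 n \<mu> X)"
proof -
  have \<mu>0: "fst (\<mu> T xs) = 0" if "map zero_fst xs = xs" for T xs
    using fst_proj_zero[OF that, of \<mu> T] \<mu>(2) by simp
  have 1: "proj (circ 2 n i \<mu> (proj X)) = proj (circ 2 n i \<mu> X)" for i
  proof (intro ext)
    fix T and ds :: "('a \<times> 'b) list"
    let ?ds = "map zero_fst ds"
    let ?as = "take (i - 1) ?ds" and ?bs = "drop (i - 1 + n) ?ds"
    let ?x = "X (R_inner i n T) (take n (drop (i - 1) ?ds))"
    let ?y = "proj X (R_inner i n T) (take n (drop (i - 1) ?ds))"
    \<comment> \<open>On arguments from B the values of \<open>X\<close> and \<open>proj X\<close>
      differ by an element of B; with this element \<mu> has only arguments from B, and its A-value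
      vanishes.\<close>
    have "?x = ?y + (0, snd ?x)"
      by (simp add: proj_def take_map drop_map comp_def prod_eq_iff)
    then have "\<mu> (R_outer i n T) (?as @ ?x # ?bs)
      = \<mu> (R_outer i n T) (?as @ ?y # ?bs) + \<mu> (R_outer i n T) (?as @ (0, snd ?x) # ?bs)"
      using C_add[OF \<mu>(1)] by metis
    moreover have "fst (\<mu> (R_outer i n T) (?as @ (0, snd ?x) # ?bs)) = 0"
      by (rule \<mu>0) (simp add: take_map drop_map comp_def)
    ultimately show "proj (circ 2 n i \<mu> (proj X)) T ds = proj (circ 2 n i \<mu> X) T ds"
      unfolding proj_def[of "circ _ _ _ _ _"] by (simp add: circ_def)
  qed
  have 2: "proj (circ n 2 i (proj X) \<mu>) = proj (circ n 2 i X \<mu>)" for i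
  proof (intro ext)
    fix T and ds :: "('a \<times> 'b) list"
    let ?ds = "map zero_fst ds"
    \<comment> \<open>\<mu> sends arguments from B to B, so the arguments that reach
      \<open>X\<close> all lie in B, where \<open>X\<close> and \<open>proj X\<close> have the same
      A-value.\<close>
    have "fst (\<mu> (R_inner i 2 T) (take 2 (drop (i - 1) ?ds))) = 0"
      by (rule \<mu>0) (simp add: take_map drop_map comp_def)
    then have "zero_fst (\<mu> (R_inner i 2 T) (take 2 (drop (i - 1) ?ds))) = \<mu> (R_inner i 2 T) (take 2
        (drop (i - 1) ?ds))"
      by (simp add: prod_eq_iff)
    then show "proj (circ n 2 i (proj X) \<mu>) T ds = proj (circ n 2 i X \<mu>) T ds"
      unfolding proj_def[of "circ _ _ _ _ _"]
      by (simp add: circ_def) (simp add: fst_proj_zero take_map drop_map comp_def)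
  qed
  show ?thesis
    unfolding bracket_def
    by (simp add: additive.sum[OF additive_proj] additive_pm[OF additive_proj] 1 2)
qed

end

section \<open>Conjugation by the exponential of an operator\<close>

text \<open>
  \<open>sum_slots \<nu> K\<close> is $\sum_i K \circ_i \nu$; its powers are needed to compute iterated brackets
  with an operation of arity 1.
\<close>

primrec sum_slots :: "('v \<Rightarrow> 'v) \<Rightarrow> ('v list \<Rightarrow> 'w) \<Rightarrow> 'v list
    \<Rightarrow> 'w::comm_monoid_add" where
  "sum_slots \<nu> K [] = 0"
| "sum_slots \<nu> K (x # xs) = K (\<nu> x # xs) + sum_slots \<nu> (\<lambda>ys. K (x # ys)) xs"

lemma sum_slots_eq: "sum_slots \<nu> K xs = (\<Sum>i<length xs. K (take i xs @ \<nu> (xs ! i) # drop (Suc i) xs))"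
  by (induction xs arbitrary: K) (simp_all add: sum.lessThan_Suc_shift del: sum.lessThan_Suc)

lemma sum_slots_cong:
  "(\<And>ys. length ys = length xs \<Longrightarrow> K ys = K' ys) \<Longrightarrow> sum_slots \<nu> K xs =
      sum_slots \<nu> K' xs"
proof (induction xs arbitrary: K K')
  case (Cons x xs)
  have "sum_slots \<nu> (\<lambda>ys. K (x # ys)) xs = sum_slots \<nu> (\<lambda>ys. K' (x # ys)) xs"
    by (rule Cons.IH) (simp add: Cons.prems)
  then show ?case by (simp add: Cons.prems)
qed simp

lemma sum_slots_additive:
  assumes "additive F"
  shows "sum_slots \<nu> (\<lambda>ys. F (K ys)) xs = F (sum_slots \<nu> K xs)"
  by (induction xs arbitrary: K) (simp_all add: additive.add[OF assms] additive.zero[OF assms])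

lemma sum_slots_add: "sum_slots \<nu> (\<lambda>ys. K ys + K' ys) xs = sum_slots \<nu> K xs + sum_slots \<nu> K' xs"
  by (induction xs arbitrary: K K') (simp_all add: algebra_simps)

lemma sum_slots_diff:
  "sum_slots \<nu> (\<lambda>ys. K ys - K' ys :: 'w::ab_group_add) xs = sum_slots \<nu> K xs - sum_slots \<nu> K' xs"
  by (induction xs arbitrary: K K') (simp_all add: algebra_simps)

lemma sum_slots_pow_eq_0:
  "(\<And>ys. length ys = length xs \<Longrightarrow> K ys = 0) \<Longrightarrow> (sum_slots \<nu> ^^ r) K xs = 0"
proof (induction r arbitrary: xs)
  case (Suc r)
  have "(sum_slots \<nu> ^^ Suc r) K xs = sum_slots \<nu> (\<lambda>ys. 0) xs"
    by (simp, rule sum_slots_cong) (use Suc in auto)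
  also have "\<dots> = 0" by (induction xs) auto
  finally show ?case .
qed simp

lemma Suc_div_fact: "of_nat (Suc r) / fact (Suc r) = (1 / fact r :: 'k::field_char_0)"
  by (simp add: field_simps del: of_nat_Suc)

locale two_spaces_map = two_spaces sA sB
  for sA :: "'k::field_char_0 \<Rightarrow> 'a::ab_group_add \<Rightarrow> 'a" and sB :: "'k \<Rightarrow>
      'b::ab_group_add \<Rightarrow> 'b" +
  fixes P :: "'b \<Rightarrow> 'a"
  assumes linear_P: "Vector_Spaces.linear sB sA P"
begin

lemma P_add: "P (x + y) = P x + P y" and P_scale: "P (sB c x) = sA c (P x)"
  using linear_P by (simp_all add: Vector_Spaces.linear_iff)

lemma P_zero [simp]: "P 0 = 0"
  using P_add[of 0 0] by simp

definition \<nu> :: "'a \<times> 'b \<Rightarrow> 'a \<times> 'b" where "\<nu> d = (P (snd d), 0)"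
definition tw :: "'a \<times> 'b \<Rightarrow> 'a \<times> 'b" where "tw d = (fst d + P (snd d), snd d)"
definition untw :: "'a \<times> 'b \<Rightarrow> 'a \<times> 'b" where "untw d = (fst d - P (snd d), snd d)"

text \<open>The conjugate \<theta>^P of the overview; \<open>untw\<close> is the inverse of
  \<open>tw\<close>.\<close>

definition twist :: "('a, 'b) op \<Rightarrow> ('a, 'b) op" where
  "twist F = (\<lambda>T xs. untw (F T (map tw xs)))"

lemma tw_untw [simp]: "tw (untw d) = d"
  by (simp add: tw_def untw_def)

lemma additive_\<nu>: "additive \<nu>" and additive_tw: "additive tw" and additive_untw: "additive untw"
  by (simp_all add: additive_def \<nu>_def tw_def untw_def P_add prod_eq_iff)

lemma \<nu>_scale: "\<nu> (sD c d) = sD c (\<nu> d)" and tw_scale: "tw (sD c d) = sD c (tw d)"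
  and untw_scale: "untw (sD c d) = sD c (untw d)"
  by (simp_all add: \<nu>_def tw_def untw_def scaleD_def P_scale A.scale_right_distrib A.scale_right_diff_distrib)

lemma \<nu>_\<nu> [simp]: "\<nu> (\<nu> d) = 0"
  by (simp add: \<nu>_def zero_prod_def)

lemma tw_eq: "tw d = d + \<nu> d" and untw_eq: "untw d = d - \<nu> d"
  by (simp_all add: \<nu>_def tw_def untw_def prod_eq_iff)

lemma additive_twist: "additive twist"
  by (auto simp: additive_def twist_def fun_eq_iff additive.add[OF additive_untw])

lemmas twist_simps [simp] = additive.add[OF additive_twist] additive.diff[OF additive_twist]
  additive.minus[OF additive_twist] additive.zero[OF additive_twist]

lemma twist_scale_op: "twist (scale_op c F) = scale_op c (twist F)"
  by (auto simp: twist_def scale_op_def fun_eq_iff untw_scale)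

text \<open>The \<open>untw\<close> behind \<open>g\<close> cancels against the \<open>tw\<close> in
  front of \<open>f\<close>.\<close>

lemma twist_circ: "twist (circ m n i f g) = circ m n i (twist f) (twist g)"
  by (auto simp: twist_def circ_def fun_eq_iff take_map drop_map additive.zero[OF additive_untw])

lemma twist_bracket: "twist (bracket m n f g) = bracket m n (twist f) (twist g)"
  by (simp add: bracket_def additive.sum[OF additive_twist] additive_pm[OF additive_twist] twist_circ)

lemma twist_in_C:
  assumes "F \<in> C n"
  shows "twist F \<in> C n"
  by (rule C_I)
    (simp_all add: twist_def C_outside[OF assms] C_add[OF assms] C_scale[OF assms] tw_scale untw_scale
      additive.zero[OF additive_untw] additive.add[OF additive_tw] additive.add[OF additive_untw])


lemma P_op_apply: "T \<in> trees 1 \<Longrightarrow> P_op P T [d] = \<nu> d"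
  by (simp add: P_op_def emb_a_def \<nu>_def)

lemma P_op_in_C: "P_op P \<in> C 1"
proof (rule C_I)
  show "P_op P T xs = 0" if "T \<notin> trees 1 \<or> length xs \<noteq> 1" for T xs
    using that by (auto simp: P_op_def emb_a_def zero_prod_def)
  have *: "P_op P T (xs @ v # ys) = (if T \<in> trees 1 \<and> xs = [] \<and> ys = [] then \<nu> v else 0)" for
      T xs v ys
    by (auto simp: P_op_def emb_a_def zero_prod_def \<nu>_def)
  show "P_op P T (xs @ (u + v) # ys) = P_op P T (xs @ u # ys) + P_op P T (xs @ v # ys)"
    and "P_op P T (xs @ sD c v # ys) = sD c (P_op P T (xs @ v # ys))" for T xs u v c ys
    unfolding * by (simp_all add: additive.add[OF additive_\<nu>] \<nu>_scale)
qed

text \<open>All signs are trivial because P has degree 0, and inserting an operation of arity 1, or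
  inserting into one, leaves the tree unchanged.\<close>

lemma bracket_P:
  assumes F: "F \<in> C n" and n: "1 \<le> n" and T: "T \<in> trees n"
  shows "bracket n 1 F (P_op P) T xs = sum_slots \<nu> (F T) xs - \<nu> (F T xs)"
proof (cases "length xs = n")
  case True
  have 1: "circ n 1 (Suc i) F (P_op P) T xs = F T (take i xs @ \<nu> (xs ! i) # drop (Suc i) xs)" if "i < n" for i
  proof -
    have "take 1 (drop i xs) = [xs ! i]" using that True
      by (simp add: take_Suc_conv_app_nth hd_drop_conv_nth take_Suc)
    moreover have "R_inner (Suc i) 1 T \<in> trees 1"
      by (rule R_inner_tree[of _ n]) (use T that in auto)
    ultimately show ?thesis
      using T True that R_outer_one[OF T, of "Suc i"] by (simp add: circ_def P_op_apply)
  qed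
  have "(\<Sum>i=1..n. circ n 1 i F (P_op P)) T xs = (\<Sum>i<n. circ n 1 (Suc i) F (P_op P) T xs)"
    by (simp add: sum.atLeast1_atMost_eq additive.sum[OF additive_fun_apply])
  also have "\<dots> = sum_slots \<nu> (F T) xs"
    unfolding sum_slots_eq True by (rule sum.cong) (simp_all add: 1[unfolded One_nat_def])
  finally have 2: "(\<Sum>i=1..n. circ n 1 i F (P_op P)) T xs = sum_slots \<nu> (F T) xs" .
  have "R_outer 1 n T \<in> trees 1" by (rule R_outer_tree) (use T n in auto)
  then have 3: "circ 1 n 1 (P_op P) F T xs = \<nu> (F T xs)"
    using T True R_inner_all[OF T] by (simp add: circ_def P_op_apply)
  show ?thesis using 2 3 by (simp add: bracket_def)
next
  case False
  have "bracket n 1 F (P_op P) \<in> C n" using bracket_in_C[OF F P_op_in_C] by simp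
  then have "bracket n 1 F (P_op P) T xs = 0" using False by (intro C_outside) auto
  moreover have "sum_slots \<nu> (F T) xs = 0"
    using sum_slots_pow_eq_0[of xs "F T" 1 \<nu>] C_outside[OF F] False by simp
  ultimately show ?thesis using C_outside[OF F] False by (simp add: additive.zero[OF additive_\<nu>])
qed

lemma iter_bracket_replicate_append:
  "iter_bracket m F (replicate r (1, g) @ hs) = iter_bracket m (iter_bracket m F (replicate r (1, g))) hs"
  by (induction r arbitrary: F) simp_all

lemma iter_bracket_P_in_C: "F \<in> C n \<Longrightarrow> iter_bracket n F (replicate r (1, P_op P)) \<in> C n"
  using bracket_in_C[OF _ P_op_in_C] by (induction r arbitrary: F) simp_all

text \<open>The bracket with P is R - L, where R = \<open>sum_slots \<nu>\<close> inserts \<nu> into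
  the slots and L applies \<nu> to the output. They commute and L^2 = 0, so (R - L)^r = R^r - r L
  R^(r-1). At r = 0 the truncated exponent r - 1 is harmless because of the factor r.\<close>

lemma iter_bracket_P:
  assumes F: "F \<in> C n" and n: "1 \<le> n" and T: "T \<in> trees n"
  shows "iter_bracket n F (replicate r (1, P_op P)) T xs
    = (sum_slots \<nu> ^^ r) (F T) xs - sD (of_nat r) (\<nu> ((sum_slots \<nu> ^^ (r - 1)) (F T) xs))"
proof (induction r arbitrary: xs)
  case (Suc r)
  let ?S = "sum_slots \<nu>" and ?G = "iter_bracket n F (replicate r (1, P_op P))"
  let ?g = "\<lambda>d. sD (of_nat r) (\<nu> d)"
  have g: "additive ?g"
    by (simp add: additive_def additive.add[OF additive_\<nu>] D.scale_right_distrib)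
  have G: "?G T = (\<lambda>ys. (?S ^^ r) (F T) ys - ?g ((?S ^^ (r - 1)) (F T) ys))"
    using Suc by blast
  have "iter_bracket n F (replicate (Suc r) (1, P_op P)) = bracket n 1 ?G (P_op P)"
    unfolding replicate_append_same[symmetric] iter_bracket_replicate_append replicate_Suc by simp
  then have "iter_bracket n F (replicate (Suc r) (1, P_op P)) T xs = ?S (?G T) xs - \<nu> (?G T xs)"
    using bracket_P[OF iter_bracket_P_in_C[OF F] n T] by simp
  also have "?S (?G T) xs = (?S ^^ Suc r) (F T) xs - ?g (?S ((?S ^^ (r - 1)) (F T)) xs)"
    unfolding G sum_slots_diff sum_slots_additive[OF g] by simp
  also have "?g (?S ((?S ^^ (r - 1)) (F T)) xs) = ?g ((?S ^^ r) (F T) xs)"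
    by (cases r) simp_all
  also have "\<nu> (?G T xs) = \<nu> ((?S ^^ r) (F T) xs)"
    unfolding G by (simp add: additive.diff[OF additive_\<nu>] \<nu>_scale)
  finally show ?case
    by (simp add: D.scale_left_distrib)
qed simp

text \<open>The same binomial argument with the first slot split off: insertion there squares to
  zero and commutes with insertion into the other slots.\<close>

lemma sum_slots_pow_Cons:
  assumes "multi_add K"
  shows "(sum_slots \<nu> ^^ r) K (d # xs) = (sum_slots \<nu> ^^ r) (\<lambda>ys. K (d # ys)) xs
    + sD (of_nat r) ((sum_slots \<nu> ^^ (r - 1)) (\<lambda>ys. K (\<nu> d # ys)) xs)"
proof (induction r arbitrary: d xs)
  case (Suc r)
  let ?S = "sum_slots \<nu>"
  have K0: "K (0 # ys) = 0" for ys
    using assms[unfolded multi_add_def, rule_format, of "[]" 0 0 ys] by simp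
  have a: "additive (sD c)" for c by (simp add: additive_def D.scale_right_distrib)
  have "(?S ^^ Suc r) K (d # xs) = (?S ^^ r) K (\<nu> d # xs) + ?S (\<lambda>ys. (?S ^^ r) K (d # ys)) xs"
    by simp
  also have "(?S ^^ r) K (\<nu> d # xs) = (?S ^^ r) (\<lambda>ys. K (\<nu> d # ys)) xs"
    unfolding Suc by (simp add: K0 sum_slots_pow_eq_0)
  also have "?S (\<lambda>ys. (?S ^^ r) K (d # ys)) xs = (?S ^^ Suc r) (\<lambda>ys. K (d # ys)) xs
    + sD (of_nat r) (?S ((?S ^^ (r - 1)) (\<lambda>ys. K (\<nu> d # ys))) xs)"
    unfolding Suc sum_slots_add sum_slots_additive[OF a] by simp
  also have "sD (of_nat r) (?S ((?S ^^ (r - 1)) (\<lambda>ys. K (\<nu> d # ys))) xs)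
      = sD (of_nat r) ((?S ^^ r) (\<lambda>ys. K (\<nu> d # ys)) xs)"
    by (cases r) simp_all
  finally show ?case by (simp add: D.scale_left_distrib algebra_simps)
qed simp

text \<open>The slots are treated one after the other. Each contributes exp N = 1 + N, where N
  inserts \<nu> into it, and \<open>tw\<close> is 1 + \<nu>. The terms beyond
  \<open>length xs\<close> vanish, so every larger bound \<open>M\<close> gives the same
  sum.\<close>

lemma sum_slots_exp:
  assumes "multi_add K" "length xs \<le> M"
  shows "(\<Sum>r\<le>M. sD (1 / fact r) ((sum_slots \<nu> ^^ r) K xs)) = K (map tw xs)"
  using assms
proof (induction xs arbitrary: K M)
  case Nil
  have "(sum_slots \<nu> ^^ r) K [] = (if r = 0 then K [] else 0)" for r
    by (cases r) simp_all
  then show ?case by (simp add: if_distrib[of "sD _"] sum.delta cong: if_cong)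
next
  case (Cons d xs)
  then obtain M' where M: "M = Suc M'" "length xs \<le> M'" by (cases M) auto
  let ?S = "sum_slots \<nu>"
  have K: "multi_add (\<lambda>ys. K (e # ys))" for e
    using Cons.prems(1) unfolding multi_add_def by (metis append_Cons)
  have "(\<Sum>r\<le>M. sD (1 / fact r) ((?S ^^ r) K (d # xs)))
    = (\<Sum>r\<le>M. sD (1 / fact r) ((?S ^^ r) (\<lambda>ys. K (d # ys)) xs))
      + (\<Sum>r\<le>M. sD (of_nat r / fact r) ((?S ^^ (r - 1)) (\<lambda>ys. K (\<nu> d # ys)) xs))"
    by (simp only: sum_slots_pow_Cons[OF Cons.prems(1)] D.scale_right_distrib sum.distrib D.scale_scale) simp
  also have "(\<Sum>r\<le>M. sD (of_nat r / fact r) ((?S ^^ (r - 1)) (\<lambda>ys. K (\<nu> d # ys)) xs))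
    = (\<Sum>r\<le>M'. sD (1 / fact r) ((?S ^^ r) (\<lambda>ys. K (\<nu> d # ys)) xs))"
    unfolding M sum.atMost_Suc_shift by (simp add: Suc_div_fact del: of_nat_Suc fact_Suc)
  also have "\<dots> = K (\<nu> d # map tw xs)"
    by (rule Cons.IH[OF K M(2)])
  also have "(\<Sum>r\<le>M. sD (1 / fact r) ((?S ^^ r) (\<lambda>ys. K (d # ys)) xs)) = K (d # map tw xs)"
    by (rule Cons.IH[OF K]) (use Cons.prems in simp)
  also have "K (d # map tw xs) + K (\<nu> d # map tw xs) = K (tw d # map tw xs)"
    using Cons.prems(1)[unfolded multi_add_def, rule_format, of "[]" d "\<nu> d" "map tw xs"] by (simp add: tw_eq)
  finally show ?case by simp
qed

text \<open>A power above the number of slots would insert \<nu> twice into some slot.\<close>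

lemma sum_slots_nilpotent:
  fixes K :: "('a \<times> 'b) list \<Rightarrow> 'a \<times> 'b"
  shows "multi_add K \<Longrightarrow> length xs < r \<Longrightarrow> (sum_slots \<nu> ^^ r) K xs = 0"
proof (induction xs arbitrary: K r)
  case Nil
  then show ?case by (cases r) simp_all
next
  case (Cons d xs)
  have K: "multi_add (\<lambda>ys. K (e # ys))" for e
    using Cons.prems(1) unfolding multi_add_def by (metis append_Cons)
  show ?case unfolding sum_slots_pow_Cons[OF Cons.prems(1)] using Cons.IH[OF K] Cons.prems by simp
qed

text \<open>Each of the \<open>n\<close> slots and the output can take \<nu> once, which allows at
  most \<open>n + 1\<close> brackets.\<close>

lemma iter_bracket_P_eq_0:
  assumes F: "F \<in> C n" and n: "1 \<le> n" and r: "n + 1 < r"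
  shows "iter_bracket n F (replicate r (1, P_op P)) = 0"
proof (rule op_eqI[of n])
  fix T and xs :: "('a \<times> 'b) list"
  assume T: "T \<in> trees n" "length xs = n"
  have "multi_add (F T)" using F unfolding C_iff by blast
  then show "iter_bracket n F (replicate r (1, P_op P)) T xs = 0 T xs"
    unfolding iter_bracket_P[OF F n T(1)] zero_fun_apply
    using T r by (simp add: sum_slots_nilpotent additive.zero[OF additive_\<nu>])
qed (use C_outside[OF iter_bracket_P_in_C[OF F]] in auto)

text \<open>With R inserting \<nu> into the slots and L applying it to the output, exp(R - L) = (1 -
  L) exp R. The first factor is \<open>untw\<close> on the value, the second is \<open>tw\<close> on
  the arguments.\<close>

lemma sum_iter_bracket_P:
  assumes F: "F \<in> C n" and n: "1 \<le> n" and M: "n + 1 \<le> M"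
  shows "(\<Sum>r\<le>M. scale_op (1 / fact r) (iter_bracket n F (replicate r (1, P_op P)))) = twist F" (is "?s = _")
proof (rule op_eqI[of n])
  fix T and xs :: "('a \<times> 'b) list"
  assume T: "T \<in> trees n" "length xs = n"
  let ?S = "sum_slots \<nu>"
  have K: "multi_add (F T)" using F unfolding C_iff by blast
  obtain M' where M': "M = Suc M'" "n \<le> M'" using M by (cases M) auto
  have "?s T xs = (\<Sum>r\<le>M. sD (1 / fact r) (iter_bracket n F (replicate r (1, P_op P)) T xs))"
    by (simp add: additive.sum[OF additive_fun_apply] scale_op_apply)
  also have "\<dots> = (\<Sum>r\<le>M. sD (1 / fact r) ((?S ^^ r) (F T) xs))
      - (\<Sum>r\<le>M. sD (of_nat r / fact r) (\<nu> ((?S ^^ (r - 1)) (F T) xs)))"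
    by (simp only: iter_bracket_P[OF F n T(1)] D.scale_right_diff_distrib sum_subtractf D.scale_scale) simp
  also have "(\<Sum>r\<le>M. sD (of_nat r / fact r) (\<nu> ((?S ^^ (r - 1)) (F T) xs)))
    = (\<Sum>r\<le>M'. sD (1 / fact r) (\<nu> ((?S ^^ r) (F T) xs)))"
    unfolding M' sum.atMost_Suc_shift by (simp add: Suc_div_fact del: of_nat_Suc fact_Suc)
  also have "\<dots> = \<nu> (\<Sum>r\<le>M'. sD (1 / fact r) ((?S ^^ r) (F T) xs))"
    by (simp add: additive.sum[OF additive_\<nu>] \<nu>_scale)
  finally show "?s T xs = twist F T xs"
    using sum_slots_exp[OF K, of xs M] sum_slots_exp[OF K, of xs M'] T M M'(2)
    by (simp only: twist_def untw_eq)
next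
  have "?s \<in> C n" by (intro sum_in_C scale_op_in_C iter_bracket_P_in_C F)
  then show "?s T xs = 0" if "T \<notin> trees n \<or> length xs \<noteq> n" for T xs
    using that by (rule C_outside)
qed (use C_outside[OF twist_in_C[OF F]] in auto)

end

section \<open>The element $\pi_\lambda$ and the twisted differential\<close>

lemma trees_0: "T \<in> trees 0 \<Longrightarrow> T = Leaf"
  using sum_list_leaves_ge by (cases T) (fastforce simp: trees_def)+

lemma trees_1: "T \<in> trees 1 \<Longrightarrow> T = Node [Leaf, Leaf]"
proof -
  assume "T \<in> trees 1"
  then obtain ts where ts: "T = Node ts" "2 \<le> length ts" "\<forall>t\<in>set ts. reduced t" "forest_leaves
      ts = 1 + 1"
    by (rule trees_pos_Node) simp
  then have "length ts = 2" using sum_list_leaves_ge[of ts] by simp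
  then obtain t u where tu: "ts = [t, u]" by (auto simp: numeral_2_eq_2 length_Suc_conv)
  have "leaves t = 1" "leaves u = 1" using ts(3,4) leaves_pos[of t] leaves_pos[of u] by (auto simp: tu)
  then have "t = Leaf" "u = Leaf" using ts(3) trees_0 by (auto simp: tu trees_def)
  then show ?thesis by (simp add: ts tu)
qed

lemma trees_2_cases:
  assumes "T \<in> trees 2"
  obtains "T = Node [Leaf, Node [Leaf, Leaf]]" | "T = Node [Node [Leaf, Leaf], Leaf]"
    | "T = Node [Leaf, Leaf, Leaf]"
proof -
  obtain ts where ts: "T = Node ts" "2 \<le> length ts" "\<forall>t\<in>set ts. reduced t" "forest_leaves ts = 2 + 1"
    using assms by (rule trees_pos_Node) simp
  have one: "t = Leaf" if "reduced t" "leaves t = 1" for t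
    using trees_0[of t] that by (simp add: trees_def)
  have two: "t = Node [Leaf, Leaf]" if "reduced t" "leaves t = 2" for t
    using trees_1[of t] that by (simp add: trees_def)
  have "length ts = 2 \<or> length ts = 3" using sum_list_leaves_ge[of ts] ts by auto
  then show ?thesis
  proof
    assume "length ts = 2"
    then obtain t u where tu: "ts = [t, u]" by (auto simp: numeral_2_eq_2 length_Suc_conv)
    have *: "reduced t" "reduced u" "1 \<le> leaves t" "1 \<le> leaves u" "leaves t + leaves u = 3"
      using ts(3,4) leaves_pos by (auto simp: tu)
    then consider "leaves t = 1" "leaves u = 2" | "leaves t = 2" "leaves u = 1" by fastforce
    then show ?thesis using one two * that(1,2) ts(1) tu by cases auto
  next
    assume "length ts = 3"
    then obtain t u v where tuv: "ts = [t, u, v]" by (auto simp: numeral_3_eq_3 length_Suc_conv)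
    have *: "reduced t" "reduced u" "reduced v" "1 \<le> leaves t" "1 \<le> leaves u" "1 \<le> leaves v"
      "leaves t + leaves u + leaves v = 3"
      using ts(3,4) leaves_pos by (auto simp: tuv)
    then have "leaves t = 1" "leaves u = 1" "leaves v = 1" by linarith+
    then show ?thesis using one * that(3) ts(1) tuv by simp
  qed
qed

lemma root_gaps_trees_2:
  "root_gaps (Node [Leaf, Node [Leaf, Leaf]]) = {1}"
  "root_gaps (Node [Node [Leaf, Leaf], Leaf]) = {2}"
  "root_gaps (Node [Leaf, Leaf, Leaf]) = {1, 2}"
  by (subst root_gaps_Node; auto simp: forest_gaps_Cons)+

locale rel_averaging_char_0 = rel_averaging_algebra scaleA scaleB lact ract P lam
  for scaleA :: "'k::field_char_0 \<Rightarrow> 'a::ring \<Rightarrow> 'a"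
    and scaleB :: "'k \<Rightarrow> 'b::ring \<Rightarrow> 'b"
    and lact :: "'a \<Rightarrow> 'b \<Rightarrow> 'b" and ract :: "'b \<Rightarrow> 'a \<Rightarrow> 'b" and P
        :: "'b \<Rightarrow> 'a" and lam :: 'k
begin

sublocale two_spaces_map scaleA scaleB P
  by unfold_locales (use P_linear in \<open>auto simp: Vector_Spaces.linear_iff\<close>)

abbreviation \<pi> :: "('a, 'b) op" where "\<pi> \<equiv> pi_lam scaleB lact ract lam"

definition \<mu> :: "('a, 'b) op" where "\<mu> = twist \<pi>"

lemma act_simps:
  "lact (a + b) x = lact a x + lact b x" "lact a (x + y) = lact a x + lact a y"
  "ract x (a + b) = ract x a + ract x b" "ract (x + y) a = ract x a + ract y a"
  "lact (scaleA c a) x = scaleB c (lact a x)" "lact a (scaleB c x) = scaleB c (lact a x)"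
  "ract x (scaleA c a) = scaleB c (ract x a)" "ract (scaleB c x) a = scaleB c (ract x a)"
  using lact_linear_left lact_linear_right ract_linear_left ract_linear_right
  by (auto simp: Vector_Spaces.linear_iff)

text \<open>The gaps determine a tree in T_2. In this form \<pi> can be evaluated on outer and inner
  trees, of which only the gaps are computed.\<close>

lemma \<pi>_apply:
  assumes "T \<in> trees 2"
  shows "\<pi> T [d, e] = (fst d * fst e,
    if root_gaps T = {1} then ract (snd d) (fst e) else if root_gaps T = {2} then lact (fst d) (snd e)
    else scaleB lam (snd d * snd e))"
  using assms
  by (cases rule: trees_2_cases)
    (simp_all add: root_gaps_trees_2 pi_lam_def doubleton_eq_iff split: prod.split del: root_gaps.simps)

lemma \<pi>_outside: "T \<notin> trees 2 \<or> length xs \<noteq> 2 \<Longrightarrow> \<pi> T xs = 0"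
proof (cases "length xs = 2")
  case True
  then obtain d e where "xs = [d, e]" by (auto simp: numeral_2_eq_2 length_Suc_conv)
  moreover assume "T \<notin> trees 2 \<or> length xs \<noteq> 2"
  ultimately show ?thesis by (auto simp: pi_lam_def trees_def split: prod.split)
next
  case False
  then show ?thesis by (auto simp: pi_lam_def split: list.split)
qed

lemma \<pi>_in_C: "\<pi> \<in> C 2"
proof (rule C_I)
  have 1: "\<pi> T ([] @ (u + v) # [e]) = \<pi> T ([] @ u # [e]) + \<pi> T ([] @ v # [e])
      \<and> \<pi> T ([] @ sD c v # [e]) = sD c (\<pi> T ([] @ v # [e]))
      \<and> \<pi> T ([e] @ (u + v) # []) = \<pi> T ([e] @ u # []) + \<pi> T ([e] @ v # [])
      \<and> \<pi> T ([e] @ sD c v # []) = sD c (\<pi> T ([e] @ v # []))" for T e u v c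
  proof (cases "T \<in> trees 2")
    case True
    then show ?thesis
      by (simp add: \<pi>_apply act_simps scaleD_def algebra_simps A.scale_mult_left[symmetric]
          A.scale_mult_right[symmetric]
        B.scale_mult_left[symmetric] B.scale_mult_right[symmetric] B.scale_right_distrib mult.commute)
  next
    case False
    then show ?thesis by (simp add: \<pi>_outside)
  qed
  have 2: "(\<exists>e. xs = [] \<and> ys = [e]) \<or> (\<exists>e. xs = [e] \<and> ys = []) \<or> length (xs @
      v # ys) \<noteq> 2"
    for xs ys :: "('a \<times> 'b) list" and v
    by (cases xs; cases ys) (auto simp: length_Suc_conv)
  show "\<pi> T (xs @ (u + v) # ys) = \<pi> T (xs @ u # ys) + \<pi> T (xs @ v # ys)" for T xs ys u v
    using 2[of xs ys 0] 1[of T u v] by (auto simp: \<pi>_outside)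
  show "\<pi> T (xs @ sD c v # ys) = sD c (\<pi> T (xs @ v # ys))" for T xs ys c v
    using 2[of xs ys 0] 1[of T _ v] by (auto simp: \<pi>_outside)
qed (rule \<pi>_outside)

text \<open>Only the gaps of \<open>T\<close> matter, a nonempty subset of {1, 2, 3}, and the seven
  cases are the associativity and bimodule axioms. Where the gaps of an inner tree are unknown, the
  outer operation reads only the product in A.\<close>

lemma \<pi>_assoc: "circ 2 2 1 \<pi> \<pi> = circ 2 2 2 \<pi> \<pi>"
proof (rule op_eqI[of 3])
  fix T and xs :: "('a \<times> 'b) list"
  assume T: "T \<in> trees 3" and "length xs = 3"
  then obtain d1 d2 d3 where xs: "xs = [d1, d2, d3]" by (auto simp: numeral_3_eq_3 length_Suc_conv)
  have T': "T \<in> trees (2 + 2 - 1)" using T by simp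
  note trees = R_outer_tree[OF T', of 1] R_outer_tree[OF T', of 2] R_inner_tree[OF T', of 1] R_inner_tree[OF T', of 2]
  have G: "root_gaps T \<subseteq> {1, 2, 3}" "root_gaps T \<noteq> {}" using root_gaps_bounds[OF T] by auto
  have g: "root_gaps (R_outer 1 2 T) = (\<lambda>s. if s \<le> 2 then 1 else 2) ` root_gaps T"
    "root_gaps (R_outer 2 2 T) = (\<lambda>s. if s \<le> 1 then 1 else 2) ` root_gaps T"
    by (subst root_gaps_R_outer[OF T']; (simp; fail | rule image_cong[OF refl], use G in force))+
  have i1: "root_gaps (R_inner 1 2 T) = root_gaps T \<inter> {1, 2}" if "root_gaps T \<inter> {1, 2} \<noteq> {}"
  proof -
    have "{1..1 + 2 - 1} = {1, 2::nat}" by auto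
    then show ?thesis using root_gaps_R_inner[OF T', of 1] that by (simp only:) simp
  qed
  have i2: "root_gaps (R_inner 2 2 T) = (\<lambda>s. s - 1) ` (root_gaps T \<inter> {2, 3})" if "root_gaps T
      \<inter> {2, 3} \<noteq> {}"
  proof -
    have "{2..2 + 2 - 1} = {2, 3::nat}" by auto
    then show ?thesis using root_gaps_R_inner[OF T', of 2] that by (simp only:) simp
  qed
  have c: "circ 2 2 1 \<pi> \<pi> T xs = \<pi> (R_outer 1 2 T) [\<pi> (R_inner 1 2 T) [d1, d2], d3]"
    "circ 2 2 2 \<pi> \<pi> T xs = \<pi> (R_outer 2 2 T) [d1, \<pi> (R_inner 2 2 T) [d2, d3]]"
    using T by (simp_all add: circ_def xs)
  have "root_gaps T \<in> Pow {1, 2, 3}" using G by blast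
  then consider "root_gaps T = {1}" | "root_gaps T = {2}" | "root_gaps T = {3}" | "root_gaps T = {1, 2}"
    | "root_gaps T = {1, 3}" | "root_gaps T = {2, 3}" | "root_gaps T = {1, 2, 3}"
    using G(2) by (auto simp: Pow_insert)
  then show "circ 2 2 1 \<pi> \<pi> T xs = circ 2 2 2 \<pi> \<pi> T xs"
    unfolding c
    by cases (simp_all add: trees \<pi>_apply g i1 i2 mult.assoc doubleton_eq_iff lact_mult lact_ract ract_mult
        mult_ract
        ract_mult_lact lact_mult_assoc act_simps B.scale_mult_left[symmetric] B.scale_mult_right[symmetric]
        del: One_nat_def)
qed (simp_all add: circ_outside)

lemma \<mu>_in_C: "\<mu> \<in> C 2"
  unfolding \<mu>_def by (rule twist_in_C[OF \<pi>_in_C])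

lemma \<mu>_assoc: "circ 2 2 1 \<mu> \<mu> = circ 2 2 2 \<mu> \<mu>"
  unfolding \<mu>_def twist_circ[symmetric] \<pi>_assoc ..

lemma proj_\<mu>: "proj \<mu> = 0"
proof (rule op_eqI[of 2])
  fix T and xs :: "('a \<times> 'b) list"
  assume T: "T \<in> trees 2" and "length xs = 2"
  then obtain d e where xs: "xs = [d, e]" by (auto simp: numeral_2_eq_2 length_Suc_conv)
  \<comment> \<open>On (0,x), (0,y) the A-value of \<mu> is P x P y - P z, where z is the B-value of
    \<pi> on (P x, x), (P y, y). The three trees give the three averaging identities.\<close>
  show "proj \<mu> T xs = 0 T xs"
    using P_lact[of "snd d" "snd e"] P_ract[of "snd d" "snd e"] P_weight[of "snd d" "snd e"]
    by (simp add: xs proj_def \<mu>_def twist_def tw_def untw_def \<pi>_apply[OF T] P_scale zero_prod_def)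
qed (use C_outside[OF proj_in_C[OF \<mu>_in_C]] in auto)

lemma sum_const_scale_op: "(\<Sum>i<r. F) = scale_op (of_nat r) F"
  by (induction r) (auto simp: scale_op_def fun_eq_iff D.scale_left_distrib)

lemma scale_pair_eq: "scale_pair scaleA scaleB c w = (scale_op c (fst w), scale_op c (snd w))"
  by (simp add: scale_pair_def scale_op_def)

text \<open>Any of the \<open>Suc r\<close> copies of \<alpha> may contribute its \<pi>; these terms
  coincide, since \<alpha> has degree 0 and causes no Koszul sign. In the last term the final input
  contributes \<theta>. The minus sign of the first component is (-1)^|\<pi>|.\<close>

lemma Linf_replicate:
  assumes n: "1 \<le> n"
  shows "Linf (replicate (Suc r) (0, \<pi>, P_op P) @ [(int n - 2, \<theta>, \<gamma>)]) =
    (if r = 0 then - bracket 2 n \<pi> \<theta> else 0,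
     scale_op (of_nat (Suc r)) (proj (bracket 2 (n - 1) (iter_bracket 2 \<pi> (replicate r (1, P_op P))) \<gamma>))
     + proj (iter_bracket n \<theta> (replicate (Suc r) (1, P_op P))))"
proof -
  let ?\<alpha> = "(0, \<pi>, P_op P) :: ('a, 'b) homog" and ?z = "(int n - 2, \<theta>, \<gamma>) :: ('a, 'b) homog"
  let ?zs = "replicate (Suc r) ?\<alpha> @ [?z]"
  have nat: "nat (int n - 2 + 2) = n" "nat (int n - 2 + 1) = n - 1" "nat (int n - 1) = n - 1" by linarith+
  have i: "?zs ! i = ?\<alpha>" "take i ?zs @ drop (Suc i) ?zs = replicate r ?\<alpha> @ [?z]" if "i < Suc r" for i
  proof -
    show "?zs ! i = ?\<alpha>" using that by (simp add: nth_append del: replicate_Suc)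
    have "take i ?zs @ drop (Suc i) ?zs = replicate i ?\<alpha> @ replicate (r - i) ?\<alpha> @ [?z]"
      using that by (simp add: min_def del: replicate_Suc)
    then show "take i ?zs @ drop (Suc i) ?zs = replicate r ?\<alpha> @ [?z]"
      using that by (simp flip: replicate_add append_assoc)
  qed
  have l: "?zs ! Suc r = ?z" "take (Suc r) ?zs @ drop (Suc (Suc r)) ?zs = replicate (Suc r) ?\<alpha>"
    by (simp_all add: nth_append del: replicate_Suc)
  have s0: "(\<Sum>z\<leftarrow>take (Suc r) ?zs. deg z) = 0"
    by (simp add: deg_def sum_list_replicate del: replicate_Suc)
  let ?t = "\<lambda>i. pm (deg (?zs ! i) * (\<Sum>z\<leftarrow>take i ?zs. deg z))
                (proj (iter_bracket (nat (deg (?zs ! i) + 2)) (hcomp (?zs ! i))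
                   (map (\<lambda>z. (nat (deg z + 1), acomp z)) (take i ?zs @ drop (Suc i) ?zs))))"
  have t1: "?t i = proj (bracket 2 (n - 1) (iter_bracket 2 \<pi> (replicate r (1, P_op P))) \<gamma>)" if "i <
      Suc r" for i
    unfolding i[OF that]
    by (simp add: deg_def hcomp_def acomp_def nat iter_bracket_replicate_append[simplified] del: replicate_Suc)
  have t2: "?t (Suc r) = proj (iter_bracket n \<theta> (replicate (Suc r) (1, P_op P)))"
    unfolding l s0 by (simp add: deg_def hcomp_def acomp_def nat del: replicate_Suc)
  have "(\<Sum>i<length ?zs. ?t i) = (\<Sum>i<Suc r. ?t i) + ?t (Suc r)"
    by (simp del: replicate_Suc)
  also have "(\<Sum>i<Suc r. ?t i) = (\<Sum>i<Suc r. proj (bracket 2 (n - 1) (iter_bracket 2 \<pi> (replicate r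
      (1, P_op P))) \<gamma>))"
    by (rule sum.cong) (use t1 in auto)
  finally have snd: "(\<Sum>i<length ?zs. ?t i) = scale_op (of_nat (Suc r)) (proj (bracket 2 (n - 1)
      (iter_bracket 2 \<pi> (replicate r (1, P_op P))) \<gamma>))
     + proj (iter_bracket n \<theta> (replicate (Suc r) (1, P_op P)))"
    unfolding t2 sum_const_scale_op .
  have fst: "(if length ?zs = 2
      then pm (deg (?zs ! 0) + 1)
             (bracket (nat (deg (?zs ! 0) + 2)) (nat (deg (?zs ! 1) + 2)) (hcomp (?zs ! 0)) (hcomp (?zs ! 1)))
      else 0) = (if r = 0 then - bracket 2 n \<pi> \<theta> else 0)"
    by (simp add: deg_def hcomp_def nat pm_odd)
  have len: "2 \<le> length ?zs" by simp
  show ?thesis unfolding Linf_def fst if_P[OF len] snd ..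
qed

lemma l1_twisted_eq:
  assumes n: "1 \<le> n" and \<theta>: "\<theta> \<in> C n" "proj \<theta> = 0" and \<gamma>: "\<gamma> \<in> C (n - 1)"
  shows "l1_twisted scaleA scaleB (0, \<pi>, P_op P) (int n - 2, \<theta>, \<gamma>) =
    (- bracket 2 n \<pi> \<theta>, proj (twist \<theta>) + proj (bracket 2 (n - 1) \<mu> \<gamma>))"
proof -
  let ?f = "\<lambda>r. scale_pair scaleA scaleB (1 / fact r) (Linf (replicate r (0, \<pi>, P_op P) @ [(int n -
      2, \<theta>, \<gamma>)]))"
  let ?I = "\<lambda>m F r. iter_bracket m F (replicate r (1, P_op P))"
  have Suc: "?f (Suc r) = (if r = 0 then - bracket 2 n \<pi> \<theta> else 0,
     scale_op (1 / fact r) (proj (bracket 2 (n - 1) (?I 2 \<pi> r) \<gamma>)) + scale_op (1 / fact (Suc r))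
         (proj (?I n \<theta> (Suc r))))" for r
  proof -
    have "of_nat (Suc r) / fact (Suc r) = (1 / fact r :: 'k)" by (rule Suc_div_fact)
    then show ?thesis
      unfolding Linf_replicate[OF n] scale_pair_eq by (auto simp del: of_nat_Suc fact_Suc replicate_Suc)
  qed
  have 0: "?f 0 = 0" by (simp add: Linf_def scale_pair_eq zero_prod_def)
  \<comment> \<open>At most three brackets with P can be applied to \<pi> and at most n + 1 to
    \<theta>; the bound n + 4 covers both series.\<close>
  have large: "?f r = 0" if big: "n + 4 < r" for r
  proof -
    obtain s where s: "r = Suc s" "n + 4 \<le> s" using big by (cases r) auto
    then show ?thesis
      unfolding s(1) Suc using iter_bracket_P_eq_0[OF \<theta>(1) n, of "Suc s"] iter_bracket_P_eq_0[OF
          \<pi>_in_C, of s]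
        additive.zero[OF additive_bracket_left[OF \<gamma>]]
      by (simp add: zero_prod_def del: replicate_Suc)
  qed
  have "l1_twisted scaleA scaleB (0, \<pi>, P_op P) (int n - 2, \<theta>, \<gamma>) = sum ?f {..Suc (n + 3)}"
    unfolding l1_twisted_def
  proof (rule Sum_any.expand_superset)
    show "{r. ?f r \<noteq> 0} \<subseteq> {..Suc (n + 3)}"
    proof
      fix r assume "r \<in> {r. ?f r \<noteq> 0}"
      then have "\<not> n + 4 < r" using large[of r] by blast
      then show "r \<in> {..Suc (n + 3)}" by simp
    qed
  qed simp
  also have "\<dots> = (\<Sum>r\<le>n + 3. ?f (Suc r))"
    unfolding sum.atMost_Suc_shift 0 by simp
  finally have eq: "l1_twisted scaleA scaleB (0, \<pi>, P_op P) (int n - 2, \<theta>, \<gamma>) =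
      (\<Sum>r\<le>n + 3. ?f (Suc r))" .
  have "fst (\<Sum>r\<le>n + 3. ?f (Suc r)) = - bracket 2 n \<pi> \<theta>"
    unfolding fst_sum Suc by (simp add: sum.delta)
  moreover have "snd (\<Sum>r\<le>n + 3. ?f (Suc r)) = proj (twist \<theta>) + proj (bracket 2 (n - 1) \<mu> \<gamma>)"
  proof -
    \<comment> \<open>The term r = 0 missing on the left is p \<theta>, which is zero by
      assumption.\<close>
    have "(\<Sum>r\<le>n + 3. scale_op (1 / fact (Suc r)) (proj (?I n \<theta> (Suc r))))
      = (\<Sum>r\<le>Suc (n + 3). scale_op (1 / fact r) (proj (?I n \<theta> r)))"
      unfolding sum.atMost_Suc_shift using \<theta>(2) by simp
    also have "\<dots> = proj (\<Sum>r\<le>Suc (n + 3). scale_op (1 / fact r) (?I n \<theta> r))"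
      unfolding additive.sum[OF additive_proj] proj_scale_op ..
    also have "\<dots> = proj (twist \<theta>)" by (subst sum_iter_bracket_P[OF \<theta>(1) n]) simp_all
    finally have 1: "(\<Sum>r\<le>n + 3. scale_op (1 / fact (Suc r)) (proj (?I n \<theta> (Suc r)))) = proj
        (twist \<theta>)" .
    have "(\<Sum>r\<le>n + 3. scale_op (1 / fact r) (proj (bracket 2 (n - 1) (?I 2 \<pi> r) \<gamma>)))
      = proj (bracket 2 (n - 1) (\<Sum>r\<le>n + 3. scale_op (1 / fact r) (?I 2 \<pi> r)) \<gamma>)"
      unfolding additive.sum[OF additive_bracket_left[OF \<gamma>]] additive.sum[OF additive_proj]
        bracket_scale_left[OF \<gamma>] proj_scale_op ..
    also have "\<dots> = proj (bracket 2 (n - 1) \<mu> \<gamma>)"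
      unfolding \<mu>_def by (subst sum_iter_bracket_P[OF \<pi>_in_C]) (use n in simp_all)
    finally have 2: "(\<Sum>r\<le>n + 3. scale_op (1 / fact r) (proj (bracket 2 (n - 1) (?I 2 \<pi> r) \<gamma>)))
      = proj (bracket 2 (n - 1) \<mu> \<gamma>)" .
    show ?thesis unfolding snd_sum Suc snd_conv sum.distrib 1 2 by (simp add: add.commute)
  qed
  ultimately show ?thesis unfolding eq by (simp only: prod_eq_iff fst_conv snd_conv)
qed

end

section \<open>The image of the cochains\<close>

text \<open>Lists that give the same word (c_1,...,c_n) for the gap set \<open>S\<close>; entries
  are numbered from 0 in lists and from 1 in \<open>S\<close>.\<close>

definition agree_on :: "nat set \<Rightarrow> ('a \<times> 'b) list \<Rightarrow> ('a \<times> 'b) list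
    \<Rightarrow> bool" where
  "agree_on S ds ds' \<longleftrightarrow> length ds = length ds' \<and>
    (\<forall>j<length ds. if Suc j \<in> S then snd (ds ! j) = snd (ds' ! j) else fst (ds ! j) = fst (ds' ! j))"

text \<open>The property by which the overview characterizes the maps \<pi>_{f,g,h}. In the first
  clause \<open>T\<close> and \<open>T'\<close> are unrelated, so the A-part is independent of the
  tree as well.\<close>

definition gap_determined :: "nat \<Rightarrow> ('a::zero, 'b::zero) op \<Rightarrow> bool" where
  "gap_determined n F \<longleftrightarrow>
    (\<forall>T\<in>trees n. \<forall>T'\<in>trees n. \<forall>ds ds'. length ds = n \<longrightarrow>
      (map fst ds = map fst ds' \<longrightarrow> fst (F T ds) = fst (F T' ds')) \<and>
      (root_gaps T = root_gaps T' \<and> agree_on (root_gaps T) ds ds' \<longrightarrow> snd (F T ds) = snd (F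
          T' ds')))"

lemma gap_determined_fst:
  "gap_determined n F \<Longrightarrow> T \<in> trees n \<Longrightarrow> T' \<in> trees n \<Longrightarrow>
      length ds = n \<Longrightarrow> map fst ds = map fst ds'
    \<Longrightarrow> fst (F T ds) = fst (F T' ds')"
  unfolding gap_determined_def by blast

lemma gap_determined_snd:
  "gap_determined n F \<Longrightarrow> T \<in> trees n \<Longrightarrow> T' \<in> trees n \<Longrightarrow>
      length ds = n \<Longrightarrow> root_gaps T = root_gaps T'
    \<Longrightarrow> agree_on (root_gaps T) ds ds' \<Longrightarrow> snd (F T ds) = snd (F T' ds')"
  unfolding gap_determined_def by blast

lemma gap_determinedI:
  assumes "\<And>T T' ds ds'. T \<in> trees n \<Longrightarrow> T' \<in> trees n \<Longrightarrow> length ds =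
      n \<Longrightarrow> length ds' = n \<Longrightarrow>
      map fst ds = map fst ds' \<Longrightarrow> fst (F T ds) = fst (F T' ds')"
    and "\<And>T T' ds ds'. T \<in> trees n \<Longrightarrow> T' \<in> trees n \<Longrightarrow> length ds = n
        \<Longrightarrow> length ds' = n \<Longrightarrow>
      root_gaps T = root_gaps T' \<Longrightarrow> agree_on (root_gaps T) ds ds' \<Longrightarrow> snd (F T ds)
          = snd (F T' ds')"
  shows "gap_determined n F"
  unfolding gap_determined_def
proof (intro ballI allI impI conjI)
  fix T T' and ds ds' :: "('a \<times> 'b) list"
  assume T: "T \<in> trees n" "T' \<in> trees n" "length ds = n"
  show "fst (F T ds) = fst (F T' ds')" if "map fst ds = map fst ds'"
    using assms(1)[OF T _ that] T map_eq_imp_length_eq[OF that] by simp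
  show "snd (F T ds) = snd (F T' ds')" if "root_gaps T = root_gaps T' \<and> agree_on (root_gaps T) ds ds'"
    using assms(2)[OF T, of ds'] T that by (simp add: agree_on_def)
qed

lemma gap_determined_zero: "gap_determined n 0"
  by (simp add: gap_determined_def)

lemma gap_determined_add:
  fixes F G :: "('a::ab_group_add, 'b::ab_group_add) op"
  assumes F: "gap_determined n F" and G: "gap_determined n G"
  shows "gap_determined n (F + G)"
proof (rule gap_determinedI)
  fix T T' and ds ds' :: "('a \<times> 'b) list"
  assume T: "T \<in> trees n" "T' \<in> trees n" "length ds = n"
  show "fst ((F + G) T ds) = fst ((F + G) T' ds')" if "map fst ds = map fst ds'"
    using gap_determined_fst[OF F T that] gap_determined_fst[OF G T that] by simp
  show "snd ((F + G) T ds) = snd ((F + G) T' ds')" if "root_gaps T = root_gaps T'" "agree_on (root_gaps T) ds ds'"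
    using gap_determined_snd[OF F T that] gap_determined_snd[OF G T that] by simp
qed

lemma gap_determined_uminus:
  fixes F :: "('a::ab_group_add, 'b::ab_group_add) op"
  assumes F: "gap_determined n F"
  shows "gap_determined n (- F)"
proof (rule gap_determinedI)
  fix T T' and ds ds' :: "('a \<times> 'b) list"
  assume T: "T \<in> trees n" "T' \<in> trees n" "length ds = n"
  show "fst ((- F) T ds) = fst ((- F) T' ds')" if "map fst ds = map fst ds'"
    using gap_determined_fst[OF F T that] by simp
  show "snd ((- F) T ds) = snd ((- F) T' ds')" if "root_gaps T = root_gaps T'" "agree_on (root_gaps T) ds ds'"
    using gap_determined_snd[OF F T that] by simp
qed

lemma gap_determined_diff:
  "gap_determined n F \<Longrightarrow> gap_determined n G \<Longrightarrow> gap_determined n (F - G ::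
      ('a::ab_group_add, 'b::ab_group_add) op)"
  using gap_determined_add[of n F "- G"] gap_determined_uminus[of n G] by simp

lemma gap_determined_pm:
  "gap_determined n F \<Longrightarrow> gap_determined n (pm e F :: ('a::ab_group_add, 'b::ab_group_add) op)"
  by (simp add: pm_def gap_determined_uminus)

lemma gap_determined_sum:
  fixes F :: "'i \<Rightarrow> ('a::ab_group_add, 'b::ab_group_add) op"
  shows "(\<And>i. i \<in> I \<Longrightarrow> gap_determined n (F i)) \<Longrightarrow> gap_determined n (sum F I)"
  by (induction I rule: infinite_finite_induct) (auto intro: gap_determined_add gap_determined_zero)

lemma in_root_gaps_R_outer:
  assumes T: "T \<in> trees (m + n - 1)" and "1 \<le> i" "i \<le> m" "1 \<le> n"
  shows "j \<in> root_gaps (R_outer i n T) \<longleftrightarrow>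
    (if j < i then j \<in> root_gaps T else if j = i then root_gaps T \<inter> {i..i + n - 1} \<noteq> {}
     else j + n - 1 \<in> root_gaps T)"
proof -
  obtain n' where n: "n = Suc n'" using assms by (cases n) auto
  show ?thesis
    unfolding root_gaps_R_outer[OF assms] unfolding n
    by (auto simp: image_iff split: if_splits intro: bexI[of _ j] bexI[of _ "j + n'"])
qed

lemma in_root_gaps_R_inner:
  assumes T: "T \<in> trees (m + n - 1)" and "1 \<le> i" "i \<le> m" "1 \<le> n"
    and "root_gaps T \<inter> {i..i + n - 1} \<noteq> {}" and "1 \<le> k" "k \<le> n"
  shows "k \<in> root_gaps (R_inner i n T) \<longleftrightarrow> i + k - 1 \<in> root_gaps T"
  unfolding root_gaps_R_inner[OF assms(1-5)] using assms(2,6,7)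
  by (auto simp: image_iff intro!: bexI[of _ "i + k - 1"])

lemma nth_outer_list:
  assumes "length ds = m + n - 1" "1 \<le> i" "i \<le> m" "j < m" "1 \<le> n"
  shows "(take (i - 1) ds @ [x] @ drop (i - 1 + n) ds) ! j
    = (if Suc j < i then ds ! j else if Suc j = i then x else ds ! (j + n - 1))"
proof -
  have "i - 1 + n + (j - i) = j + n - 1" if "i \<le> j" using that assms by simp
  then show ?thesis using assms by (auto simp: nth_append not_less min_def nth_Cons')
qed

text \<open>The outer tree has a gap at \<open>i\<close> iff \<open>T\<close> has one from
  \<open>i\<close> to \<open>i + n - 1\<close>. In this case \<open>f\<close> reads the B-value of
  \<open>g\<close>, and the gaps of the inner tree come from \<open>T\<close>; otherwise
  \<open>f\<close> reads the A-value, which is the same for all inner trees.\<close>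

lemma gap_determined_circ:
  fixes f g :: "('a::ab_group_add, 'b::ab_group_add) op"
  assumes f: "gap_determined m f" and g: "gap_determined n g" and i: "1 \<le> i" "i \<le> m" and n: "1 \<le> n"
  shows "gap_determined (m + n - 1) (circ m n i f g)"
proof (rule gap_determinedI)
  fix T T' and ds ds' :: "('a \<times> 'b) list"
  assume T: "T \<in> trees (m + n - 1)" "T' \<in> trees (m + n - 1)"
    and l: "length ds = m + n - 1" "length ds' = m + n - 1"
  note o = R_outer_tree[OF T(1) i n] R_outer_tree[OF T(2) i n]
  note inn = R_inner_tree[OF T(1) i n] R_inner_tree[OF T(2) i n]
  let ?b = "take n (drop (i - 1) ds)" and ?b' = "take n (drop (i - 1) ds')"
  let ?x = "g (R_inner i n T) ?b" and ?x' = "g (R_inner i n T') ?b'"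
  let ?o = "take (i - 1) ds @ [?x] @ drop (i - 1 + n) ds" and ?o' = "take (i - 1) ds' @ [?x'] @ drop (i - 1 + n) ds'"
  have lb: "length ?b = n" "length ?b' = n" and lo: "length ?o = m" "length ?o' = m" using l i n by auto
  have c: "circ m n i f g T ds = f (R_outer i n T) ?o" "circ m n i f g T' ds' = f (R_outer i n T') ?o'"
    using T l by (simp_all add: circ_def)
  show "fst (circ m n i f g T ds) = fst (circ m n i f g T' ds')" if eq: "map fst ds = map fst ds'"
  proof -
    have e: "map fst (take k ds) = map fst (take k ds')" "map fst (drop k ds) = map fst (drop k ds')" for k
      using eq by (simp_all flip: take_map drop_map)
    have "map fst ?b = map fst ?b'"
      using eq by (simp flip: take_map drop_map)
    then have "fst ?x = fst ?x'" by (rule gap_determined_fst[OF g inn lb(1)])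
    then have "map fst ?o = map fst ?o'" using e by simp
    then show ?thesis unfolding c by (rule gap_determined_fst[OF f o lo(1)])
  qed
  show "snd (circ m n i f g T ds) = snd (circ m n i f g T' ds')"
    if gaps: "root_gaps T = root_gaps T'" and ag: "agree_on (root_gaps T) ds ds'"
  proof -
    have og: "root_gaps (R_outer i n T) = root_gaps (R_outer i n T')"
      by (rule set_eqI) (simp only: in_root_gaps_R_outer[OF T(1) i n] in_root_gaps_R_outer[OF T(2) i n] gaps)
    have ag': "if Suc j \<in> root_gaps T then snd (ds ! j) = snd (ds' ! j) else fst (ds ! j) = fst (ds' ! j)"
      if "j < m + n - 1" for j
      using ag that l by (simp add: agree_on_def)
    have b: "?b ! k = ds ! (i - 1 + k)" "?b' ! k = ds' ! (i - 1 + k)" if "k < n" for k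
      using that l i by simp_all
    have x: "if i \<in> root_gaps (R_outer i n T) then snd ?x = snd ?x' else fst ?x = fst ?x'"
    proof (cases "root_gaps T \<inter> {i..i + n - 1} = {}")
      case True
      have "fst (?b ! k) = fst (?b' ! k)" if "k < n" for k
      proof -
        have "Suc (i - 1 + k) \<in> {i..i + n - 1}" using that i by auto
        then have "Suc (i - 1 + k) \<notin> root_gaps T" using True by blast
        then show ?thesis using ag'[of "i - 1 + k"] b[OF that] that i by auto
      qed
      then have "map fst ?b = map fst ?b'" using lb by (intro nth_equalityI) auto
      then have "fst ?x = fst ?x'" by (rule gap_determined_fst[OF g inn lb(1)])
      then show ?thesis using True in_root_gaps_R_outer[OF T(1) i n, of i] by simp
    next
      case False
      have False': "root_gaps T' \<inter> {i..i + n - 1} \<noteq> {}" using False gaps by simp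
      have k: "k \<in> root_gaps (R_inner i n T) \<longleftrightarrow> k \<in> root_gaps (R_inner i n T')"
        if "1 \<le> k" "k \<le> n" for k
        by (simp only: in_root_gaps_R_inner[OF T(1) i n False that] in_root_gaps_R_inner[OF T(2) i n False' that] gaps)
      have gi: "root_gaps (R_inner i n T) = root_gaps (R_inner i n T')"
      proof (rule set_eqI)
        fix k show "k \<in> root_gaps (R_inner i n T) \<longleftrightarrow> k \<in> root_gaps (R_inner i n T')"
          using k[of k] subsetD[OF root_gaps_bounds(2)[OF inn(1) n], of k] subsetD[OF root_gaps_bounds(2)[OF
              inn(2) n], of k]
          by auto
      qed
      have "agree_on (root_gaps (R_inner i n T)) ?b ?b'"
        unfolding agree_on_def lb
      proof (intro conjI allI impI refl)
        fix k assume k: "k < n"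
        have "Suc k \<in> root_gaps (R_inner i n T) \<longleftrightarrow> Suc (i - 1 + k) \<in> root_gaps T"
          using in_root_gaps_R_inner[OF T(1) i n False, of "Suc k"] k i by simp
        then show "if Suc k \<in> root_gaps (R_inner i n T) then snd (?b ! k) = snd (?b' ! k) else fst (?b ! k)
            = fst (?b' ! k)"
          using ag'[of "i - 1 + k"] b[OF k] k i by auto
      qed
      then have "snd ?x = snd ?x'" by (rule gap_determined_snd[OF g inn lb(1) gi])
      then show ?thesis using False in_root_gaps_R_outer[OF T(1) i n, of i] by simp
    qed
    have "agree_on (root_gaps (R_outer i n T)) ?o ?o'"
      unfolding agree_on_def lo
    proof (intro conjI allI impI refl)
      fix j assume j: "j < m"
      show "if Suc j \<in> root_gaps (R_outer i n T) then snd (?o ! j) = snd (?o' ! j) else fst (?o ! j) = fst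
          (?o' ! j)"
        using x ag'[of j] ag'[of "j + n - 1"] j n i
        unfolding nth_outer_list[OF l(1) i j n] nth_outer_list[OF l(2) i j n]
        by (cases "Suc j" i rule: linorder_cases) (simp_all add: in_root_gaps_R_outer[OF T(1) i n] del: One_nat_def)
    qed
    then show ?thesis unfolding c by (rule gap_determined_snd[OF f o lo(1) og])
  qed
qed

lemma gap_determined_bracket:
  fixes f g :: "('a::ab_group_add, 'b::ab_group_add) op"
  assumes "gap_determined m f" "gap_determined n g" "1 \<le> m" "1 \<le> n"
  shows "gap_determined (m + n - 1) (bracket m n f g)"
proof -
  have "gap_determined (m + n - 1) (circ n m i g f)" if "1 \<le> i" "i \<le> n" for i
    using gap_determined_circ[OF assms(2,1) that assms(3)] by (simp add: add.commute)
  then show ?thesis unfolding bracket_def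
    by (intro gap_determined_diff gap_determined_pm gap_determined_sum)
      (use gap_determined_circ[OF assms(1,2) _ _ assms(4)] in auto)
qed

text \<open>
  \<open>word_of (root_gaps T) ds\<close> is the word $(c_1,\dots,c_n)$ in the definition of $\pi_{f,g,h}$, and
  \<open>word_gaps\<close>, \<open>lift_word\<close> recover a suitable set of gaps and a list of arguments from a word.
\<close>

definition word_of :: "nat set \<Rightarrow> ('a \<times> 'b) list \<Rightarrow> ('a + 'b) list" where
  "word_of S ds = map (\<lambda>j. if Suc j \<in> S then Inr (snd (ds ! j)) else Inl (fst (ds ! j))) [0..<length ds]"

lemma length_word_of [simp]: "length (word_of S ds) = length ds"
  by (simp add: word_of_def)

lemma nth_word_of: "j < length ds \<Longrightarrow>
    word_of S ds ! j = (if Suc j \<in> S then Inr (snd (ds ! j)) else Inl (fst (ds ! j)))"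
  by (simp add: word_of_def)

definition lift_word :: "('a + 'b) list \<Rightarrow> ('a::zero \<times> 'b::zero) list" where
  "lift_word = map (case_sum (\<lambda>a. (a, 0)) (\<lambda>x. (0, x)))"

definition word_gaps :: "('a + 'b) list \<Rightarrow> nat set" where
  "word_gaps w = {Suc j | j. j < length w \<and> \<not> isl (w ! j)}"

lemma length_lift_word [simp]: "length (lift_word w) = length w"
  by (simp add: lift_word_def)

lemma word_gaps_subset: "word_gaps w \<subseteq> {1..length w}"
  by (auto simp: word_gaps_def)

lemma word_of_lift_word: "word_of (word_gaps w) (lift_word w) = w"
proof (rule nth_equalityI)
  fix j assume "j < length (word_of (word_gaps w) (lift_word w))"
  then show "word_of (word_gaps w) (lift_word w) ! j = w ! j"
    by (cases "w ! j") (auto simp: nth_word_of lift_word_def word_gaps_def)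
qed simp

lemma word_gaps_word_of: "S \<subseteq> {1..length ds} \<Longrightarrow> word_gaps (word_of S ds) = S"
  by (auto simp: word_gaps_def nth_word_of image_iff Suc_le_eq gr0_conv_Suc subset_iff split: if_splits)

lemma agree_on_lift_word_of: "agree_on S (lift_word (word_of S ds)) ds"
  by (auto simp: agree_on_def lift_word_def nth_word_of)

lemma ex_isl_iff: "(\<exists>u\<in>set w. isl u) \<longleftrightarrow> (\<exists>j<length w. isl (w ! j))"
  "(\<exists>u\<in>set w. \<not> isl u) \<longleftrightarrow> (\<exists>j<length w. \<not> isl (w ! j))"
  by (metis in_set_conv_nth)+

lemma word_gaps_empty_iff: "word_gaps w = {} \<longleftrightarrow> (\<forall>u\<in>set w. isl u)"
  using ex_isl_iff(2)[of w] by (auto simp: word_gaps_def)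

lemma words_AB_iff:
  "(\<exists>k l. k + l = n \<and> 1 \<le> k \<and> 1 \<le> l \<and> c \<in> words_AB k l) \<longleftrightarrow>
    length c = n \<and> (\<exists>u\<in>set c. isl u) \<and> (\<exists>u\<in>set c. \<not> isl u)"
proof -
  have "(1 \<le> length (filter Q c)) = (\<exists>u\<in>set c. Q u)" for Q
    by (simp add: Suc_le_eq filter_empty_conv)
  then show ?thesis
    using sum_length_filter_compl[of isl c] by (auto simp: words_AB_def)
qed

lemma pi_fgh_eq:
  assumes "T \<in> trees n" "length ds = n"
  shows "pi_fgh sB lam n f g h T ds = (f (map fst ds), sB (lam ^ (arity_root T - 2)) (gh_sum g h (word_of
      (root_gaps T) ds)))"
proof -
  have "map (\<lambda>j. if j \<in> root_gaps T then Inr (snd (ds ! (j - 1))) else Inl (fst (ds ! (j - 1)))) [1..<n + 1]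
      = word_of (root_gaps T) ds"
    unfolding word_of_def using assms(2) by (simp add: map_Suc_upt[symmetric] comp_def del: upt_Suc)
  then show ?thesis using assms by (simp add: pi_fgh_def)
qed

lemma pi_fgh_outside: "T \<notin> trees n \<or> length ds \<noteq> n \<Longrightarrow> pi_fgh sB lam n f g h T ds = 0"
  by (auto simp: pi_fgh_def)

lemma gap_determined_pi_fgh:
  assumes "1 \<le> n"
  shows "gap_determined n (pi_fgh sB lam n f g h)"
proof (rule gap_determinedI)
  fix T T' and ds ds' :: "('a \<times> 'b) list"
  assume T: "T \<in> trees n" "T' \<in> trees n" and l: "length ds = n" "length ds' = n"
  note e = pi_fgh_eq[OF T(1) l(1)] pi_fgh_eq[OF T(2) l(2)]
  show "fst (pi_fgh sB lam n f g h T ds) = fst (pi_fgh sB lam n f g h T' ds')" if "map fst ds = map fst ds'"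
    by (simp add: e that)
  show "snd (pi_fgh sB lam n f g h T ds) = snd (pi_fgh sB lam n f g h T' ds')"
    if "root_gaps T = root_gaps T'" "agree_on (root_gaps T) ds ds'"
  proof -
    have "word_of (root_gaps T) ds = word_of (root_gaps T) ds'"
      using that(2) by (intro nth_equalityI) (auto simp: agree_on_def nth_word_of)
    \<comment> \<open>This makes the exponents of \<lambda> agree.\<close>
    moreover have "arity_root T = arity_root T'"
      using card_root_gaps[OF T(1) assms] card_root_gaps[OF T(2) assms] that(1) by simp
    ultimately show ?thesis by (simp add: e that(1))
  qed
qed

context two_spaces
begin

lemma vsA: "vector_space sA" and vsB: "vector_space sB"
  by unfold_locales

lemma gh_sum_slot:
  assumes g: "g \<in> multilinear sB sB n" and h: "h \<in> mixed_hom sA sB n" and w: "length w = n" "i < n"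
  shows "Vector_Spaces.linear sA sB (\<lambda>a. gh_sum g h (w[i := Inl a]))"
    and "Vector_Spaces.linear sB sB (\<lambda>x. gh_sum g h (w[i := Inr x]))"
proof -
  have h': "Vector_Spaces.linear sA sB (\<lambda>a. h (w[i := Inl a]))" "Vector_Spaces.linear sB sB
      (\<lambda>x. h (w[i := Inr x]))"
    using h w by (auto simp: mixed_hom_def)
  have "gh_sum g h (w[i := Inl a]) = h (w[i := Inl a])" for a
    using w set_update_memI[of i w "Inl a"] by (auto simp: gh_sum_def)
  then show "Vector_Spaces.linear sA sB (\<lambda>a. gh_sum g h (w[i := Inl a]))" using h'(1) by simp
  \<comment> \<open>Whether the updated word is mixed depends on the other letters only; as
    \<open>x\<close> varies, the value is given by \<open>g\<close> throughout or by
    \<open>h\<close> throughout.\<close>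
  have ex: "(\<exists>u\<in>set (w[i := Inr x]). isl u) \<longleftrightarrow> (\<exists>j<length w. j \<noteq>
      i \<and> isl (w ! j))" for x
    unfolding ex_isl_iff length_list_update by (rule ex_cong1) (use w in \<open>auto simp: nth_list_update\<close>)
  have g': "Vector_Spaces.linear sB sB (\<lambda>x. g ((map projr w)[i := x]))"
    using g w by (simp add: multilinear_def)
  show "Vector_Spaces.linear sB sB (\<lambda>x. gh_sum g h (w[i := Inr x]))"
    using h'(2) g' by (cases "\<exists>j<length w. j \<noteq> i \<and> isl (w ! j)") (simp_all only: gh_sum_def
        ex if_True if_False map_update sum.sel simp_thms)
qed

lemma word_of_slot:
  "word_of S (xs @ v # ys) = (word_of S (xs @ 0 # ys))[length xs := if Suc (length xs) \<in> S then Inr (snd v)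
      else Inl (fst v)]"
  by (rule nth_equalityI) (auto simp: nth_word_of nth_list_update nth_append nth_Cons')

lemma pi_fgh_in_C:
  assumes f: "f \<in> multilinear sA sA n" and g: "g \<in> multilinear sB sB n" and h: "h \<in> mixed_hom sA sB n"
  shows "pi_fgh sB lam n f g h \<in> C n"
proof (rule C_I)
  have f': "multi_add f" "multi_scale sA sA f" using f multilinear_iff[OF vsA vsA, of f n] by auto
  have *: "pi_fgh sB lam n f g h T (xs @ (u + v) # ys) = pi_fgh sB lam n f g h T (xs @ u # ys) + pi_fgh sB lam
      n f g h T (xs @ v # ys)
    \<and> pi_fgh sB lam n f g h T (xs @ sD c v # ys) = sD c (pi_fgh sB lam n f g h T (xs @ v # ys))" for T xs u v ys c
  proof (cases "T \<in> trees n \<and> length xs + 1 + length ys = n")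
    case True
    let ?w = "word_of (root_gaps T) (xs @ 0 # ys)"
    have w: "length ?w = n" "length xs < n" using True by auto
    note lin = gh_sum_slot[OF g h w]
    have e: "pi_fgh sB lam n f g h T (xs @ z # ys) = (f (map fst xs @ fst z # map fst ys),
        sB (lam ^ (arity_root T - 2)) (gh_sum g h (?w[length xs := if Suc (length xs) \<in> root_gaps T then
            Inr (snd z) else Inl (fst z)])))" for z
      using True by (subst pi_fgh_eq) (auto simp: word_of_slot[of _ xs z])
    show ?thesis
      using lin f' unfolding e
      by (auto simp: multi_add_def multi_scale_def scaleD_def Vector_Spaces.linear_iff B.scale_right_distrib
          mult.commute)
  next
    case False
    then have "pi_fgh sB lam n f g h T (xs @ z # ys) = 0" for z by (intro pi_fgh_outside) auto
    then show ?thesis by simp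
  qed
  show "pi_fgh sB lam n f g h T (xs @ (u + v) # ys) = pi_fgh sB lam n f g h T (xs @ u # ys) + pi_fgh sB lam n f
      g h T (xs @ v # ys)"
    and "pi_fgh sB lam n f g h T (xs @ sD c v # ys) = sD c (pi_fgh sB lam n f g h T (xs @ v # ys))" for T xs u v ys c
    using * by blast+
qed (rule pi_fgh_outside)

text \<open>A word with a letter from B prescribes a nonempty set of gaps, and a tree with these
  gaps exists. Evaluating \<open>F\<close> there, on arguments whose relevant entries are the
  letters, gives g + h up to a power of \<lambda>.\<close>

lemma ex_pi_fgh:
  assumes lam: "lam \<noteq> 0" and n: "1 \<le> n" and F: "F \<in> C n" "gap_determined n F"
  shows "\<exists>f\<in>multilinear sA sA n. \<exists>g\<in>multilinear sB sB n. \<exists>h\<in>mixed_hom sA sB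
      n. F = pi_fgh sB lam n f g h"
proof -
  define tr where "tr S = (SOME T. T \<in> trees n \<and> root_gaps T = S)" for S
  have tr: "tr S \<in> trees n" "root_gaps (tr S) = S" if "S \<subseteq> {1..n}" "S \<noteq> {}" for S
    using someI_ex[of "\<lambda>T. T \<in> trees n \<and> root_gaps T = S"] ex_tree_root_gaps[OF that]
        unfolding tr_def by blast+
  \<comment> \<open>The A-part is the same on all trees, so one fixed tree suffices to define
    f.\<close>
  define T0 where "T0 = tr {1..n}"
  have T0: "T0 \<in> trees n" "root_gaps T0 = {1..n}" using tr[of "{1..n}"] n by (auto simp: T0_def)
  define f where "f as = fst (F T0 (map (\<lambda>a. (a, 0)) as))" for as
  \<comment> \<open>A tree with s gaps has k = s + 1 branches at the root, so \<lambda>^{k-2} is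
    divided out by the power s - 1 of the inverse.\<close>
  define G where "G w = sB (inverse lam ^ (card (word_gaps w) - 1)) (snd (F (tr (word_gaps w)) (lift_word w)))" for w
  define g where "g xs = G (map Inr xs)" for xs
  \<comment> \<open>On words over A alone \<open>G\<close> is an arbitrary value, because no tree in
    \<open>trees n\<close> has an empty set of gaps; on words over B alone it is accounted for by
    \<open>g\<close>.\<close>
  define h where "h w = (if length w = n \<and> (\<exists>u\<in>set w. isl u) \<and> (\<exists>u\<in>set w.
      \<not> isl u) then G w else 0)" for w
  have zs: "(u + v, 0::'b) = (u, 0) + (v, 0)" "(0::'a, x + y) = (0, x) + (0, y)"
    "(sA c u, 0::'b) = sD c (u, 0)" "(0::'a, sB c x) = sD c (0, x)"
    for u v :: 'a and x y :: 'b and c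
    by (auto simp: scaleD_def)
  have "f \<in> multilinear sA sA n"
    unfolding multilinear_iff[OF vsA vsA] multi_add_def multi_scale_def f_def map_append list.map zs C_add[OF
        F(1)] C_scale[OF F(1)]
    by (auto simp: C_outside[OF F(1)] scaleD_def)
  moreover have "g \<in> multilinear sB sB n"
  proof -
    have wg: "word_gaps (map Inr xs :: ('a + 'b) list) = {1..length xs}" for xs :: "'b list"
      by (auto simp: word_gaps_def image_iff Suc_le_eq gr0_conv_Suc)
    have g_eq: "g xs = sB (inverse lam ^ (length xs - 1)) (snd (F (tr {1..length xs}) (map (\<lambda>x. (0, x))
        xs)))" for xs
      unfolding g_def G_def wg by (simp add: lift_word_def comp_def)
    show ?thesis
      unfolding multilinear_iff[OF vsB vsB] multi_add_def multi_scale_def g_eq length_append list.size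
          map_append list.map zs
        C_add[OF F(1)] C_scale[OF F(1)]
      by (auto simp: C_outside[OF F(1)] scaleD_def B.scale_right_distrib mult.commute)
  qed
  moreover have "h \<in> mixed_hom sA sB n"
  proof -
    have slot: "word_gaps (w[i := u]) = (word_gaps w - {Suc i}) \<union> (if i < length w \<and> \<not> isl u
        then {Suc i} else {})" for w :: "('a + 'b) list" and i u
      by (cases "i < length w") (auto simp: word_gaps_def nth_list_update list_update_beyond split: if_splits)
    have lift: "lift_word (w[i := u]) = take i (lift_word w) @ case_sum (\<lambda>a. (a, 0)) (\<lambda>x. (0,
        x)) u # drop (Suc i) (lift_word w)"
      if "i < length w" for w :: "('a + 'b) list" and i u
      using that by (simp add: lift_word_def map_update upd_conv_take_nth_drop take_map drop_map)
    have linA: "Vector_Spaces.linear sA sB (\<lambda>a. h (c[i := Inl a]))" if "length c = n" "i < n" for c i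
    proof -
      have ex: "(\<exists>u\<in>set (c[i := Inl a]). isl u) \<longleftrightarrow> True" for a
        using that set_update_memI[of i c "Inl a"] by (auto intro!: bexI[of _ "Inl a"])
      have ex': "(\<exists>u\<in>set (c[i := Inl a]). \<not> isl u) \<longleftrightarrow> (\<exists>j<length c.
          j \<noteq> i \<and> \<not> isl (c ! j))" for a
        unfolding ex_isl_iff length_list_update by (rule ex_cong1) (use that in \<open>auto simp:
            nth_list_update\<close>)
      have "Vector_Spaces.linear sA sB (\<lambda>a. G (c[i := Inl a]))"
        unfolding G_def slot using that
        by (simp add: lift linear_iff_vs[OF vsA vsB] zs C_add[OF F(1)] C_scale[OF F(1)] del: add_Pair)
          (simp add: scaleD_def B.scale_right_distrib mult.commute)
      moreover have "Vector_Spaces.linear sA sB (\<lambda>a. 0)"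
        by (simp add: linear_iff_vs[OF vsA vsB])
      ultimately show ?thesis
        unfolding h_def ex ex' using that(1)
        by (cases "\<exists>j<length c. j \<noteq> i \<and> \<not> isl (c ! j)") (simp_all only:
            length_list_update simp_thms if_True if_False)
    qed
    have linB: "Vector_Spaces.linear sB sB (\<lambda>x. h (c[i := Inr x]))" if "length c = n" "i < n" for c i
    proof -
      have ex: "(\<exists>u\<in>set (c[i := Inr x]). \<not> isl u) \<longleftrightarrow> True" for x
        using that set_update_memI[of i c "Inr x"] by (auto intro!: bexI[of _ "Inr x"])
      have ex': "(\<exists>u\<in>set (c[i := Inr x]). isl u) \<longleftrightarrow> (\<exists>j<length c. j
          \<noteq> i \<and> isl (c ! j))" for x
        unfolding ex_isl_iff length_list_update by (rule ex_cong1) (use that in \<open>auto simp: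
            nth_list_update\<close>)
      have "Vector_Spaces.linear sB sB (\<lambda>x. G (c[i := Inr x]))"
        unfolding G_def slot using that
        by (simp add: lift linear_iff_vs[OF vsB vsB] zs C_add[OF F(1)] C_scale[OF F(1)] del: add_Pair)
          (simp add: scaleD_def B.scale_right_distrib mult.commute)
      moreover have "Vector_Spaces.linear sB sB (\<lambda>x. 0)"
        by (simp add: linear_iff_vs[OF vsB vsB])
      ultimately show ?thesis
        unfolding h_def ex ex' using that(1)
        by (cases "\<exists>j<length c. j \<noteq> i \<and> isl (c ! j)") (simp_all only: length_list_update
            simp_thms if_True if_False)
    qed
    show ?thesis
      unfolding mixed_hom_def words_AB_iff using linA linB by (auto simp: h_def)
  qed
  moreover have "F = pi_fgh sB lam n f g h"
  proof (rule op_eqI[of n])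
    fix T and ds :: "('a \<times> 'b) list"
    assume T: "T \<in> trees n" and l: "length ds = n"
    let ?S = "root_gaps T"
    let ?w = "word_of ?S ds"
    have S: "?S \<subseteq> {1..n}" "?S \<noteq> {}" using root_gaps_bounds[OF T n] by auto
    have wg: "word_gaps ?w = ?S" using S l by (intro word_gaps_word_of) simp
    have nl: "\<exists>u\<in>set ?w. \<not> isl u" using word_gaps_empty_iff[of ?w] wg S by auto
    have "f (map fst ds) = fst (F T ds)"
      unfolding f_def by (rule gap_determined_fst[OF F(2) T0(1) T]) (simp_all add: l comp_def)
    moreover have "gh_sum g h ?w = G ?w"
    proof (cases "\<exists>u\<in>set ?w. isl u")
      case True
      then show ?thesis using nl l by (simp add: gh_sum_def h_def)
    next
      case False
      then have "map Inr (map projr ?w) = ?w"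
        unfolding map_map by (intro map_idI) (metis comp_apply sum.collapse(2))
      then show ?thesis using False by (simp add: gh_sum_def g_def)
    qed
    moreover have "snd (F (tr ?S) (lift_word ?w)) = snd (F T ds)"
      by (rule gap_determined_snd[OF F(2) tr(1)[OF S] T]) (simp_all add: l tr(2)[OF S] agree_on_lift_word_of)
    moreover have "arity_root T - 2 = card ?S - 1"
      using card_root_gaps[OF T n] by simp
    ultimately show "F T ds = pi_fgh sB lam n f g h T ds"
      using lam by (simp add: pi_fgh_eq[OF T l] G_def wg prod_eq_iff flip: power_mult_distrib)
  qed (rule C_outside[OF F(1)] pi_fgh_outside; assumption)+
  ultimately show ?thesis by blast
qed

text \<open>Every word of length \<open>n\<close> with a letter from B occurs as (c_1,...,c_n) for
  some tree and arguments, so the value of g + h on it is recovered by cancelling a power of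
  \<lambda>.\<close>

lemma pi_fgh_inject:
  assumes lam: "lam \<noteq> 0" and n: "1 \<le> n"
    and f: "f \<in> multilinear sA sA n" "f' \<in> multilinear sA sA n"
    and g: "g \<in> multilinear sB sB n" "g' \<in> multilinear sB sB n"
    and h: "h \<in> mixed_hom sA sB n" "h' \<in> mixed_hom sA sB n"
    and eq: "pi_fgh sB lam n f g h = pi_fgh sB lam n f' g' h'"
  shows "f = f' \<and> g = g' \<and> h = h'"
proof (intro conjI ext)
  have w: "gh_sum g h w = gh_sum g' h' w" if wl: "length w = n" and wi: "\<not> (\<forall>u\<in>set w. isl u)" for w
  proof -
    obtain T where T: "T \<in> trees n" "root_gaps T = word_gaps w"
      using ex_tree_root_gaps[of "word_gaps w" n] word_gaps_subset[of w] wl wi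
      unfolding word_gaps_empty_iff[symmetric] by blast
    have "snd (pi_fgh sB lam n f g h T (lift_word w)) = snd (pi_fgh sB lam n f' g' h' T (lift_word w))"
      by (simp only: eq)
    then show ?thesis using lam wl T by (simp add: pi_fgh_eq word_of_lift_word)
  qed
  obtain T where T: "T \<in> trees n" using ex_tree_root_gaps[of "{1..n}" n] n by auto
  show "f as = f' as" for as
  proof (cases "length as = n")
    case True
    have "fst (pi_fgh sB lam n f g h T (map (\<lambda>a. (a, 0)) as)) = fst (pi_fgh sB lam n f' g' h' T (map
        (\<lambda>a. (a, 0)) as))"
      by (simp only: eq)
    then show ?thesis using True T by (simp add: pi_fgh_eq comp_def)
  next
    case False
    then show ?thesis using f by (simp add: multilinear_def)
  qed
  show "g xs = g' xs" for xs
  proof (cases "length xs = n")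
    case True
    then have "gh_sum g h (map Inr xs) = gh_sum g' h' (map Inr xs)" using n by (intro w) (auto simp: Suc_le_eq)
    then show ?thesis by (simp add: gh_sum_def comp_def)
  next
    case False
    then show ?thesis using g by (simp add: multilinear_def)
  qed
  show "h c = h' c" for c
  proof (cases "length c = n \<and> (\<exists>u\<in>set c. isl u) \<and> (\<exists>u\<in>set c. \<not> isl u)")
    case True
    then show ?thesis using w[of c] by (auto simp: gh_sum_def)
  next
    case False
    then show ?thesis using h unfolding mixed_hom_def words_AB_iff by auto
  qed
qed

end

section \<open>The cochain complex\<close>

lemma subspace_iff:
  "module s \<Longrightarrow> module.subspace s S \<longleftrightarrow> 0 \<in> S \<and> (\<forall>x\<in>S.
      \<forall>y\<in>S. x + y \<in> S) \<and> (\<forall>c. \<forall>x\<in>S. s c x \<in> S)"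
  by (simp add: module.subspace_def)

lemma root_gaps_not_all_Inl: "T \<in> trees n \<Longrightarrow> 1 \<le> n \<Longrightarrow> \<exists>j<n. Suc j
    \<in> root_gaps T"
  using root_gaps_bounds[of T n] by (auto simp: Suc_le_eq gr0_conv_Suc subset_iff)

abbreviation zero_snd :: "'a \<times> 'b \<Rightarrow> 'a \<times> 'b::zero" where "zero_snd \<equiv>
    \<lambda>d. (fst d, 0)"

context two_spaces
begin

text \<open>These are the two conditions that define \<open>h_part\<close>.\<close>

lemma gap_determined_factor:
  assumes F: "F \<in> C n" "gap_determined n F" and n: "1 \<le> n"
  shows "fst (F T ds) = fst (F T (map zero_snd ds))" and "snd (F T (map zero_snd ds)) = 0"
proof -
  show "fst (F T ds) = fst (F T (map zero_snd ds))"
  proof (cases "T \<in> trees n \<and> length ds = n")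
    case True
    then show ?thesis by (intro gap_determined_fst[OF F(2)]) (auto simp: comp_def)
  next
    case False
    then show ?thesis using C_outside[OF F(1)] by auto
  qed
  show "snd (F T (map zero_snd ds)) = 0"
  proof (cases "T \<in> trees n \<and> length ds = n")
    case True
    then obtain j where j: "j < n" "Suc j \<in> root_gaps T" using root_gaps_not_all_Inl n by blast
    let ?ds = "map zero_snd ds"
    \<comment> \<open>At a gap the B-part reads only the second component, which is 0 here, so the
      whole entry may be replaced by 0.\<close>
    have "snd (F T ?ds) = snd (F T (take j ?ds @ 0 # drop (Suc j) ?ds))"
    proof (rule gap_determined_snd[OF F(2)])
      have "take j ?ds @ 0 # drop (Suc j) ?ds = ?ds[j := 0]" using j True by (simp add: upd_conv_take_nth_drop)
      then show "agree_on (root_gaps T) ?ds (take j ?ds @ 0 # drop (Suc j) ?ds)"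
        using j True by (auto simp: agree_on_def nth_list_update)
    qed (use True in auto)
    then show ?thesis by (simp add: C_zero_arg[OF F(1)])
  next
    case False
    then show ?thesis using C_outside[OF F(1)] by auto
  qed
qed

text \<open>Supplies the assumption p \<theta> = 0 of \<open>l1_twisted_eq\<close>. With all
  A-entries zero the A-part vanishes by linearity in the first argument, which exists since n \<ge>
  1.\<close>

lemma gap_determined_proj:
  assumes F: "F \<in> C n" "gap_determined n F" and n: "1 \<le> n"
  shows "proj F = 0"
proof (intro ext)
  fix T and ds :: "('a \<times> 'b) list"
  let ?ds = "map zero_snd (map zero_fst ds)"
  have "F T ?ds = 0"
  proof (cases ds)
    case Nil
    then show ?thesis using n by (intro C_outside[OF F(1)]) simp
  next
    case (Cons d es)
    then show ?thesis using C_zero_arg[OF F(1), of T "[]"] by (simp add: zero_prod_def)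
  qed
  then show "proj F T ds = 0 T ds"
    using gap_determined_factor(1)[OF F n, of T "map zero_fst ds"] by (simp add: proj_def zero_prod_def)
qed

lemma gap_determined_in_h_part:
  assumes F: "F \<in> C n" "gap_determined n F" and n: "1 \<le> n"
  shows "F \<in> h_part sA sB (int n - 2 + 1)"
proof -
  have "nat (int n - 2 + 1 + 1) = n" "\<not> int n - 2 + 1 < 0" using n by auto
  then show ?thesis using F(1) gap_determined_factor[OF F n] by (auto simp: h_part_def)
qed

lemma emb_a_in_C:
  assumes "\<gamma> \<in> tree_hom sB sA n"
  shows "emb_a \<gamma> \<in> C n"
  using assms unfolding tree_hom_iff[OF vsB vsA] multi_add_def multi_scale_def
  by (intro C_I) (auto simp: emb_a_def scaleD_def zero_prod_def)

lemma proj_emb_a: "proj (emb_a \<gamma>) = emb_a \<gamma>"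
  by (simp add: proj_def emb_a_def fun_eq_iff comp_def)

lemma ex_emb_a:
  assumes "F \<in> C n"
  shows "\<exists>\<gamma>\<in>tree_hom sB sA n. proj F = emb_a \<gamma>"
proof
  let ?g = "\<lambda>T xs. fst (F T (map (\<lambda>x. (0, x)) xs))"
  have zs: "(0::'a, x + y) = (0, x) + (0, y)" "(0::'a, sB c x) = sD c (0, x)" for x y c
    by (auto simp: scaleD_def)
  show "?g \<in> tree_hom sB sA n"
    unfolding tree_hom_iff[OF vsB vsA] multi_add_def multi_scale_def map_append list.map zs C_add[OF assms]
        C_scale[OF assms]
    by (auto simp: C_outside[OF assms] scaleD_def)
  show "proj F = emb_a ?g"
    by (simp add: proj_def emb_a_def fun_eq_iff comp_def)
qed

lemma emb_a_inject: "emb_a \<gamma> = emb_a \<gamma>' \<Longrightarrow> \<gamma> = (\<gamma>' :: ptree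
    \<Rightarrow> 'b list \<Rightarrow> 'a)"
proof (intro ext)
  fix T and xs :: "'b list"
  assume "emb_a \<gamma> = (emb_a \<gamma>' :: ('a, 'b) op)"
  then have "fst (emb_a \<gamma> T (map (\<lambda>x. (0::'a, x)) xs)) = fst (emb_a \<gamma>' T (map
      (\<lambda>x. (0::'a, x)) xs))" by simp
  then show "\<gamma> T xs = \<gamma>' T xs" by (simp add: emb_a_def comp_def)
qed

abbreviation Ch :: "nat \<Rightarrow> ('a, 'b) cochain set" where "Ch \<equiv> cochains sA sB"

lemma zero_mixed_hom: "0 \<in> mixed_hom sA sB n"
  by (simp add: mixed_hom_def linear_iff_vs[OF vsA vsB] linear_iff_vs[OF vsB vsB])

lemma zero_tree_hom: "0 \<in> tree_hom sB sA n"
  unfolding tree_hom_iff[OF vsB vsA] by (simp add: multi_add_def multi_scale_def)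

lemma zero_multilinear: "0 \<in> multilinear sA sA n" "0 \<in> multilinear sB sB n"
  unfolding multilinear_iff[OF vsA vsA] multilinear_iff[OF vsB vsB] by (simp_all add: multi_add_def multi_scale_def)

text \<open>
  The only tree in $T_1$ has one gap, so $(f,g) \in C^1$ fits the general formula with \<open>h = 0\<close>.
\<close>

lemma fg_op_eq_pi_fgh: "fg_op (f :: 'a list \<Rightarrow> 'a) g = pi_fgh sB lam 1 f g 0"
proof (intro ext)
  fix T and ds :: "('a \<times> 'b) list"
  show "fg_op f g T ds = pi_fgh sB lam 1 f g 0 T ds"
  proof (cases "T \<in> trees 1 \<and> length ds = 1")
    case True
    then obtain d where d: "ds = [d]" by (auto simp: length_Suc_conv)
    have r: "root_gaps T = {1}" using root_gaps_bounds[of T 1] True by auto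
    have "arity_root T = 2" using card_root_gaps[of T 1] True r by simp
    then show ?thesis using True r
      by (simp add: pi_fgh_eq d fg_op_def word_of_def gh_sum_def del: root_gaps.simps)
  next
    case False
    then show ?thesis by (auto simp: fg_op_def pi_fgh_def)
  qed
qed

lemma emb_eq: "1 \<le> n \<Longrightarrow> (f, g, h, \<gamma>) \<in> Ch n \<Longrightarrow> emb sB lam n (f, g,
    h, \<gamma>) = (pi_fgh sB lam n f g h, emb_a \<gamma>)"
proof (cases "n = 1")
  case True
  moreover assume "(f, g, h, \<gamma>) \<in> Ch n"
  ultimately have "h = 0" "\<gamma> = 0" by (auto simp: cochains_def)
  moreover have "emb_a (0 :: ptree \<Rightarrow> 'b list \<Rightarrow> 'a) = (0 :: ('a, 'b) op)"
    by (simp add: emb_a_def fun_eq_iff zero_prod_def)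
  ultimately show ?thesis using True by (simp add: emb_def fg_op_eq_pi_fgh[of _ _ lam])
qed (simp add: emb_def)

lemma cochainsD:
  assumes "(f, g, h, \<gamma>) \<in> Ch n" "1 \<le> n"
  shows "f \<in> multilinear sA sA n" "g \<in> multilinear sB sB n" "h \<in> mixed_hom sA sB n" "\<gamma> \<in>
      tree_hom sB sA (n - 1)"
  using assms by (auto simp: cochains_def zero_mixed_hom zero_tree_hom split: if_splits)

lemma emb_props:
  assumes c: "c \<in> Ch n" and n: "1 \<le> n"
  shows "fst (emb sB lam n c) \<in> C n" "gap_determined n (fst (emb sB lam n c))"
    "snd (emb sB lam n c) \<in> C (n - 1)" "proj (snd (emb sB lam n c)) = snd (emb sB lam n c)"
    "n = 1 \<Longrightarrow> snd (emb sB lam n c) = 0"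
proof -
  obtain f g h \<gamma> where e: "c = (f, g, h, \<gamma>)" by (metis prod_cases4)
  note m = cochainsD[OF c[unfolded e] n]
  note e' = emb_eq[OF n c[unfolded e], of lam]
  show "fst (emb sB lam n c) \<in> C n" "gap_determined n (fst (emb sB lam n c))"
    "snd (emb sB lam n c) \<in> C (n - 1)" "proj (snd (emb sB lam n c)) = snd (emb sB lam n c)"
    unfolding e e' using pi_fgh_in_C[OF m(1-3)] gap_determined_pi_fgh[OF n] emb_a_in_C[OF m(4)] proj_emb_a by auto
  show "n = 1 \<Longrightarrow> snd (emb sB lam n c) = 0"
    by (simp add: e emb_def)
qed

lemma emb_in_sh_a:
  assumes c: "c \<in> Ch n" and n: "1 \<le> n"
  shows "emb sB lam n c \<in> sh_a sA sB (int n - 2)"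
proof -
  note p = emb_props[OF c n, of lam]
  have "snd (emb sB lam n c) \<in> a_part sA sB (int n - 2)"
  \<comment> \<open>For n = 1 the degree is -1, where \<open>a_part\<close> consists of 0
    only.\<close>
  proof (cases "n = 1")
    case True
    then show ?thesis using p(5) by (simp add: a_part_def)
  next
    case False
    then have "nat (int n - 2 + 1) = n - 1" "\<not> int n - 2 < 0" using n by auto
    then show ?thesis using p by (simp add: a_part_def)
  qed
  then show ?thesis using gap_determined_in_h_part[OF p(1,2) n]
    by (simp add: sh_a_def mem_Times_iff)
qed

lemma inj_on_emb:
  assumes lam: "lam \<noteq> 0" and n: "1 \<le> n"
  shows "inj_on (emb sB lam n) (Ch n)"
proof (rule inj_onI)
  fix c c' assume c: "c \<in> Ch n" "c' \<in> Ch n" and eq: "emb sB lam n c = emb sB lam n c'"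
  obtain f g h \<gamma> f' g' h' \<gamma>' where e: "c = (f, g, h, \<gamma>)" "c' = (f', g', h', \<gamma>')" by
      (metis prod_cases4)
  note m = cochainsD[OF c(1)[unfolded e] n] cochainsD[OF c(2)[unfolded e] n]
  have "pi_fgh sB lam n f g h = pi_fgh sB lam n f' g' h'" "emb_a \<gamma> = (emb_a \<gamma>' :: ('a, 'b) op)"
    using eq unfolding e emb_eq[OF n c(1)[unfolded e]] emb_eq[OF n c(2)[unfolded e]] by simp_all
  then show "c = c'"
    using pi_fgh_inject[OF lam n m(1,5) m(2,6) m(3,7)] emb_a_inject by (auto simp: e)
qed

text \<open>This brings the differential of a cochain back into the cochains: its second entry is
  always a value of p.\<close>

lemma emb_surj:
  assumes lam: "lam \<noteq> 0" and n: "2 \<le> n" and F: "F \<in> C n" "gap_determined n F" and G: "G \<in> C (n - 1)"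
  shows "(F, proj G) \<in> emb sB lam n ` Ch n"
proof -
  obtain f g h where m: "f \<in> multilinear sA sA n" "g \<in> multilinear sB sB n" "h \<in> mixed_hom sA sB n"
    and F': "F = pi_fgh sB lam n f g h"
    using ex_pi_fgh[OF lam _ F] n by auto
  obtain \<gamma> where "\<gamma> \<in> tree_hom sB sA (n - 1)" "proj G = emb_a \<gamma>" using ex_emb_a[OF G] by blast
  then show ?thesis using m n by (intro image_eqI[of _ _ "(f, g, h, \<gamma>)"]) (auto simp: F' emb_def cochains_def)
qed

section \<open>The linear structure of the cochains\<close>

lemma multilinear_add: "f \<in> multilinear sA sA n \<Longrightarrow> f' \<in> multilinear sA sA n
    \<Longrightarrow> f + f' \<in> multilinear sA sA n"
  and multilinear_scale: "f \<in> multilinear sA sA n \<Longrightarrow> (\<lambda>as. sA c (f as)) \<in>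
      multilinear sA sA n"
  and multilinear_add_B: "g \<in> multilinear sB sB n \<Longrightarrow> g' \<in> multilinear sB sB n
      \<Longrightarrow> g + g' \<in> multilinear sB sB n"
  and multilinear_scale_B: "g \<in> multilinear sB sB n \<Longrightarrow> (\<lambda>as. sB c (g as)) \<in>
      multilinear sB sB n"
  and tree_hom_add: "\<gamma> \<in> tree_hom sB sA n \<Longrightarrow> \<gamma>' \<in> tree_hom sB sA n
      \<Longrightarrow> \<gamma> + \<gamma>' \<in> tree_hom sB sA n"
  and tree_hom_scale: "\<gamma> \<in> tree_hom sB sA n \<Longrightarrow> (\<lambda>T xs. sA c (\<gamma> T xs))
      \<in> tree_hom sB sA n"
  unfolding multilinear_iff[OF vsA vsA] multilinear_iff[OF vsB vsB] tree_hom_iff[OF vsB vsA] multi_add_def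
      multi_scale_def
  by (simp_all add: A.scale_right_distrib B.scale_right_distrib algebra_simps mult.commute)

lemma mixed_hom_add: "h \<in> mixed_hom sA sB n \<Longrightarrow> h' \<in> mixed_hom sA sB n \<Longrightarrow>
    h + h' \<in> mixed_hom sA sB n"
  and mixed_hom_scale: "h \<in> mixed_hom sA sB n \<Longrightarrow> (\<lambda>w. sB c (h w)) \<in> mixed_hom sA sB n"
  unfolding mixed_hom_def linear_iff_vs[OF vsA vsB] linear_iff_vs[OF vsB vsB]
  by (simp_all add: B.scale_right_distrib algebra_simps mult.commute)

lemma Ch_zero: "0 \<in> Ch n"
  by (simp add: cochains_def zero_multilinear zero_mixed_hom zero_tree_hom zero_prod_def)

lemma Ch_add: "c \<in> Ch n \<Longrightarrow> c' \<in> Ch n \<Longrightarrow> c + c' \<in> Ch n"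
  by (cases c; cases c') (auto simp: cochains_def multilinear_add multilinear_add_B mixed_hom_add tree_hom_add
      zero_prod_def split: if_splits)

abbreviation sC :: "'k \<Rightarrow> ('a, 'b) cochain \<Rightarrow> ('a, 'b) cochain" where "sC \<equiv>
    scale_cochain sA sB"

lemma Ch_scale: "c \<in> Ch n \<Longrightarrow> sC r c \<in> Ch n"
  by (cases c) (auto simp: cochains_def scale_cochain_def multilinear_scale multilinear_scale_B mixed_hom_scale
      tree_hom_scale
      zero_prod_def fun_eq_iff split: if_splits)

lemma module_cochain: "module sC"
  by unfold_locales (simp_all add: scale_cochain_def split_def prod_eq_iff fun_eq_iff
      A.scale_right_distrib A.scale_left_distrib B.scale_right_distrib B.scale_left_distrib)

lemma emb_add: "emb sB lam n (c + c') = emb sB lam n c + emb sB lam n c'"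
  by (cases c; cases c')
    (auto simp: emb_def fg_op_def pi_fgh_def gh_sum_def emb_a_def fun_eq_iff B.scale_right_distrib)

lemma emb_scale: "emb sB lam n (sC r c) = (scale_op r (fst (emb sB lam n c)), scale_op r (snd (emb sB lam n c)))"
  by (cases c)
    (auto simp: emb_def fg_op_def pi_fgh_def gh_sum_def emb_a_def fun_eq_iff scale_cochain_def scale_op_def scaleD_def
      zero_prod_def mult.commute)

end


lemma pm_Pair: "pm e (x, y) = (pm e x, pm e y)"
  by (simp add: pm_def)

context rel_averaging_char_0
begin

text \<open>For the gap sets {1}, {2}, {1, 2} the B-value is the right action on x, the left action
  on y, and \<lambda> x y: entries from B are read exactly at the gaps.\<close>

lemma gap_determined_\<pi>: "gap_determined 2 \<pi>"
proof (rule gap_determinedI)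
  fix T T' and ds ds' :: "('a \<times> 'b) list"
  assume T: "T \<in> trees 2" "T' \<in> trees 2" and "length ds = 2" "length ds' = 2"
  then obtain d e d' e' where ds: "ds = [d, e]" "ds' = [d', e']"
    by (auto simp: numeral_2_eq_2 length_Suc_conv)
  show "fst (\<pi> T ds) = fst (\<pi> T' ds')" if "map fst ds = map fst ds'"
    using that by (simp add: ds \<pi>_apply[OF T(1)] \<pi>_apply[OF T(2)])
  show "snd (\<pi> T ds) = snd (\<pi> T' ds')" if g: "root_gaps T = root_gaps T'" and "agree_on (root_gaps T) ds ds'"
  proof -
    have a: "if 1 \<in> root_gaps T then snd d = snd d' else fst d = fst d'"
      "if 2 \<in> root_gaps T then snd e = snd e' else fst e = fst e'"
      using that(2)[unfolded agree_on_def ds, THEN conjunct2, rule_format, of 0]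
        that(2)[unfolded agree_on_def ds, THEN conjunct2, rule_format, of 1]
      by (simp_all add: numeral_2_eq_2 split: if_splits)
    have "root_gaps T = {1} \<or> root_gaps T = {2} \<or> root_gaps T = {1, 2}"
      using T(1) by (cases rule: trees_2_cases) (simp_all add: root_gaps_trees_2 del: root_gaps.simps)
    then show ?thesis
      using a unfolding ds \<pi>_apply[OF T(1)] \<pi>_apply[OF T(2)] g[symmetric] by auto
  qed
qed

text \<open>Closed form of \<open>signed_l1\<close> on embedded cochains. It is defined on all
  pairs, and its additivity and homogeneity are immediate.\<close>

definition D_map :: "nat \<Rightarrow> ('a, 'b) op \<times> ('a, 'b) op \<Rightarrow> ('a, 'b) op \<times> ('a,
    'b) op" where
  "D_map n w = pm (int n - 2) (- bracket 2 n \<pi> (fst w), proj (twist (fst w)) + proj (bracket 2 (n - 1)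
      \<mu> (snd w)))"

lemma additive_D_map: "additive (D_map n)"
  by (simp add: additive_def D_map_def additive.add[OF additive_bracket_right[OF \<pi>_in_C]]
      additive.add[OF additive_bracket_right[OF \<mu>_in_C]] pm_Pair)

lemma D_map_scale_op:
  "D_map n (scale_op r (fst w), scale_op r (snd w)) = (scale_op r (fst (D_map n w)), scale_op r (snd (D_map n w)))"
  by (simp add: D_map_def pm_Pair bracket_scale_right[OF \<pi>_in_C] bracket_scale_right[OF \<mu>_in_C] twist_scale_op
      proj_scale_op scale_op_pm)

lemma D_map_D_map:
  assumes \<theta>: "fst w \<in> C n" and \<gamma>: "snd w \<in> C (n - 1)" "n = 1 \<Longrightarrow> snd w = 0"
      and n: "1 \<le> n"
  shows "D_map (n + 1) (D_map n w) = 0"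
proof -
  define w' where "w' = (- bracket 2 n \<pi> (fst w), proj (twist (fst w)) + proj (bracket 2 (n - 1) \<mu> (snd w)))"
  note a\<pi> = additive_bracket_right[OF \<pi>_in_C] and a\<mu> = additive_bracket_right[OF \<mu>_in_C]
  have b: "bracket 2 (n - 1) \<mu> (snd w) \<in> C n"
    using bracket_in_C[OF \<mu>_in_C \<gamma>(1)] n by simp
  have 1: "bracket 2 (n + 1) \<pi> (fst w') = 0"
    by (simp only: w'_def fst_conv additive.minus[OF a\<pi>] bracket_bracket_eq_0[OF \<pi>_in_C \<pi>_assoc n]
        minus_zero)
  \<comment> \<open>For n = 1 the inner bracket has an argument of arity 0, outside the range of
    \<open>bracket_bracket_eq_0\<close>; there \<gamma> = 0.\<close>
  have "bracket 2 n \<mu> (bracket 2 (n - 1) \<mu> (snd w)) = 0"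
  proof (cases "n = 1")
    case True
    then show ?thesis using \<gamma>(2) by (simp add: additive.zero[OF a\<mu>])
  next
    case False
    then show ?thesis using bracket_bracket_eq_0[OF \<mu>_in_C \<mu>_assoc, of "n - 1"] n by simp
  qed
  then have "proj (bracket 2 n \<mu> (proj (bracket 2 (n - 1) \<mu> (snd w)))) = 0"
    unfolding proj_bracket_proj[OF \<mu>_in_C proj_\<mu> b] by simp
  moreover have "proj (bracket 2 n \<mu> (proj (twist (fst w)))) = proj (twist (bracket 2 n \<pi> (fst w)))"
    by (simp add: proj_bracket_proj[OF \<mu>_in_C proj_\<mu> twist_in_C[OF \<theta>]] twist_bracket flip: \<mu>_def)
  ultimately have 2: "proj (twist (fst w')) + proj (bracket 2 n \<mu> (snd w')) = 0"
    by (simp add: w'_def additive.add[OF a\<mu>])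
  have "D_map (n + 1) w' = 0"
    using 1 2 by (simp add: D_map_def pm_Pair zero_prod_def)
  moreover have "D_map n w = pm (int n - 2) w'"
    by (simp add: D_map_def w'_def)
  ultimately show ?thesis
    by (simp add: additive_pm[OF additive_D_map])
qed

abbreviation E :: "nat \<Rightarrow> ('a, 'b) cochain \<Rightarrow> ('a, 'b) op \<times> ('a, 'b) op" where "E
    \<equiv> emb scaleB lam"
abbreviation \<delta> :: "nat \<Rightarrow> ('a, 'b) cochain \<Rightarrow> ('a, 'b) cochain" where "\<delta>
    \<equiv> delta scaleA scaleB lact ract P lam"

lemma signed_l1_emb:
  assumes c: "c \<in> Ch n" and n: "1 \<le> n"
  shows "signed_l1 scaleA scaleB lact ract P lam n (E n c) = D_map n (E n c)"
proof -
  note p = emb_props[OF c n, of lam]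
  have "l1_twisted scaleA scaleB (0, \<pi>, P_op P) (int n - 2, fst (E n c), snd (E n c))
    = (- bracket 2 n \<pi> (fst (E n c)), proj (twist (fst (E n c))) + proj (bracket 2 (n - 1) \<mu> (snd (E n c))))"
    by (rule l1_twisted_eq[OF n p(1) gap_determined_proj[OF p(1,2) n] p(3)])
  then show ?thesis by (simp add: signed_l1_def D_map_def)
qed

text \<open>The bracket with \<pi> preserves gap-determined operations, and every value of p comes
  from \<open>emb_a\<close>. This makes the inverse in \<open>delta\<close> a genuine
  preimage.\<close>

lemma D_map_emb_in_image:
  assumes lam: "lam \<noteq> 0" and c: "c \<in> Ch n" and n: "1 \<le> n"
  shows "D_map n (E n c) \<in> E (n + 1) ` Ch (n + 1)"
proof -
  note p = emb_props[OF c n, of lam]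
  let ?F = "pm (int n - 2) (- bracket 2 n \<pi> (fst (E n c)))"
    and ?G = "pm (int n - 2) (twist (fst (E n c)) + bracket 2 (n - 1) \<mu> (snd (E n c)))"
  have "?F \<in> C (n + 1)"
    using bracket_in_C[OF \<pi>_in_C p(1)] by (intro pm_in_C uminus_in_C) simp
  moreover have "gap_determined (n + 1) ?F"
    using gap_determined_bracket[OF gap_determined_\<pi> p(2) _ n] by (intro gap_determined_pm
        gap_determined_uminus) simp
  moreover have "?G \<in> C (n + 1 - 1)"
    using bracket_in_C[OF \<mu>_in_C p(3)] twist_in_C[OF p(1)] n by (intro pm_in_C add_in_C) simp_all
  ultimately have "(?F, proj ?G) \<in> E (n + 1) ` Ch (n + 1)"
    using n by (intro emb_surj lam) auto
  then show ?thesis by (simp add: D_map_def pm_Pair additive_pm[OF additive_proj])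
qed

lemma delta_props:
  assumes lam: "lam \<noteq> 0" and c: "c \<in> Ch n" and n: "1 \<le> n"
  shows "\<delta> n c \<in> Ch (n + 1)" "E (n + 1) (\<delta> n c) = D_map n (E n c)"
proof -
  have "\<delta> n c = inv_into (Ch (n + 1)) (E (n + 1)) (D_map n (E n c))"
    using n by (simp add: delta_def signed_l1_emb[OF c n])
  then show "\<delta> n c \<in> Ch (n + 1)" "E (n + 1) (\<delta> n c) = D_map n (E n c)"
    using D_map_emb_in_image[OF lam c n] by (simp_all only: inv_into_into f_inv_into_f)
qed

text \<open>All identities hold for \<open>D_map\<close> and are carried over to the cochains by
  injectivity of the embedding.\<close>

lemma cochain_complex_delta:
  assumes lam: "lam \<noteq> 0"
  shows "cochain_complex sC Ch \<delta>"
proof -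
  note inj = inj_onD[OF inj_on_emb[OF lam]]
  have Ch0: "c = 0" if "c \<in> Ch 0" for c using that by (simp add: cochains_def)
  have \<delta>0: "\<delta> 0 c = 0" for c by (simp add: delta_def)
  have sub: "module.subspace sC (Ch n)" for n
    unfolding subspace_iff[OF module_cochain] using Ch_zero Ch_add Ch_scale by blast
  have closed: "\<delta> n c \<in> Ch (n + 1)" if "c \<in> Ch n" for n c
    using delta_props(1)[OF lam that] \<delta>0 Ch_zero by (cases "n = 0") auto
  have add: "\<delta> n (c + c') = \<delta> n c + \<delta> n c'" if c: "c \<in> Ch n" "c' \<in> Ch n" for n c c'
  proof (cases "n = 0")
    case False
    then have n: "1 \<le> n" by simp
    show ?thesis
    proof (rule inj[of "n + 1"])
      show "E (n + 1) (\<delta> n (c + c')) = E (n + 1) (\<delta> n c + \<delta> n c')"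
        by (simp only: emb_add delta_props(2)[OF lam _ n] c Ch_add additive.add[OF additive_D_map])
    qed (use c closed Ch_add in auto)
  qed (simp add: \<delta>0)
  have scale: "\<delta> n (sC r c) = sC r (\<delta> n c)" if c: "c \<in> Ch n" for n r c
  proof (cases "n = 0")
    case True
    then show ?thesis using module.scale_zero_right[OF module_cochain] by (simp add: \<delta>0)
  next
    case False
    then have n: "1 \<le> n" by simp
    show ?thesis
    proof (rule inj[of "n + 1"])
      show "E (n + 1) (\<delta> n (sC r c)) = E (n + 1) (sC r (\<delta> n c))"
        by (simp only: emb_scale delta_props(2)[OF lam _ n] c Ch_scale D_map_scale_op)
    qed (use c closed Ch_scale in auto)
  qed
  have emb0: "E n 0 = 0" for n
    using emb_add[of lam n 0 0] by simp
  have "\<delta> (n + 1) (\<delta> n c) = 0" if c: "c \<in> Ch n" for n c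
  proof (rule inj[of "n + 1 + 1"])
    have "E (n + 1 + 1) (\<delta> (n + 1) (\<delta> n c)) = D_map (n + 1) (E (n + 1) (\<delta> n c))"
      by (rule delta_props(2)[OF lam closed[OF c]]) simp
    also have "\<dots> = 0"
    proof (cases "n = 0")
      case True
      then show ?thesis by (simp only: \<delta>0 emb0 additive.zero[OF additive_D_map])
    next
      case False
      then have n: "1 \<le> n" by simp
      then show ?thesis
        using emb_props[OF c n, of lam] by (simp only: delta_props(2)[OF lam c n] D_map_D_map)
    qed
    finally show "E (n + 1 + 1) (\<delta> (n + 1) (\<delta> n c)) = E (n + 1 + 1) 0" by (simp only: emb0)
  qed (use closed[OF closed[OF c]] Ch_zero in auto)
  then show ?thesis
    unfolding cochain_complex_def using sub closed add scale by blast
qed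

end

text \<open>The first two parts validate the definition of \<open>delta\<close>: the embeddings are
  injective and land in the right degree, and the embedded coboundary is the prescribed element, so
  that \<open>inv_into\<close> does not return an arbitrary value on cochains.\<close>

theorem proposition6p2:
  fixes scaleA :: "'k::field_char_0 \<Rightarrow> 'a::ring \<Rightarrow> 'a"
    and scaleB :: "'k \<Rightarrow> 'b::ring \<Rightarrow> 'b"
    and lact :: "'a \<Rightarrow> 'b \<Rightarrow> 'b" and ract :: "'b \<Rightarrow> 'a \<Rightarrow> 'b"
    and P :: "'b \<Rightarrow> 'a" and lam :: 'k
  assumes "rel_averaging_algebra scaleA scaleB lact ract P lam"
    and "lam \<noteq> 0"
  shows "(\<forall>n\<ge>1. inj_on (emb scaleB lam n) (cochains scaleA scaleB n) \<and>
            emb scaleB lam n ` cochains scaleA scaleB n \<subseteq> sh_a scaleA scaleB (int n - 2))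
    \<and> (\<forall>n\<ge>1. \<forall>c\<in>cochains scaleA scaleB n.
          emb scaleB lam (n + 1) (delta scaleA scaleB lact ract P lam n c)
            = signed_l1 scaleA scaleB lact ract P lam n (emb scaleB lam n c))
    \<and> cochain_complex (scale_cochain scaleA scaleB) (cochains scaleA scaleB)
        (delta scaleA scaleB lact ract P lam)"
proof -
  interpret rel_averaging_char_0 scaleA scaleB lact ract P lam
    using assms(1) by (simp add: rel_averaging_char_0_def)
  show ?thesis
    using assms(2) by (auto simp: inj_on_emb emb_in_sh_a delta_props signed_l1_emb cochain_complex_delta simp del: One_nat_def add_Suc_right)
qed

end
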